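(* Let $(M,\mathcal{F})$ be an $\mathbb{R}$-covered foliation of a compact manifold $M$ by Riemannian leaves, having no compact leaves. Then the Liouville property holds for $(M,\mathcal{F})$; that is, every leafwise harmonic function on $M$ is constant on each leaf of $\mathcal{F}$.
   Context: Setting: $M$ is a compact (connected) manifold and $\mathcal{F}$ is a continuous foliation of $M$ whose leaves are $C^r$ Riemannian manifolds, $r\ge 2$; the Riemannian metrics on leaves and their derivatives along leaves up to order $r$ vary continuously on $M$. If $\partial M\neq\emptyset$, then $\partial M$ is a union of (compact) leaves of $\mathcal{F}$. A codimension-one foliation $\mathcal{F}$ of $M$ is $\mathbb{R}$-covered if the leaf space $\widetilde{M}/\widetilde{\mathcal{F}}$ (the quotient topological space identifying points on the same leaf) of the lifted foliation $\widetilde{\mathcal{F}}$ on the universal cover $\widetilde{M}$ is homeomorphic to $\mathbb{R}$. A leafwise harmonic function is a function $f:M\to\mathbb{R}$ that is continuous on $M$, $C^2$ on leaves, and whose restriction to each leaf is harmonic for the Laplace-Beltrami operator of that leaf. *)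

theory Defs
  imports "HOL-Analysis.Analysis"
begin

section \<open>Leafwise calculus in foliated coordinates\<close>

text \<open>
  Foliated coordinates are pairs \<open>(x, t)\<close> with \<open>x\<close> in \<open>real ^ 'n\<close> along the leaves and \<open>t\<close> in
  \<open>[0, \<infinity>)\<close> transverse to them. All derivatives below are taken in the \<open>x\<close> directions only, so
  they make sense on every \<open>\<Omega>\<close> whose slices \<open>{x. (x, t) \<in> \<Omega>}\<close> are open, also at \<open>t = 0\<close>.
\<close>

type_synonym 'n coords = "(real ^ 'n) \<times> real"

definition leaf_line :: "'n::finite \<Rightarrow> 'n coords \<Rightarrow> real \<Rightarrow> 'n coords"
  where "leaf_line i z s = (fst z + s *\<^sub>R axis i 1, snd z)"

definition leaf_partial ::
    "'n::finite \<Rightarrow> ('n coords \<Rightarrow> 'b::real_normed_vector) \<Rightarrow> 'n coords \<Rightarrow> 'b"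
  where "leaf_partial i F z = vector_derivative (\<lambda>s. F (leaf_line i z s)) (at 0)"

text \<open>
  \<open>leafwise_C k \<Omega> F\<close>: all iterated partial derivatives of \<open>F\<close> along the leaves of order at most
  \<open>k\<close> exist and are continuous on \<open>\<Omega>\<close>, jointly in \<open>x\<close> and \<open>t\<close>.  If \<open>\<Omega>\<close> lies in a single slice
  \<open>t = const\<close>, this is the ordinary notion of \<open>C\<^sup>k\<close> on that slice.
\<close>

primrec leafwise_C ::
    "nat \<Rightarrow> ('n::finite) coords set \<Rightarrow> ('n coords \<Rightarrow> 'b::real_normed_vector) \<Rightarrow> bool"
  where
    "leafwise_C 0 \<Omega> F \<longleftrightarrow> continuous_on \<Omega> F"
  | "leafwise_C (Suc k) \<Omega> F \<longleftrightarrow> continuous_on \<Omega> F \<and>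
       (\<forall>i. (\<forall>z\<in>\<Omega>. (\<lambda>s. F (leaf_line i z s)) differentiable (at 0)) \<and>
            leafwise_C k \<Omega> (leaf_partial i F))"


section \<open>Codimension-one foliations\<close>

type_synonym ('a, 'n) chart = "'a set \<times> ('a \<Rightarrow> 'n coords)"

text \<open>
  Charts take values in relatively open subsets of the half-space \<open>t \<ge> 0\<close>. Points with \<open>t > 0\<close> are
  interior points and points with \<open>t = 0\<close> are boundary points of the manifold, so the boundary
  (which may be empty) is a union of leaves.
\<close>

definition foliated_chart :: "'a::topological_space set \<Rightarrow> ('a, 'n::finite) chart \<Rightarrow> bool"
  where "foliated_chart M = (\<lambda>(U, \<phi>).
           openin (top_of_set M) U \<and>
           openin (top_of_set (UNIV \<times> {0..})) (\<phi> ` U) \<and>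
           (\<exists>\<psi>. homeomorphism U (\<phi> ` U) \<phi> \<psi>))"

definition chart_inv :: "('a, 'n::finite) chart \<Rightarrow> 'n coords \<Rightarrow> 'a"
  where "chart_inv c = inv_into (fst c) (snd c)"

definition transition ::
    "('a, 'n::finite) chart \<Rightarrow> ('a, 'n) chart \<Rightarrow> 'n coords \<Rightarrow> 'n coords"
  where "transition c d = snd d \<circ> chart_inv c"

text \<open>
  Coordinate changes have locally the form \<open>(x, t) \<mapsto> (\<xi> (x, t), h t)\<close> with \<open>\<xi>\<close> of class \<open>C\<^sup>r\<close>
  along the leaves; transversally they are only continuous.
\<close>

definition foliated_atlas ::
    "nat \<Rightarrow> 'a::topological_space set \<Rightarrow> ('a, 'n::finite) chart set \<Rightarrow> bool"
  where "foliated_atlas r M A \<longleftrightarrow>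
           (\<forall>c\<in>A. foliated_chart M c) \<and>
           (\<Union>c\<in>A. fst c) = M \<and>
           (\<forall>c\<in>A. \<forall>d\<in>A. let \<Omega> = snd c ` (fst c \<inter> fst d); \<tau> = transition c d in
              leafwise_C r \<Omega> (\<lambda>z. fst (\<tau> z)) \<and>
              (\<forall>z\<in>\<Omega>. \<exists>N h. openin (top_of_set \<Omega>) N \<and> z \<in> N \<and> (\<forall>w\<in>N. snd (\<tau> w) = h (snd w))))"

text \<open>
  The leaf topology on the underlying set of the manifold is generated by the open subsets of the
  plaques. Leaves are its connected components, and a compact leaf is one that is compact in the leaf
  topology, i.e.\ as a manifold.
\<close>

definition leaf_topology :: "('a, 'n::finite) chart set \<Rightarrow> 'a topology"
  where "leaf_topology A =
           topology_generated_by {{m \<in> U. \<phi> m \<in> B \<times> {t}} |U \<phi> B t. (U, \<phi>) \<in> A \<and> open B}"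

definition leaves :: "('a, 'n::finite) chart set \<Rightarrow> 'a set set"
  where "leaves A = connected_components_of (leaf_topology A)"

definition compact_leaf :: "('a, 'n::finite) chart set \<Rightarrow> 'a set \<Rightarrow> bool"
  where "compact_leaf A L \<longleftrightarrow> L \<in> leaves A \<and> compactin (leaf_topology A) L"


section \<open>\<open>\<real>\<close>-covered foliations\<close>

definition partition_topology :: "'a topology \<Rightarrow> 'a set set \<Rightarrow> 'a set topology"
  where "partition_topology X P = topology (\<lambda>\<U>. \<U> \<subseteq> P \<and> openin X (\<Union>\<U>))"

lemma openin_partition_topology:
  assumes "pairwise disjnt P"
  shows "openin (partition_topology X P) \<U> \<longleftrightarrow> \<U> \<subseteq> P \<and> openin X (\<Union>\<U>)"
proof -
  have "istopology (\<lambda>\<U>. \<U> \<subseteq> P \<and> openin X (\<Union>\<U>))"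
    unfolding istopology_def
  proof (intro conjI allI impI)
    fix S T assume S: "S \<subseteq> P \<and> openin X (\<Union>S)" and T: "T \<subseteq> P \<and> openin X (\<Union>T)"
    have "\<Union>(S \<inter> T) = \<Union>S \<inter> \<Union>T"
    proof
      show "\<Union>S \<inter> \<Union>T \<subseteq> \<Union>(S \<inter> T)"
      proof
        fix x assume "x \<in> \<Union>S \<inter> \<Union>T"
        then obtain a b where ab: "a \<in> S" "b \<in> T" "x \<in> a" "x \<in> b" by blast
        then have "a = b"
          using assms S T by (auto simp: pairwise_def disjnt_def)
        with ab show "x \<in> \<Union>(S \<inter> T)" by blast
      qed
    qed blast
    then show "openin X (\<Union>(S \<inter> T))" using S T by (simp add: openin_Int)
    show "S \<inter> T \<subseteq> P" using S by blast
  next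
    fix K assume K: "\<forall>S\<in>K. S \<subseteq> P \<and> openin X (\<Union>S)"
    then show "\<Union>K \<subseteq> P" by blast
    have "\<Union>(\<Union>K) = \<Union>(Union ` K)" by blast
    then show "openin X (\<Union>(\<Union>K))" using K by (simp only:) (rule openin_Union, blast)
  qed
  then show ?thesis
    by (simp add: partition_topology_def)
qed

text \<open>The quotient of the manifold \<open>M\<close> that identifies points on the same leaf.\<close>

definition leaf_space ::
    "'a::topological_space set \<Rightarrow> ('a, 'n::finite) chart set \<Rightarrow> 'a set topology"
  where "leaf_space M A = partition_topology (top_of_set M) (leaves A)"

lemma openin_leaf_space:
  "openin (leaf_space M A) \<U> \<longleftrightarrow> \<U> \<subseteq> leaves A \<and> openin (top_of_set M) (\<Union>\<U>)"
  unfolding leaf_space_def leaves_def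
  by (intro openin_partition_topology pairwise_disjoint_connected_components_of)

definition universal_cover ::
    "'c::topological_space set \<Rightarrow> ('c \<Rightarrow> 'a::topological_space) \<Rightarrow> 'a set \<Rightarrow> bool"
  where "universal_cover C p M \<longleftrightarrow> covering_space C p M \<and> simply_connected C"

definition lifted_atlas ::
    "'c::topological_space set \<Rightarrow> ('c \<Rightarrow> 'a::topological_space) \<Rightarrow> ('a, 'n::finite) chart set
      \<Rightarrow> ('c, 'n) chart set"
  where "lifted_atlas C p A =
           {(V, \<phi> \<circ> p) |V U \<phi>. (U, \<phi>) \<in> A \<and> openin (top_of_set C) V \<and> p ` V \<subseteq> U \<and>
              (\<exists>q. homeomorphism V (p ` V) p q)}"

definition R_covered ::
    "'c::topological_space set \<Rightarrow> ('c \<Rightarrow> 'a::topological_space) \<Rightarrow> ('a, 'n::finite) chart set \<Rightarrow> bool"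
  where "R_covered C p A \<longleftrightarrow> leaf_space C (lifted_atlas C p A) homeomorphic_space euclideanreal"


section \<open>Leafwise Riemannian metrics and harmonic functions\<close>

text \<open>
  A leafwise metric is given by its coefficient matrix \<open>g c\<close> in every chart \<open>c\<close> of the atlas; on
  overlaps the matrices are related by the usual transformation law of a covariant 2-tensor.
\<close>

definition leafwise_metric ::
    "nat \<Rightarrow> ('a, 'n::finite) chart set \<Rightarrow> (('a, 'n) chart \<Rightarrow> 'n coords \<Rightarrow> real ^ 'n ^ 'n) \<Rightarrow> bool"
  where "leafwise_metric r A g \<longleftrightarrow>
           (\<forall>c\<in>A. leafwise_C r (snd c ` fst c) (g c) \<and>
              (\<forall>z \<in> snd c ` fst c. transpose (g c z) = g c z \<and> (\<forall>v. v \<noteq> 0 \<longrightarrow> 0 < v \<bullet> (g c z *v v)))) \<and>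
           (\<forall>c\<in>A. \<forall>d\<in>A. \<forall>(x, t) \<in> snd c ` (fst c \<inter> fst d).
              let J = jacobian (\<lambda>y. fst (transition c d (y, t))) (at x) in
                g c (x, t) = transpose J ** g d (transition c d (x, t)) ** J)"

text \<open>
  In coordinates \<open>\<Delta>u = |g|\<^sup>-\<^sup>1\<^sup>/\<^sup>2 \<Sum>\<^sub>i \<partial>\<^sub>i (|g|\<^sup>1\<^sup>/\<^sup>2 \<Sum>\<^sub>j g\<^sup>i\<^sup>j \<partial>\<^sub>j u)\<close> with \<open>|g| = det g\<close>.
\<close>

definition laplace_beltrami ::
    "(('n::finite) coords \<Rightarrow> real ^ 'n ^ 'n) \<Rightarrow> ('n coords \<Rightarrow> real) \<Rightarrow> 'n coords \<Rightarrow> real"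
  where "laplace_beltrami G u z =
           (\<Sum>i\<in>UNIV. leaf_partial i
              (\<lambda>w. sqrt (det (G w)) * (\<Sum>j\<in>UNIV. matrix_inv (G w) $ i $ j * leaf_partial j u w)) z)
           / sqrt (det (G z))"

definition leafwise_harmonic ::
    "'a::topological_space set \<Rightarrow> ('a, 'n::finite) chart set
      \<Rightarrow> (('a, 'n) chart \<Rightarrow> 'n coords \<Rightarrow> real ^ 'n ^ 'n) \<Rightarrow> ('a \<Rightarrow> real) \<Rightarrow> bool"
  where "leafwise_harmonic M A g f \<longleftrightarrow>
           continuous_on M f \<and>
           (\<forall>c\<in>A. let \<Omega> = snd c ` fst c; u = f \<circ> chart_inv c in
              (\<forall>t. leafwise_C 2 {z \<in> \<Omega>. snd z = t} u) \<and>
              (\<forall>z\<in>\<Omega>. laplace_beltrami (g c) u z = 0))"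

definition liouville_property ::
    "'a::topological_space set \<Rightarrow> ('a, 'n::finite) chart set
      \<Rightarrow> (('a, 'n) chart \<Rightarrow> 'n coords \<Rightarrow> real ^ 'n ^ 'n) \<Rightarrow> bool"
  where "liouville_property M A g \<longleftrightarrow>
           (\<forall>f. leafwise_harmonic M A g f \<longrightarrow> (\<forall>L\<in>leaves A. f constant_on L))"

end

theory Submission
  imports Defs
begin

text \<open>
  Let \<open>f\<close> be leafwise harmonic. By Hopf's strong maximum principle the sets \<open>K\<^sub>1\<close> and \<open>K\<^sub>2\<close> on which
  \<open>f\<close> attains its maximum and its minimum are closed and saturated, so it suffices that they meet.
  Suppose they are disjoint. Their preimages in the cover project to disjoint closed sets \<open>X\<close>, \<open>Y\<close> in
  the leaf space \<open>\<real>\<close>. Let \<open>E\<close> be the set of all points of \<open>X\<close> that are joined to a point of \<open>Y\<close> by an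
  interval whose interior misses \<open>X \<union> Y\<close>. By connectedness of \<open>\<real>\<close>, \<open>E\<close> is nonempty, and it has no
  accumulation points, since such a point would lie in both \<open>X\<close> and \<open>Y\<close>. Lifting paths shows that the
  preimage of \<open>E\<close> is a union of fibres of the covering, so a leaf below a point of \<open>E\<close> meets every small
  compact box of \<open>M\<close> in finitely many plaques. As \<open>M\<close> is compact, this leaf is compact, which is
  excluded.
\<close>

section \<open>The strong maximum principle\<close>

text \<open>The maximum and the minimum set are used together because the ends of the complementary
  intervals of a single closed subset of the line may accumulate, as for a Cantor set, while ends
  that face a second, disjoint closed set may not. The obstacle is then to find a discrete set in
  the leaf space that is determined by \<open>M\<close> alone: a deck transformation acts on the
  line by a homeomorphism that may reverse it and distort distances, so neither a left end nor a
  longest gap is an invariant notion. Being an end of a gap is one. It amounts to the existence of a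
  path in \<open>M\<close> that starts at the given point of \<open>K1\<close>, ends in
  \<open>K2\<close> and meets both sets only at its two ends. Such a path can be lifted from every
  point of the fibre. Since \<open>K1\<close> and \<open>K2\<close> are saturated, whether a lifted
  path is over one of the two closed sets of the line can be read off from its projection, and the
  intermediate value theorem turns the lifted path back into a gap.\<close>

text \<open>The partial derivatives are carried as data, so that a second-order hypothesis is the
  same predicate applied to each \<open>f' j\<close>. Derivatives along the axes are what
  \<open>leafwise_C\<close> provides; other directions are derived from them on open sets.\<close>

definition C1_along_axes ::
    "(real ^ 'n) set \<Rightarrow> (real ^ 'n \<Rightarrow> real) \<Rightarrow> ('n::finite \<Rightarrow> real ^ 'n \<Rightarrow> real) \<Rightarrow> bool"
  where "C1_along_axes S f f' \<longleftrightarrow> continuous_on S f \<and> (\<forall>i. continuous_on S (f' i) \<and>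
    (\<forall>x\<in>S. ((\<lambda>s. f (x + s *\<^sub>R axis i 1)) has_real_derivative f' i x) (at 0)))"

lemma C1_along_axesD:
  assumes "C1_along_axes S f f'"
  shows "continuous_on S f" "continuous_on S (f' i)"
    "x \<in> S \<Longrightarrow> ((\<lambda>s. f (x + s *\<^sub>R axis i 1)) has_real_derivative f' i x) (at 0)"
  using assms unfolding C1_along_axes_def by blast+

lemma C1_along_axes_subset:
  "\<lbrakk>C1_along_axes S f f'; T \<subseteq> S\<rbrakk> \<Longrightarrow> C1_along_axes T f f'"
  unfolding C1_along_axes_def by (meson continuous_on_subset subsetD)

lemma C1_along_axes_const: "C1_along_axes S (\<lambda>x. c) (\<lambda>i x. 0)"
  unfolding C1_along_axes_def by (auto intro!: continuous_intros)

lemma C1_along_axes_add: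
  "\<lbrakk>C1_along_axes S f f'; C1_along_axes S g g'\<rbrakk> \<Longrightarrow>
    C1_along_axes S (\<lambda>x. f x + g x) (\<lambda>i x. f' i x + g' i x)"
  unfolding C1_along_axes_def by (auto intro!: continuous_intros DERIV_add)

lemma C1_along_axes_mult:
  assumes f: "C1_along_axes S f f'" and g: "C1_along_axes S g g'"
  shows "C1_along_axes S (\<lambda>x. f x * g x) (\<lambda>i x. f' i x * g x + g' i x * f x)"
  unfolding C1_along_axes_def
proof (intro conjI allI ballI)
  fix i x assume x: "x \<in> S"
  show "((\<lambda>s. f (x + s *\<^sub>R axis i 1) * g (x + s *\<^sub>R axis i 1)) has_real_derivative
      f' i x * g x + g' i x * f x) (at 0)"
    using DERIV_mult[OF C1_along_axesD(3)[OF f x] C1_along_axesD(3)[OF g x]] by simp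
qed (use C1_along_axesD[OF f] C1_along_axesD[OF g] in \<open>auto intro!: continuous_intros\<close>)

lemma C1_along_axes_sum:
  assumes "finite I" "\<And>k. k \<in> I \<Longrightarrow> C1_along_axes S (f k) (f' k)"
  shows "C1_along_axes S (\<lambda>x. \<Sum>k\<in>I. f k x) (\<lambda>i x. \<Sum>k\<in>I. f' k i x)"
  using assms
proof (induction I)
  case empty
  then show ?case using C1_along_axes_const[of S 0] by simp
next
  case (insert k I)
  then show ?case
    using C1_along_axes_add[of S "f k" "f' k" "\<lambda>x. \<Sum>k\<in>I. f k x" "\<lambda>i x. \<Sum>k\<in>I. f' k i x"] by simp
qed

lemma C1_along_axes_prod:
  assumes "finite I" "\<And>k. k \<in> I \<Longrightarrow> \<exists>f'. C1_along_axes S (f k) f'"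
  shows "\<exists>f'. C1_along_axes S (\<lambda>x. \<Prod>k\<in>I. f k x) f'"
  using assms
proof (induction I)
  case empty
  then show ?case using C1_along_axes_const[of S 1] by auto
next
  case (insert k I)
  obtain u where u: "C1_along_axes S (f k) u" using insert.prems by blast
  obtain v where v: "C1_along_axes S (\<lambda>x. \<Prod>k\<in>I. f k x) v" using insert.IH insert.prems by blast
  from C1_along_axes_mult[OF u v] show ?case using insert.hyps by auto
qed

lemma C1_along_axes_compose:
  fixes \<phi> :: "real \<Rightarrow> real"
  assumes f: "C1_along_axes S f f'"
    and \<phi>: "\<And>x. x \<in> S \<Longrightarrow> (\<phi> has_real_derivative \<phi>' (f x)) (at (f x))"
    and cont: "continuous_on (f ` S) \<phi>'"
  shows "C1_along_axes S (\<lambda>x. \<phi> (f x)) (\<lambda>i x. \<phi>' (f x) * f' i x)"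
  unfolding C1_along_axes_def
proof (intro conjI allI ballI)
  fix i x assume x: "x \<in> S"
  have "(\<phi> has_real_derivative \<phi>' (f x)) (at (f (x + 0 *\<^sub>R axis i 1)))" using \<phi>[OF x] by simp
  from DERIV_chain2[OF this C1_along_axesD(3)[OF f x, of i]]
  show "((\<lambda>s. \<phi> (f (x + s *\<^sub>R axis i 1))) has_real_derivative \<phi>' (f x) * f' i x) (at 0)" .
next
  fix i
  have "continuous_on S (\<phi>' \<circ> f)"
    using C1_along_axesD(1)[OF f] cont by (rule continuous_on_compose)
  then show "continuous_on S (\<lambda>x. \<phi>' (f x) * f' i x)"
    using C1_along_axesD(2)[OF f] by (auto intro!: continuous_intros simp: o_def)
  have "continuous_on (f ` S) \<phi>"
    using \<phi> by (auto intro!: continuous_at_imp_continuous_on DERIV_isCont)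
  from continuous_on_compose[OF C1_along_axesD(1)[OF f] this]
  show "continuous_on S (\<lambda>x. \<phi> (f x))" by (simp add: o_def)
qed

lemma axis_line_deriv:
  assumes f: "C1_along_axes S f f'" and x: "x + s *\<^sub>R axis i 1 \<in> S"
  shows "((\<lambda>r. f (x + r *\<^sub>R axis i 1)) has_real_derivative f' i (x + s *\<^sub>R axis i 1)) (at s)"
proof -
  have "((\<lambda>r. f (x + (r + s) *\<^sub>R axis i 1)) has_real_derivative f' i (x + s *\<^sub>R axis i 1)) (at 0)"
    using C1_along_axesD(3)[OF f x, of i] by (simp add: algebra_simps)
  then show ?thesis
    using DERIV_shift[of "\<lambda>r. f (x + r *\<^sub>R axis i 1)" _ 0 s] by simp
qed

text \<open>No coordinate of a point on the staircase from 0 to \<open>h\<close> exceeds that of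
  \<open>h\<close> in absolute value, so the staircase stays in every ball about 0 that contains
  \<open>h\<close>.\<close>

lemma norm_sum_axis_le:
  fixes h :: "real ^ 'n::finite"
  assumes "k \<notin> I" "\<bar>t\<bar> \<le> \<bar>h $ k\<bar>"
  shows "norm ((\<Sum>i\<in>I. h $ i *\<^sub>R axis i (1::real)) + t *\<^sub>R axis k 1) \<le> norm h"
proof (rule norm_le_componentwise_cart)
  fix j
  have fin: "finite I" by simp
  have "((\<Sum>i\<in>I. h $ i *\<^sub>R axis i (1::real)) + t *\<^sub>R axis k 1) $ j
      = (\<Sum>i\<in>I. if i = j then h $ j else 0) + (if j = k then t else 0)"
    by (simp add: axis_def if_distrib cong: if_cong)
  also have "\<dots> = (if j \<in> I then h $ j else 0) + (if j = k then t else 0)"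
    using fin by (simp add: sum.delta')
  finally show "norm (((\<Sum>i\<in>I. h $ i *\<^sub>R axis i (1::real)) + t *\<^sub>R axis k 1) $ j) \<le> norm (h $ j)"
    using assms by (auto split: if_splits)
qed

text \<open>Walk from \<open>x\<close> to \<open>x + h\<close> parallel to the axes;
  \<open>I\<close> is the set of coordinates already changed. On each edge the mean value inequality
  is combined with continuity of one partial derivative at \<open>x\<close>.\<close>

lemma C1_along_axes_imp_has_derivative:
  fixes f :: "real ^ 'n::finite \<Rightarrow> real"
  assumes S: "open S" and f: "C1_along_axes S f f'" and x: "x \<in> S"
  shows "(f has_derivative (\<lambda>h. \<Sum>i\<in>UNIV. h $ i * f' i x)) (at x)"
proof -
  let ?h = "\<lambda>I (h::real^'n). \<Sum>i\<in>I. h $ i *\<^sub>R axis i (1::real)"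
  have main: "\<forall>e>0. \<exists>d>0. \<forall>h. norm h < d \<longrightarrow>
      \<bar>f (x + ?h I h) - f x - (\<Sum>i\<in>I. h $ i * f' i x)\<bar> \<le> e * norm h" if "finite I" for I
    using that
  proof (induction I)
    case empty
    then show ?case by (auto intro!: exI[of _ 1])
  next
    case (insert k I)
    show ?case
    proof (intro allI impI)
      fix e :: real assume e: "e > 0"
      obtain d1 where d1: "d1 > 0" "\<And>h. norm h < d1 \<Longrightarrow>
          \<bar>f (x + ?h I h) - f x - (\<Sum>i\<in>I. h $ i * f' i x)\<bar> \<le> e/2 * norm h"
        using insert.IH e by (meson half_gt_zero)
      obtain d2 where d2: "d2 > 0" "ball x d2 \<subseteq> S" using S x open_contains_ball by blast
      have "continuous_on S (f' k)" using C1_along_axesD(2)[OF f] .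
      then have "isCont (f' k) x" using S x continuous_on_eq_continuous_at by blast
      then obtain d3 where d3: "d3 > 0" "\<And>y. norm (y - x) < d3 \<Longrightarrow> \<bar>f' k y - f' k x\<bar> < e/2"
        using e unfolding continuous_at_eps_delta dist_norm by (metis half_gt_zero real_norm_def)
      define d where "d = min d1 (min d2 d3)"
      have d: "d > 0" "d \<le> d1" "d \<le> d2" "d \<le> d3" using d1 d2 d3 by (auto simp: d_def)
      have "\<bar>f (x + ?h (insert k I) h) - f x - (\<Sum>i\<in>insert k I. h $ i * f' i x)\<bar> \<le> e * norm h"
        if h: "norm h < d" for h :: "real^'n"
      proof -
        define y where "y = x + ?h I h"
        \<comment> \<open>Removing the linear part leaves a function whose derivative is the
          oscillation of \<open>f' k\<close> near \<open>x\<close>, at most \<open>e/2\<close> along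
          the edge. The other \<open>e/2\<close> pays for the earlier edges.\<close>
        define g where "g t = f (y + t *\<^sub>R axis k 1) - t * f' k x" for t
        have near: "norm (y + t *\<^sub>R axis k 1 - x) < d" if "\<bar>t\<bar> \<le> \<bar>h $ k\<bar>" for t
          using norm_sum_axis_le[OF insert(2) that] h unfolding y_def by (simp add: algebra_simps)
        have inS: "y + t *\<^sub>R axis k 1 \<in> S" if "\<bar>t\<bar> \<le> \<bar>h $ k\<bar>" for t
        proof -
          have "y + t *\<^sub>R axis k 1 \<in> ball x d2"
            using near[OF that] d(3) by (simp add: dist_norm norm_minus_commute)
          then show ?thesis using d2 by blast
        qed
        have dg: "(g has_real_derivative (f' k (y + t *\<^sub>R axis k 1) - f' k x)) (at t)" if "\<bar>t\<bar> \<le> \<bar>h $ k\<bar>" for t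
          unfolding g_def using axis_line_deriv[OF f inS[OF that]]
          by (auto intro!: derivative_eq_intros)
        have "norm (g (h $ k) - g 0) \<le> e/2 * norm (h $ k - 0)"
        proof (rule field_differentiable_bound[of "closed_segment 0 (h $ k)"])
          fix t assume "t \<in> closed_segment 0 (h $ k)"
          then have t: "\<bar>t\<bar> \<le> \<bar>h $ k\<bar>" by (auto simp: closed_segment_eq_real_ivl split: if_splits)
          show "(g has_field_derivative (f' k (y + t *\<^sub>R axis k 1) - f' k x)) (at t within closed_segment 0 (h $ k))"
            using dg[OF t] DERIV_subset by blast
          show "norm (f' k (y + t *\<^sub>R axis k 1) - f' k x) \<le> e/2"
            using d3(2)[of "y + t *\<^sub>R axis k 1"] near[OF t] d(4) by simp
        qed auto
        then have 1: "\<bar>f (y + h $ k *\<^sub>R axis k 1) - h $ k * f' k x - f y\<bar> \<le> e/2 * \<bar>h $ k\<bar>"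
          by (simp add: g_def)
        have 2: "\<bar>f y - f x - (\<Sum>i\<in>I. h $ i * f' i x)\<bar> \<le> e/2 * norm h"
          unfolding y_def using d1(2)[of h] h d by simp
        have 3: "\<bar>h $ k\<bar> \<le> norm h" using component_le_norm_cart[of h k] .
        have eq: "x + ?h (insert k I) h = y + h $ k *\<^sub>R axis k 1"
          unfolding y_def using insert by (simp add: algebra_simps)
        have "\<bar>f (x + ?h (insert k I) h) - f x - (\<Sum>i\<in>insert k I. h $ i * f' i x)\<bar>
          = \<bar>(f (y + h $ k *\<^sub>R axis k 1) - h $ k * f' k x - f y) + (f y - f x - (\<Sum>i\<in>I. h $ i * f' i x))\<bar>"
          unfolding eq using insert.hyps by (simp add: algebra_simps)
        also have "\<dots> \<le> e/2 * \<bar>h $ k\<bar> + e/2 * norm h"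
          using 1 2 by linarith
        also have "\<dots> \<le> e * norm h"
          using mult_left_mono[OF 3, of "e/2"] e by (simp add: field_simps)
        finally show ?thesis .
      qed
      then show "\<exists>d>0. \<forall>h. norm h < d \<longrightarrow>
        \<bar>f (x + ?h (insert k I) h) - f x - (\<Sum>i\<in>insert k I. h $ i * f' i x)\<bar> \<le> e * norm h"
        using d by blast
    qed
  qed
  have sum: "?h UNIV h = h" for h :: "real^'n"
    using basis_expansion[of h] by (simp add: scalar_mult_eq_scaleR)
  have bl: "bounded_linear (\<lambda>h::real^'n. \<Sum>i\<in>UNIV. h $ i * f' i x)"
    by (intro bounded_linear_sum bounded_linear_mult_left[THEN bounded_linear_compose] bounded_linear_vec_nth)
  show ?thesis
    unfolding has_derivative_at_alt
  proof (intro conjI allI impI bl)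
    fix e :: real assume "e > 0"
    then obtain d where d: "d > 0" "\<And>h. norm h < d \<Longrightarrow>
      \<bar>f (x + h) - f x - (\<Sum>i\<in>UNIV. h $ i * f' i x)\<bar> \<le> e * norm h"
      using main[of UNIV] unfolding sum by (meson finite)
    then show "\<exists>d>0. \<forall>y. norm (y - x) < d \<longrightarrow>
         norm (f y - f x - (\<Sum>i\<in>UNIV. (y - x) $ i * f' i x)) \<le> e * norm (y - x)"
      using d(2)[of "_ - x"] by (intro exI[of _ d]) (simp del: vector_minus_component)
  qed
qed

lemma line_deriv:
  fixes f :: "real ^ 'n::finite \<Rightarrow> real"
  assumes S: "open S" and f: "C1_along_axes S f f'" and x: "x + s *\<^sub>R v \<in> S"
  shows "((\<lambda>r. f (x + r *\<^sub>R v)) has_real_derivative (\<Sum>i\<in>UNIV. v $ i * f' i (x + s *\<^sub>R v))) (at s)"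
proof -
  have "((\<lambda>r. x + r *\<^sub>R v) has_derivative (\<lambda>r. r *\<^sub>R v)) (at s)"
    by (auto intro!: derivative_eq_intros)
  from has_derivative_compose[OF this C1_along_axes_imp_has_derivative[OF S f x]]
  have "((\<lambda>r. f (x + r *\<^sub>R v)) has_derivative (\<lambda>r. \<Sum>i\<in>UNIV. (r *\<^sub>R v) $ i * f' i (x + s *\<^sub>R v))) (at s)" .
  then show ?thesis
    unfolding has_field_derivative_def
    by (rule has_derivative_eq_rhs) (simp add: fun_eq_iff sum_distrib_left mult_ac)
qed

section \<open>Second-order conditions at a maximum\<close>

text \<open>If \<open>q\<close> were positive, \<open>\<psi>\<close> would be positive just to the
  right of its zero at 0, and \<open>\<phi>\<close> would increase there.\<close>

lemma second_derivative_at_max: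
  fixes \<phi> \<psi> :: "real \<Rightarrow> real"
  assumes d: "d > 0" and \<phi>: "\<And>s. \<bar>s\<bar> < d \<Longrightarrow> (\<phi> has_real_derivative \<psi> s) (at s)"
    and \<psi>: "(\<psi> has_real_derivative q) (at 0)"
    and max: "\<And>s. \<bar>s\<bar> < d \<Longrightarrow> \<phi> s \<le> \<phi> 0"
  shows "\<psi> 0 = 0" "q \<le> 0"
proof -
  show 0: "\<psi> 0 = 0"
    by (rule DERIV_local_max[OF \<phi>[of 0] d]) (use d max in auto)
  show "q \<le> 0"
  proof (rule ccontr)
    assume "\<not> q \<le> 0"
    then have "q > 0" by simp
    from DERIV_pos_inc_right[OF \<psi> this] obtain e where e: "e > 0" "\<And>h. \<lbrakk>h > 0; h < e\<rbrakk> \<Longrightarrow> \<psi> h > 0"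
      using 0 by auto
    define t where "t = min d e / 2"
    have t: "t > 0" "t < d" "t < e" using d e by (auto simp: t_def)
    have "\<phi> 0 < \<phi> t"
    proof (rule DERIV_pos_imp_increasing_open[OF t(1)])
      show "\<exists>y. (\<phi> has_real_derivative y) (at s) \<and> 0 < y" if "0 < s" "s < t" for s
        using \<phi>[of s] e(2)[of s] that t by auto
      show "continuous_on {0..t} \<phi>"
      proof (intro continuous_at_imp_continuous_on ballI)
        fix s assume "s \<in> {0..t}"
        then show "isCont \<phi> s" using t by (intro DERIV_isCont[OF \<phi>]) auto
      qed
    qed
    then show False using max[of t] t by simp
  qed
qed

text \<open>Completing squares, as in a Cholesky factorisation that tolerates zero pivots. Rows
  outside \<open>I\<close> vanish, and each step clears the row of one index \<open>k\<close>. The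
  result splits a contraction with \<open>A\<close> into contributions of single directions.\<close>

lemma psd_sum_of_squares:
  fixes A :: "'n::finite \<Rightarrow> 'n \<Rightarrow> real"
  assumes "\<And>i j. A i j = A j i" "\<And>v. 0 \<le> (\<Sum>i\<in>UNIV. \<Sum>j\<in>UNIV. v i * A i j * v j)"
  shows "\<exists>V :: 'n \<Rightarrow> 'n \<Rightarrow> real. \<forall>i j. A i j = (\<Sum>k\<in>UNIV. V k i * V k j)"
proof -
  have "\<exists>V. \<forall>i j. A i j = (\<Sum>k\<in>I. V k i * V k j)"
    if "finite I" "\<And>i j. A i j = A j i" "\<And>v. 0 \<le> (\<Sum>i\<in>UNIV. \<Sum>j\<in>UNIV. v i * A i j * v j)"
       "\<And>i j. i \<notin> I \<Longrightarrow> A i j = 0" for I and A :: "'n \<Rightarrow> 'n \<Rightarrow> real"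
    using that
  proof (induction I arbitrary: A)
    case empty
    then show ?case by simp
  next
    case (insert k I A)
    note sym = insert.prems(1) and psd = insert.prems(2) and zero = insert.prems(3)
    define Q where "Q v = (\<Sum>i\<in>UNIV. \<Sum>j\<in>UNIV. v i * A i j * v j)" for v
    have Qadd: "Q (\<lambda>i. v i + (if i = k then s else 0)) = Q v + 2 * s * (\<Sum>i\<in>UNIV. v i * A i k) + s\<^sup>2 * A k k" for v s
    proof -
      have "(v i + (if i = k then s else 0)) * A i j * (v j + (if j = k then s else 0))
        = v i * A i j * v j + (if j = k then s * (v i * A i k) else 0)
          + ((if i = k then s * (A k j * v j) else 0) + (if j = k then if i = k then s\<^sup>2 * A k k else 0 else 0))" for i j
        by (auto simp: algebra_simps power2_eq_square)
      then have "Q (\<lambda>i. v i + (if i = k then s else 0)) = Q v + (\<Sum>i\<in>UNIV. s * (v i * A i k))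
          + ((\<Sum>i\<in>UNIV. \<Sum>j\<in>UNIV. (if i = k then s * (A k j * v j) else 0)) + s\<^sup>2 * A k k)"
        unfolding Q_def by (simp add: sum.distrib)
      also have "(\<Sum>i\<in>UNIV. \<Sum>j\<in>UNIV. (if i = k then s * (A k j * v j) else 0)) = (\<Sum>j\<in>UNIV. s * (A k j * v j))"
        by (subst sum.swap) simp
      also have "\<dots> = s * (\<Sum>i\<in>UNIV. v i * A i k)"
        using sym by (simp add: sum_distrib_left mult.commute)
      finally show ?thesis by (simp add: sum_distrib_left mult_ac)
    qed
    show ?case
    proof (cases "A k k = 0")
      case True
      have "A k j = 0" for j
      proof (rule ccontr)
        assume nz: "A k j \<noteq> 0"
        define v where "v i = (if i = j then 1 else 0 :: real)" for i
        have *: "(\<Sum>i\<in>UNIV. v i * A i k) = A j k" unfolding v_def by (simp add: if_distrib[where f = "\<lambda>x. x * _"] cong: if_cong)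
        \<comment> \<open>With a zero pivot the form is affine in \<open>s\<close> with slope
          \<open>2 * A j k\<close>; this \<open>s\<close> gives it the value -1.\<close>
        define s where "s = - (Q v + 1) / (2 * A j k)"
        have "Q v + 2 * s * A j k = -1"
          using nz sym[of k j] by (simp add: s_def field_simps)
        moreover have "0 \<le> Q v + 2 * s * A j k"
          using psd[of "\<lambda>i. v i + (if i = k then s else 0)"] Qadd[of v s] True * unfolding Q_def by simp
        ultimately show False by simp
      qed
      then have "\<And>i j. i \<notin> I \<Longrightarrow> A i j = 0" using zero by (metis insertE)
      then obtain V where V: "\<forall>i j. A i j = (\<Sum>k\<in>I. V k i * V k j)"
        using insert.IH[OF sym psd] by blast
      define W where "W l = (if l = k then (\<lambda>_. 0) else V l)" for l
      have "(\<Sum>l\<in>I. W l i * W l j) = (\<Sum>l\<in>I. V l i * V l j)" for i j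
        by (rule sum.cong) (use insert.hyps in \<open>auto simp: W_def\<close>)
      then have "\<forall>i j. A i j = (\<Sum>l\<in>insert k I. W l i * W l j)"
        using V insert.hyps by (simp add: W_def)
      then show ?thesis by blast
    next
      case False
      have "Q (\<lambda>i. 0 + (if i = k then 1 else 0)) = A k k" using Qadd[of "\<lambda>_. 0" 1] by (simp add: Q_def)
      then have pos: "A k k > 0"
        using psd[of "\<lambda>i. 0 + (if i = k then 1 else 0)"] False unfolding Q_def by linarith
      \<comment> \<open>The Schur complement of the pivot, whose row \<open>k\<close>
        vanishes.\<close>
      define B where "B i j = A i j - A i k * A j k / A k k" for i j
      have QB: "(\<Sum>i\<in>UNIV. \<Sum>j\<in>UNIV. v i * B i j * v j) = Q v - (\<Sum>i\<in>UNIV. v i * A i k)\<^sup>2 / A k k" for v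
      proof -
        have "(\<Sum>i\<in>UNIV. v i * A i k)\<^sup>2 / A k k = (\<Sum>i\<in>UNIV. \<Sum>j\<in>UNIV. (v i * A i k) * (v j * A j k) / A k k)"
          unfolding power2_eq_square sum_product sum_divide_distrib by simp
        moreover have "v i * B i j * v j = v i * A i j * v j - (v i * A i k) * (v j * A j k) / A k k" for i j
          unfolding B_def by (simp add: algebra_simps)
        ultimately show ?thesis unfolding Q_def by (simp add: sum_subtractf)
      qed
      have "0 \<le> (\<Sum>i\<in>UNIV. \<Sum>j\<in>UNIV. v i * B i j * v j)" for v
      proof -
        define c where "c = (\<Sum>i\<in>UNIV. v i * A i k)"
        \<comment> \<open>Shifting coordinate \<open>k\<close> by \<open>- c / A k k\<close>
          minimises the form of \<open>A\<close>, and the minimum is the form of \<open>B\<close> at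
          \<open>v\<close>.\<close>
        have "0 \<le> Q v + 2 * (- c / A k k) * c + (- c / A k k)\<^sup>2 * A k k"
          using psd[of "\<lambda>i. v i + (if i = k then - c / A k k else 0)"] Qadd[of v "- c / A k k"]
          unfolding Q_def c_def by simp
        also have "\<dots> = Q v - c\<^sup>2 / A k k"
          using pos by (simp add: field_simps power2_eq_square)
        finally show ?thesis unfolding QB c_def .
      qed
      moreover have "\<And>i j. B i j = B j i" unfolding B_def using sym by (simp add: mult.commute)
      moreover have "\<And>i j. i \<notin> I \<Longrightarrow> B i j = 0"
        unfolding B_def using zero sym pos by (metis (no_types, lifting) insertE diff_self divide_eq_0_iff
            mult_eq_0_iff nonzero_mult_div_cancel_left diff_0_right less_irrefl)
      ultimately obtain V where V: "\<And>i j. B i j = (\<Sum>k\<in>I. V k i * V k j)"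
        using insert.IH[of B] by blast
      define W where "W l = (if l = k then (\<lambda>i. A i k / sqrt (A k k)) else V l)" for l
      have "(\<Sum>l\<in>I. W l i * W l j) = (\<Sum>l\<in>I. V l i * V l j)" for i j
        by (rule sum.cong) (use insert.hyps in \<open>auto simp: W_def\<close>)
      moreover have "W k i * W k j = A i k * A j k / A k k" for i j
        unfolding W_def using pos by (simp add: field_simps)
      ultimately have "(\<Sum>l\<in>insert k I. W l i * W l j) = A i j" for i j
        using V[of i j, symmetric] insert.hyps by (simp add: B_def)
      then show ?thesis by metis
    qed
  qed
  from this[of UNIV A] assms show ?thesis by simp
qed

text \<open>Once \<open>A\<close> is a sum of squares of directions \<open>V k\<close>, the
  contraction is a sum of second derivatives of \<open>w\<close> along lines through its
  maximum.\<close>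

lemma elliptic_at_max:
  fixes w :: "real ^ 'n::finite \<Rightarrow> real"
  assumes S: "open S" and w: "C1_along_axes S w w1" "\<And>j. C1_along_axes S (w1 j) (\<lambda>i. w2 i j)"
    and x: "x \<in> S" and max: "\<And>y. y \<in> S \<Longrightarrow> w y \<le> w x"
    and A: "\<And>i j. A i j = A j i" "\<And>v. 0 \<le> (\<Sum>i\<in>UNIV. \<Sum>j\<in>UNIV. v i * A i j * v j)"
  shows "w1 j x = 0" "(\<Sum>i\<in>UNIV. \<Sum>j\<in>UNIV. A i j * w2 i j x) \<le> 0"
proof -
  have dir: "(\<Sum>j\<in>UNIV. v $ j * w1 j x) = 0 \<and> (\<Sum>i\<in>UNIV. \<Sum>j\<in>UNIV. v $ i * v $ j * w2 i j x) \<le> 0" for v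
  proof -
    obtain e where e: "e > 0" "ball x e \<subseteq> S" using S x open_contains_ball by blast
    \<comment> \<open>The summand 1 keeps the denominator positive when \<open>v\<close> is
      zero.\<close>
    define d where "d = e / (norm v + 1)"
    have d: "d > 0" using e by (simp add: d_def add_nonneg_pos)
    have inS: "x + s *\<^sub>R v \<in> S" if "\<bar>s\<bar> < d" for s
    proof -
      have "\<bar>s\<bar> * norm v \<le> \<bar>s\<bar> * (norm v + 1)" by (simp add: mult_left_mono)
      also have "\<dots> < d * (norm v + 1)" using that by (intro mult_strict_right_mono) (auto simp: add_nonneg_pos)
      also have "\<dots> = e" unfolding d_def by (simp add: add_nonneg_eq_0_iff)
      finally have "x + s *\<^sub>R v \<in> ball x e" by (simp add: dist_norm)
      then show ?thesis using e by blast
    qed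
    define \<psi> where "\<psi> s = (\<Sum>j\<in>UNIV. v $ j * w1 j (x + s *\<^sub>R v))" for s
    have 1: "((\<lambda>s. w (x + s *\<^sub>R v)) has_real_derivative \<psi> s) (at s)" if "\<bar>s\<bar> < d" for s
      unfolding \<psi>_def by (rule line_deriv[OF S w(1) inS[OF that]])
    have 2: "(\<psi> has_real_derivative (\<Sum>j\<in>UNIV. v $ j * (\<Sum>i\<in>UNIV. v $ i * w2 i j (x + 0 *\<^sub>R v)))) (at 0)"
      unfolding \<psi>_def
      by (intro DERIV_sum DERIV_cmult line_deriv[OF S w(2)]) (use x in simp)
    have 3: "w (x + s *\<^sub>R v) \<le> w (x + 0 *\<^sub>R v)" if "\<bar>s\<bar> < d" for s
      using max[OF inS[OF that]] by simp
    have "(\<Sum>j\<in>UNIV. v $ j * (\<Sum>i\<in>UNIV. v $ i * w2 i j x)) = (\<Sum>i\<in>UNIV. \<Sum>j\<in>UNIV. v $ i * v $ j * w2 i j x)"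
      unfolding sum_distrib_left by (subst sum.swap) (simp add: mult_ac)
    then show ?thesis
      using second_derivative_at_max[OF d 1 2 3] unfolding \<psi>_def by simp
  qed
  have "(\<Sum>k\<in>UNIV. axis j (1::real) $ k * w1 k x) = w1 j x"
    by (simp add: axis_def if_distrib[where f = "\<lambda>x. x * _"] cong: if_cong)
  then show "w1 j x = 0" using dir[of "axis j 1"] by simp
  obtain V :: "'n \<Rightarrow> 'n \<Rightarrow> real" where V: "\<And>i j. A i j = (\<Sum>k\<in>UNIV. V k i * V k j)"
    using psd_sum_of_squares[OF A] by blast
  have "(\<Sum>i\<in>UNIV. \<Sum>j\<in>UNIV. A i j * w2 i j x) = (\<Sum>i\<in>UNIV. \<Sum>j\<in>UNIV. \<Sum>k\<in>UNIV. V k i * V k j * w2 i j x)"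
    unfolding V sum_distrib_right ..
  also have "\<dots> = (\<Sum>i\<in>UNIV. \<Sum>k\<in>UNIV. \<Sum>j\<in>UNIV. V k i * V k j * w2 i j x)"
    by (intro sum.cong refl sum.swap)
  also have "\<dots> = (\<Sum>k\<in>UNIV. \<Sum>i\<in>UNIV. \<Sum>j\<in>UNIV. V k i * V k j * w2 i j x)"
    by (rule sum.swap)
  also have "\<dots> \<le> 0"
  proof (rule sum_nonpos)
    fix k
    show "(\<Sum>i\<in>UNIV. \<Sum>j\<in>UNIV. V k i * V k j * w2 i j x) \<le> 0"
      using dir[of "vec_lambda (V k)"] by simp
  qed
  finally show "(\<Sum>i\<in>UNIV. \<Sum>j\<in>UNIV. A i j * w2 i j x) \<le> 0" .
qed

section \<open>The barrier and the strong maximum principle\<close>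

lemma C1_along_axes_cmult:
  "C1_along_axes S f f' \<Longrightarrow> C1_along_axes S (\<lambda>x. c * f x) (\<lambda>i x. c * f' i x)"
  using C1_along_axes_mult[OF C1_along_axes_const[of S c]] by (simp add: mult.commute)

lemma C1_along_axes_component:
  "C1_along_axes S (\<lambda>x. (x - c) $ j) (\<lambda>i x. if i = j then 1 else 0)"
  unfolding C1_along_axes_def
  by (auto intro!: continuous_intros derivative_eq_intros simp: axis_def)

lemma C1_along_axes_gaussian:
  fixes c :: "real ^ 'n::finite"
  shows "C1_along_axes S (\<lambda>x. exp (- \<alpha> * ((x - c) \<bullet> (x - c))))
    (\<lambda>i x. - 2 * \<alpha> * ((x - c) $ i * exp (- \<alpha> * ((x - c) \<bullet> (x - c)))))"
  unfolding C1_along_axes_def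
proof (intro conjI allI ballI)
  fix i and x :: "real ^ 'n"
  define q where "q = (x - c) \<bullet> (x - c)"
  have eq: "(x + s *\<^sub>R axis i 1 - c) \<bullet> (x + s *\<^sub>R axis i 1 - c) = q + 2 * s * (x - c) $ i + s\<^sup>2" for s
  proof -
    have "x + s *\<^sub>R axis i 1 - c = (x - c) + s *\<^sub>R axis i 1" by simp
    then show ?thesis
      unfolding q_def by (simp only: inner_add_left inner_add_right inner_scaleR_left inner_scaleR_right
          inner_axis inner_axis' axis_nth) (simp add: power2_eq_square algebra_simps)
  qed
  show "((\<lambda>s. exp (- \<alpha> * ((x + s *\<^sub>R axis i 1 - c) \<bullet> (x + s *\<^sub>R axis i 1 - c)))) has_real_derivative
      - 2 * \<alpha> * ((x - c) $ i * exp (- \<alpha> * ((x - c) \<bullet> (x - c))))) (at 0)"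
    unfolding eq unfolding q_def[symmetric]
    by (auto intro!: derivative_eq_intros simp del: vector_minus_component)
qed (auto intro!: continuous_intros)

text \<open>Hopf's barrier argument at a boundary point of \<open>{u < m}\<close> satisfying an interior ball condition.\<close>

lemma strong_maximum_principle:
  fixes u :: "real ^ 'n::finite \<Rightarrow> real" and a :: "'n \<Rightarrow> 'n \<Rightarrow> real ^ 'n \<Rightarrow> real"
  assumes S: "open S"
    and u: "C1_along_axes S u u1" "\<And>j. C1_along_axes S (u1 j) (\<lambda>i. u2 i j)"
    and a: "\<And>i j. continuous_on S (a i j)" "\<And>i j x. x \<in> S \<Longrightarrow> a i j x = a j i x"
      "\<And>x v. \<lbrakk>x \<in> S; v \<noteq> 0\<rbrakk> \<Longrightarrow> 0 < (\<Sum>i\<in>UNIV. \<Sum>j\<in>UNIV. v $ i * a i j x * v $ j)"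
    and b: "\<And>j. continuous_on S (b j)"
    and eq: "\<And>x. x \<in> S \<Longrightarrow> (\<Sum>i\<in>UNIV. \<Sum>j\<in>UNIV. a i j x * u2 i j x) + (\<Sum>j\<in>UNIV. b j x * u1 j x) = 0"
    and x0: "x0 \<in> S" and max: "\<And>x. x \<in> S \<Longrightarrow> u x \<le> u x0"
  shows "\<exists>e>0. ball x0 e \<subseteq> S \<and> (\<forall>y\<in>ball x0 e. u y = u x0)"
proof -
  define m where "m = u x0"
  obtain R where R: "R > 0" "cball x0 R \<subseteq> S"
    using S x0 open_contains_cball by blast
  \<comment> \<open>With half the radius, the point \<open>z\<close> of \<open>D\<close> nearest to
    \<open>y\<close> is less than \<open>R\<close> away from \<open>x0\<close>, so a small ball
    about \<open>z\<close> still fits into \<open>S\<close>.\<close>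
  have "u y = m" if y: "y \<in> ball x0 (R/2)" for y
  proof (rule ccontr)
    assume "u y \<noteq> m"
    define D where "D = {x \<in> cball x0 R. u x = m}"
    have "continuous_on (cball x0 R) u" using C1_along_axesD(1)[OF u(1)] R(2) continuous_on_subset by blast
    from continuous_closedin_preimage_constant[OF this, of m]
    have "closed D" unfolding D_def using closedin_closed_trans closed_cball by blast
    moreover have "x0 \<in> D" unfolding D_def m_def using R by simp
    ultimately obtain z where z: "z \<in> D" "\<And>x. x \<in> D \<Longrightarrow> dist y z \<le> dist y x"
      using distance_attains_inf[of D y] by blast
    define \<rho> where "\<rho> = dist y z"
    have "y \<noteq> z" using z(1) \<open>u y \<noteq> m\<close> unfolding D_def by auto
    then have \<rho>: "\<rho> > 0" "\<rho> < R/2"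
      using z(2)[OF \<open>x0 \<in> D\<close>] y unfolding \<rho>_def by (auto simp: dist_commute)
    \<comment> \<open>The ball about the midpoint with half the radius touches the sphere of radius
      \<open>\<rho>\<close> about \<open>y\<close> only at \<open>z\<close>. Hence
      \<open>u < m\<close> on the whole closed ball except at its boundary point
      \<open>z\<close>.\<close>
    define c where "c = midpoint y z"
    define \<sigma> where "\<sigma> = \<rho>/2"
    have c: "dist y c = \<sigma>" "dist c z = \<sigma>" "\<sigma> > 0"
      unfolding c_def \<sigma>_def \<rho>_def using \<rho> \<open>y \<noteq> z\<close> by (simp_all add: dist_midpoint)
    have below: "u x < m" if x: "dist c x \<le> \<sigma>" "x \<noteq> z" for x
    proof -
      have "dist y x < \<rho>"
      proof (rule ccontr)
        assume "\<not> dist y x < \<rho>"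
        then have ge: "norm ((y - c) + (c - x)) \<ge> 2 * \<sigma>" unfolding \<sigma>_def by (simp add: dist_norm)
        have n: "norm (y - c) = \<sigma>" "norm (c - x) \<le> \<sigma>" using c(1) x(1) by (simp_all add: dist_norm)
        then have n2: "norm (c - x) = \<sigma>" "norm ((y - c) + (c - x)) = norm (y - c) + norm (c - x)"
          using ge norm_triangle_ineq[of "y - c" "c - x"] by linarith+
        \<comment> \<open>Equality in the triangle inequality makes the two vectors parallel. They
          have equal length and so coincide: \<open>x\<close> is the reflection of \<open>y\<close>
          in \<open>c\<close>, which is \<open>z\<close>.\<close>
        then have "\<sigma> *\<^sub>R (c - x) = \<sigma> *\<^sub>R (y - c)"
          using norm_triangle_eq[of "y - c" "c - x"] n by simp
        then have "c - x = y - c" using c(3) by simp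
        then have "x = z" unfolding c_def midpoint_def by (simp add: algebra_simps scaleR_2[symmetric])
        then show False using x(2) by simp
      qed
      then have "x \<in> cball x0 R" "x \<notin> D"
        using y \<rho>(2) z(2)[of x] dist_triangle[of x0 x y] unfolding \<rho>_def by auto
      then show ?thesis using max[of x] R(2) unfolding D_def m_def by fastforce
    qed
    have "dist x0 z < R" using dist_triangle[of x0 z y] y \<rho> unfolding \<rho>_def by simp
    \<comment> \<open>The first bound keeps the ball about \<open>z\<close> inside
      \<open>cball x0 R\<close>, the second keeps it away from \<open>c\<close>, where the form
      \<open>q\<close> vanishes.\<close>
    define k where "k = min ((R - dist x0 z)/2) (\<sigma>/2)"
    have k: "k > 0" "k < R - dist x0 z" "k \<le> \<sigma>/2"
      using \<open>dist x0 z < R\<close> c(3) unfolding k_def by (auto simp: min_less_iff_disj)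
    have KS: "cball z k \<subseteq> S"
    proof
      fix x assume "x \<in> cball z k"
      then have "x \<in> cball x0 R" using dist_triangle[of x0 x z] k by simp
      then show "x \<in> S" using R by blast
    qed
    have away: "x \<noteq> c" if "x \<in> cball z k" for x
      using that k c by (auto simp: dist_commute)
    \<comment> \<open>Applied to the Gaussian \<open>E\<close> below, the operator gives
      \<open>2 * \<alpha> * E x * (2 * (\<alpha> * q x) - T x)\<close>: \<open>q\<close> is the term
      that a large \<alpha> makes dominant and \<open>T\<close> is the rest.\<close>
    define q where "q x = (\<Sum>i\<in>UNIV. \<Sum>j\<in>UNIV. (x - c) $ i * a i j x * (x - c) $ j)" for x
    define T where "T x = (\<Sum>i\<in>UNIV. a i i x) + (\<Sum>j\<in>UNIV. b j x * (x - c) $ j)" for x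
    have cont: "continuous_on (cball z k) (a i j)" "continuous_on (cball z k) (b j)" for i j
      using a(1) b KS continuous_on_subset by blast+
    have "continuous_on (cball z k) q"
      unfolding q_def by (intro continuous_intros cont)
    then obtain xq where xq: "xq \<in> cball z k" "\<And>x. x \<in> cball z k \<Longrightarrow> q xq \<le> q x"
      using continuous_attains_inf[of "cball z k" q] k by auto
    define \<mu> where "\<mu> = q xq"
    have \<mu>: "\<mu> > 0" "\<And>x. x \<in> cball z k \<Longrightarrow> \<mu> \<le> q x"
      unfolding \<mu>_def using xq(2) a(3)[of xq "xq - c"] away[OF xq(1)] KS xq(1) unfolding q_def by auto
    have "continuous_on (cball z k) T"
      unfolding T_def by (intro continuous_intros cont)
    then have "bounded (T ` cball z k)"
      using compact_continuous_image compact_cball compact_imp_bounded by blast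
    then obtain \<Lambda> where \<Lambda>: "\<And>x. x \<in> cball z k \<Longrightarrow> \<bar>T x\<bar> \<le> \<Lambda>"
      unfolding bounded_real by blast
    have \<Lambda>0: "\<Lambda> \<ge> 0" using \<Lambda>[of z] k by auto
    \<comment> \<open>The quotient balances \<open>\<Lambda>\<close> against the lower bound \<mu>
      of \<open>q\<close>; the summand 1 makes the inequality strict and \<alpha> positive.\<close>
    define \<alpha> where "\<alpha> = \<Lambda> / \<mu> + 1"
    have \<alpha>: "\<alpha> > 0" using \<mu>(1) \<Lambda>0 unfolding \<alpha>_def by (simp add: add_nonneg_pos)
    have \<alpha>\<mu>: "\<alpha> * \<mu> > \<Lambda>" using \<mu>(1) unfolding \<alpha>_def by (simp add: field_simps)
    define E where "E x = exp (- \<alpha> * ((x - c) \<bullet> (x - c)))" for x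
    \<comment> \<open>The constant makes the barrier vanish on the sphere of radius \<sigma> about
      \<open>c\<close>, hence at \<open>z\<close>, and negative outside it.\<close>
    define w where "w x = E x + - exp (- \<alpha> * \<sigma>\<^sup>2)" for x
    define w1 where "w1 j x = - 2 * \<alpha> * ((x - c) $ j * E x)" for j x
    define w2 where "w2 i j x = - 2 * \<alpha> * ((if i = j then 1 else 0) * E x + - 2 * \<alpha> * ((x - c) $ i * E x) * (x - c) $ j)" for i j x
    have E: "C1_along_axes S E (\<lambda>i x. - 2 * \<alpha> * ((x - c) $ i * E x))"
      unfolding E_def by (rule C1_along_axes_gaussian)
    have w: "C1_along_axes S w w1"
      unfolding w_def w1_def using C1_along_axes_add[OF E C1_along_axes_const[of S "- exp (- \<alpha> * \<sigma>\<^sup>2)"]] by simp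
    have w': "C1_along_axes S (w1 j) (\<lambda>i. w2 i j)" for j
      unfolding w1_def w2_def
      by (rule C1_along_axes_cmult[OF C1_along_axes_mult[OF C1_along_axes_component E]])
    have inner: "(x - c) \<bullet> (x - c) = (dist c x)\<^sup>2" for x
      by (metis dist_commute dist_norm power2_norm_eq_inner)
    have w_le: "w x \<le> 1" for x
    proof -
      have "E x \<le> 1" unfolding E_def inner using \<alpha> by simp
      then show ?thesis unfolding w_def using exp_gt_zero[of "- \<alpha> * \<sigma>\<^sup>2"] by linarith
    qed
    have w_neg: "w x < 0" if "dist c x > \<sigma>" for x
    proof -
      have "\<sigma>\<^sup>2 < (dist c x)\<^sup>2" using that c(3) by (intro power_strict_mono) auto
      then show ?thesis unfolding w_def E_def inner using \<alpha> by simp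
    qed
    have w_z: "w z = 0" unfolding w_def E_def inner c(2) by simp
    \<comment> \<open>The part of the small sphere on which the barrier is not negative. It is
      compact and misses \<open>z\<close>, so \<open>u\<close> is below \<open>m\<close> there by a
      fixed amount; since \<open>w\<close> is at most 1, adding \<open>\<epsilon> * w\<close> with
      \<epsilon> below that amount does not reach \<open>m\<close>.\<close>
    define N where "N = sphere z k \<inter> cball c \<sigma>"
    have Nsub: "N \<subseteq> cball z k" unfolding N_def by auto
    have "compact N" unfolding N_def by (intro compact_Int compact_sphere compact_cball)
    have uN: "continuous_on N u"
      using C1_along_axesD(1)[OF u(1)] Nsub KS continuous_on_subset by (meson order_trans)
    obtain \<epsilon> where \<epsilon>: "\<epsilon> > 0" "\<And>x. x \<in> N \<Longrightarrow> u x + \<epsilon> < m"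
    proof (cases "N = {}")
      case True
      then show ?thesis using that[of 1] by simp
    next
      case False
      then obtain t where t: "t \<in> N" "\<And>x. x \<in> N \<Longrightarrow> u x \<le> u t"
        using continuous_attains_sup[OF \<open>compact N\<close> False uN] by blast
      have "u t < m" using t(1) k(1) unfolding N_def by (intro below) auto
      then show ?thesis using t(2) by (intro that[of "(m - u t)/2"]) (fastforce simp: field_simps)+
    qed
    define v where "v x = u x + \<epsilon> * w x" for x
    define v1 where "v1 j x = u1 j x + \<epsilon> * w1 j x" for j x
    define v2 where "v2 i j x = u2 i j x + \<epsilon> * w2 i j x" for i j x
    have v: "C1_along_axes S v v1" "\<And>j. C1_along_axes S (v1 j) (\<lambda>i. v2 i j)"
      unfolding v_def v1_def v2_def
      by (intro C1_along_axes_add C1_along_axes_cmult u w w')+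
    have sphere: "v x < m" if x: "x \<in> sphere z k" for x
    proof (cases "dist c x \<le> \<sigma>")
      case True
      then have "x \<in> N" using x unfolding N_def by simp
      moreover have "\<epsilon> * w x \<le> \<epsilon> * 1" using w_le \<epsilon>(1) by (intro mult_left_mono) auto
      ultimately show ?thesis using \<epsilon>(2)[of x] unfolding v_def by linarith
    next
      case False
      then have "\<epsilon> * w x < 0" using w_neg[of x] \<epsilon>(1) by (simp add: mult_pos_neg)
      moreover have "u x \<le> m" unfolding m_def using x KS by (intro max) auto
      ultimately show ?thesis unfolding v_def by simp
    qed
    have "continuous_on (cball z k) v"
      using C1_along_axesD(1)[OF v(1)] KS continuous_on_subset by blast
    then obtain x1 where x1: "x1 \<in> cball z k" "\<And>x. x \<in> cball z k \<Longrightarrow> v x \<le> v x1"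
      using continuous_attains_sup[of "cball z k" v] k by auto
    \<comment> \<open>On the sphere \<open>v\<close> is below \<open>m\<close>, but it equals
      \<open>m\<close> at the centre, so its maximum \<open>x1\<close> is interior. There
      \<open>elliptic_at_max\<close> makes the operator nonpositive on \<open>v\<close>, although it
      vanishes on \<open>u\<close> and is positive on the barrier.\<close>
    have "v z = m" using z(1) w_z unfolding v_def D_def by simp
    then have "v x1 \<ge> m" using x1(2)[of z] k by simp
    then have "x1 \<notin> sphere z k" using sphere[of x1] by force
    then have x1b: "x1 \<in> ball z k" using x1(1) by auto
    have x1S: "x1 \<in> S" using x1(1) KS by blast
    have bS: "ball z k \<subseteq> S" using KS ball_subset_cball by blast
    have psd: "0 \<le> (\<Sum>i\<in>UNIV. \<Sum>j\<in>UNIV. h i * a i j x1 * h j)" for h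
    proof (cases "vec_lambda h = 0")
      case True
      then have "h i = 0" for i by (metis vec_lambda_beta zero_index)
      then show ?thesis by simp
    next
      case False
      from a(3)[OF x1S this] show ?thesis by simp
    qed
    have x1max: "v x \<le> v x1" if "x \<in> ball z k" for x using x1(2)[of x] that by simp
    note at_max = elliptic_at_max[OF open_ball C1_along_axes_subset[OF v(1) bS]
        C1_along_axes_subset[OF v(2) bS] x1b x1max a(2)[OF x1S] psd]
    have v1_0: "v1 j x1 = 0" for j by (rule at_max(1))
    have v2_le: "(\<Sum>i\<in>UNIV. \<Sum>j\<in>UNIV. a i j x1 * v2 i j x1) \<le> 0" by (rule at_max(2))
    have "(\<Sum>i\<in>UNIV. \<Sum>j\<in>UNIV. a i j x1 * w2 i j x1)
       = (\<Sum>i\<in>UNIV. \<Sum>j\<in>UNIV. 4 * \<alpha>\<^sup>2 * E x1 * ((x1 - c) $ i * a i j x1 * (x1 - c) $ j) - (if i = j then 2 * \<alpha> * E x1 * a i i x1 else 0))"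
      unfolding w2_def by (intro sum.cong refl) (simp add: algebra_simps power2_eq_square)
    also have "\<dots> = 4 * \<alpha>\<^sup>2 * E x1 * q x1 - 2 * \<alpha> * E x1 * (\<Sum>i\<in>UNIV. a i i x1)"
      unfolding q_def by (simp add: sum_subtractf sum_distrib_left)
    finally have Lw2: "(\<Sum>i\<in>UNIV. \<Sum>j\<in>UNIV. a i j x1 * w2 i j x1)
       = 4 * \<alpha>\<^sup>2 * E x1 * q x1 - 2 * \<alpha> * E x1 * (\<Sum>i\<in>UNIV. a i i x1)" .
    have Lw1: "(\<Sum>j\<in>UNIV. b j x1 * w1 j x1) = - 2 * \<alpha> * E x1 * (\<Sum>j\<in>UNIV. b j x1 * (x1 - c) $ j)"
      unfolding w1_def sum_distrib_left by (intro sum.cong refl) (simp add: mult_ac)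
    have Lw: "(\<Sum>i\<in>UNIV. \<Sum>j\<in>UNIV. a i j x1 * w2 i j x1) + (\<Sum>j\<in>UNIV. b j x1 * w1 j x1)
       = 2 * \<alpha> * E x1 * (2 * (\<alpha> * q x1) - T x1)"
      unfolding Lw1 Lw2 T_def by (simp add: algebra_simps power2_eq_square)
    have "(\<Sum>i\<in>UNIV. \<Sum>j\<in>UNIV. a i j x1 * v2 i j x1) + (\<Sum>j\<in>UNIV. b j x1 * v1 j x1)
       = ((\<Sum>i\<in>UNIV. \<Sum>j\<in>UNIV. a i j x1 * u2 i j x1) + (\<Sum>j\<in>UNIV. b j x1 * u1 j x1))
       + \<epsilon> * ((\<Sum>i\<in>UNIV. \<Sum>j\<in>UNIV. a i j x1 * w2 i j x1) + (\<Sum>j\<in>UNIV. b j x1 * w1 j x1))"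
      unfolding v1_def v2_def by (simp add: sum.distrib sum_distrib_left algebra_simps)
    also have "\<dots> = \<epsilon> * (2 * \<alpha> * E x1 * (2 * (\<alpha> * q x1) - T x1))"
      unfolding eq[OF x1S] Lw by simp
    finally have "\<epsilon> * (2 * \<alpha> * E x1 * (2 * (\<alpha> * q x1) - T x1)) \<le> 0"
      using v2_le v1_0 by simp
    moreover have "2 * (\<alpha> * q x1) - T x1 > 0"
    proof -
      have "\<alpha> * \<mu> \<le> \<alpha> * q x1" using \<mu>(2)[OF x1(1)] \<alpha> by simp
      then show ?thesis using \<alpha>\<mu> \<Lambda>[OF x1(1)] \<Lambda>0 by linarith
    qed
    moreover have "E x1 > 0" unfolding E_def by simp
    ultimately show False
      using mult_pos_pos[OF \<epsilon>(1) mult_pos_pos[OF mult_pos_pos[of "2 * \<alpha>" "E x1"]]] \<alpha>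
      by (metis mult_pos_pos not_less zero_less_numeral)
  qed
  moreover have "ball x0 (R/2) \<subseteq> S" using R by (auto simp: subset_iff)
  ultimately have "ball x0 (R/2) \<subseteq> S \<and> (\<forall>y\<in>ball x0 (R/2). u y = u x0)" unfolding m_def by blast
  then show ?thesis using half_gt_zero[OF R(1)] by blast
qed

section \<open>The leafwise Laplacian as an elliptic operator\<close>

lemma leafwise_C_continuous: "leafwise_C k \<Omega> F \<Longrightarrow> continuous_on \<Omega> F"
  by (cases k) simp_all

text \<open>\<open>L\<close> is the identity for functions and the projection to an entry for the
  matrix of the metric. \<open>\<Omega>\<close> is left general because the metric is regular on a
  whole chart image, whereas a harmonic function is so on each slice.\<close>

lemma leafwise_C_imp_C1_along_axes:
  fixes F :: "'n::finite coords \<Rightarrow> 'b::real_normed_vector"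
  assumes F: "leafwise_C (Suc k) \<Omega> F" and S: "S \<times> {t} \<subseteq> \<Omega>" and L: "bounded_linear L"
  shows "C1_along_axes S (\<lambda>x. L (F (x, t))) (\<lambda>i x. L (leaf_partial i F (x, t)))"
  unfolding C1_along_axes_def
proof (intro conjI allI ballI)
  have cont: "continuous_on S (\<lambda>x. L (H (x, t)))" if "continuous_on \<Omega> H" for H :: "'n coords \<Rightarrow> 'b"
  proof -
    have "(\<lambda>x. (x, t)) ` S \<subseteq> \<Omega>" using S by auto
    then have "continuous_on ((\<lambda>x. (x, t)) ` S) H" using that continuous_on_subset by blast
    then have "continuous_on S (H \<circ> (\<lambda>x. (x, t)))"
      by (intro continuous_on_compose) (auto intro!: continuous_intros)
    then show ?thesis
      by (intro bounded_linear.continuous_on[OF L]) (simp add: o_def)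
  qed
  show "continuous_on S (\<lambda>x. L (F (x, t)))"
    using F leafwise_C_continuous by (intro cont) blast
  show "continuous_on S (\<lambda>x. L (leaf_partial i F (x, t)))" for i
    using F leafwise_C_continuous by (intro cont) auto
  fix i x assume "x \<in> S"
  then have "(\<lambda>s. F (leaf_line i (x, t) s)) differentiable (at 0)"
    using F S by auto
  then have "((\<lambda>s. F (leaf_line i (x, t) s)) has_vector_derivative leaf_partial i F (x, t)) (at 0)"
    unfolding leaf_partial_def by (simp add: vector_derivative_works)
  from bounded_linear.has_vector_derivative[OF L this]
  show "((\<lambda>s. L (F (x + s *\<^sub>R axis i 1, t))) has_real_derivative L (leaf_partial i F (x, t))) (at 0)"
    unfolding has_real_derivative_iff_has_vector_derivative by (simp add: leaf_line_def)
qed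

lemma C1_along_axes_imp_leaf_partial:
  assumes "C1_along_axes S (\<lambda>x. F (x, t)) f'" "x \<in> S"
  shows "leaf_partial i F (x, t) = f' i x"
  unfolding leaf_partial_def leaf_line_def
  by (rule vector_derivative_at)
     (use C1_along_axesD(3)[OF assms, of i] in \<open>simp add: has_real_derivative_iff_has_vector_derivative\<close>)

lemma C1_along_axes_cong:
  assumes S: "open S" and f: "C1_along_axes S f f'" and eq: "\<And>x. x \<in> S \<Longrightarrow> f x = g x"
  shows "C1_along_axes S g f'"
  unfolding C1_along_axes_def
proof (intro conjI allI ballI)
  show "continuous_on S g" using C1_along_axesD(1)[OF f] eq continuous_on_cong by blast
  show "continuous_on S (f' i)" for i using C1_along_axesD(2)[OF f] .
  fix i x assume x: "x \<in> S"
  have "isCont (\<lambda>s. x + s *\<^sub>R axis i (1::real)) 0" by (intro continuous_intros)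
  then have "\<forall>\<^sub>F s in at 0. x + s *\<^sub>R axis i 1 \<in> S"
    using S x unfolding continuous_at by (intro topological_tendstoD) auto
  then have "\<forall>\<^sub>F s in at 0. f (x + s *\<^sub>R axis i 1) = g (x + s *\<^sub>R axis i 1)"
    by (rule eventually_mono) (rule eq)
  then have "\<forall>\<^sub>F s in nhds 0. f (x + s *\<^sub>R axis i 1) = g (x + s *\<^sub>R axis i 1)"
    using eq[OF x] by (simp add: eventually_nhds_conv_at)
  from DERIV_cong_ev[OF refl this refl] C1_along_axesD(3)[OF f x, of i]
  show "((\<lambda>s. g (x + s *\<^sub>R axis i 1)) has_real_derivative f' i x) (at 0)" by blast
qed

section \<open>Positive definite matrices and the coefficients of the Laplacian\<close>

lemma C1_along_axes_det:
  fixes X :: "real ^ 'n::finite \<Rightarrow> real ^ 'k::finite ^ 'k"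
  assumes "\<And>i j. \<exists>f'. C1_along_axes S (\<lambda>x. X x $ i $ j) f'"
  shows "\<exists>f'. C1_along_axes S (\<lambda>x. det (X x)) f'"
proof -
  have "\<exists>f'. C1_along_axes S (\<lambda>x. of_int (sign \<pi>) * (\<Prod>i\<in>UNIV. X x $ i $ \<pi> i)) f'" for \<pi>
  proof -
    obtain f' where "C1_along_axes S (\<lambda>x. \<Prod>i\<in>UNIV. X x $ i $ \<pi> i) f'"
      using C1_along_axes_prod[OF finite, where S = S and f = "\<lambda>i x. X x $ i $ \<pi> i"] assms by blast
    from C1_along_axes_cmult[OF this] show ?thesis by blast
  qed
  then have "\<forall>\<pi>. \<exists>f'. C1_along_axes S (\<lambda>x. of_int (sign \<pi>) * (\<Prod>i\<in>UNIV. X x $ i $ \<pi> i)) f'"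
    by blast
  from choice[OF this] obtain f' where
    f': "\<And>\<pi>. C1_along_axes S (\<lambda>x. of_int (sign \<pi>) * (\<Prod>i\<in>UNIV. X x $ i $ \<pi> i)) (f' \<pi>)"
    by blast
  show ?thesis
    unfolding det_def by (rule exI) (rule C1_along_axes_sum[OF finite_permutations[OF finite] f'])
qed

lemma posdef_det_nz:
  fixes G :: "real ^ 'n::finite ^ 'n"
  assumes "\<And>v. v \<noteq> 0 \<Longrightarrow> 0 < v \<bullet> (G *v v)"
  shows "det G \<noteq> 0"
proof -
  have "\<forall>x. G *v x = 0 \<longrightarrow> x = 0"
    using assms by (metis inner_zero_right less_irrefl)
  then show ?thesis
    using matrix_left_invertible_ker invertible_left_inverse invertible_det_nz by metis
qed

text \<open>The segment from the identity to \<open>G\<close> consists of positive definite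
  matrices, so the determinant has no zero on it and keeps the sign it has at the identity.\<close>

lemma posdef_det_pos:
  fixes G :: "real ^ 'n::finite ^ 'n"
  assumes G: "\<And>v. v \<noteq> 0 \<Longrightarrow> 0 < v \<bullet> (G *v v)"
  shows "det G > 0"
proof (rule ccontr)
  assume "\<not> det G > 0"
  define H :: "real \<Rightarrow> real ^ 'n ^ 'n" where "H s = (\<chi> i j. (1 - s) * mat 1 $ i $ j + s * G $ i $ j)" for s
  have H: "H s *v v = (1 - s) *\<^sub>R v + s *\<^sub>R (G *v v)" for s v
  proof -
    have "H s = (1 - s) *\<^sub>R mat 1 + s *\<^sub>R G" unfolding H_def by (simp add: vec_eq_iff)
    then show ?thesis
      by (simp add: matrix_vector_mult_add_rdistrib scaleR_matrix_vector_assoc[symmetric])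
  qed
  have nz: "det (H s) \<noteq> 0" if s: "0 \<le> s" "s \<le> 1" for s
  proof (rule posdef_det_nz)
    fix v :: "real ^ 'n" assume v: "v \<noteq> 0"
    have "v \<bullet> (H s *v v) = (1 - s) * (v \<bullet> v) + s * (v \<bullet> (G *v v))"
      unfolding H by (simp add: inner_add_right)
    also have "\<dots> > 0"
    proof (cases "s = 0")
      case True
      then show ?thesis using v by simp
    next
      case False
      then show ?thesis using s G[OF v] by (simp add: add_nonneg_pos)
    qed
    finally show "0 < v \<bullet> (H s *v v)" .
  qed
  have "H 1 = G" "H 0 = mat 1" unfolding H_def by (simp_all add: vec_eq_iff)
  then have "det (H 1) \<le> 0" "0 \<le> det (H 0)" using \<open>\<not> det G > 0\<close> by simp_all
  moreover have "continuous_on {0..1} (\<lambda>s. det (H s))"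
    unfolding det_def H_def by (auto intro!: continuous_intros)
  ultimately obtain s where "0 \<le> s" "s \<le> 1" "det (H s) = 0"
    using IVT2'[of "\<lambda>s. det (H s)" 1 0 0] by auto
  then show False using nz by blast
qed

lemma matrix_inv_right:
  fixes G :: "real ^ 'n::finite ^ 'n"
  assumes "det G \<noteq> 0"
  shows "G ** matrix_inv G = mat 1"
proof -
  have "\<exists>B. G ** B = mat 1 \<and> B ** G = mat 1"
    using assms unfolding invertible_det_nz[symmetric] invertible_def .
  from someI_ex[OF this] show ?thesis unfolding matrix_inv_def by blast
qed

text \<open>Entries of the inverse become quotients of determinants, which reduces their
  differentiability to that of \<open>det\<close>.\<close>

lemma matrix_inv_cramer:
  fixes G :: "real ^ 'n::finite ^ 'n"
  assumes "det G \<noteq> 0"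
  shows "matrix_inv G $ i $ j = det (\<chi> k l. if l = i then (axis j 1 :: real ^ 'n) $ k else G $ k $ l) / det G"
proof -
  have "G ** matrix_inv G = mat 1" using matrix_inv_right[OF assms] .
  then have "G *v (matrix_inv G *v axis j 1) = axis j 1"
    by (simp add: matrix_vector_mul_assoc)
  then have "matrix_inv G *v axis j 1 = (\<chi> k. det (\<chi> i l. if l = k then (axis j 1 :: real ^ 'n) $ i else G $ i $ l) / det G)"
    using cramer[OF assms] by blast
  then have "(matrix_inv G *v axis j 1) $ i = det (\<chi> k l. if l = i then (axis j 1 :: real ^ 'n) $ k else G $ k $ l) / det G"
    by simp
  then show ?thesis
    by (simp add: matrix_vector_mult_basis column_def)
qed

text \<open>With \<open>y = matrix_inv G *v v\<close>, the form of the inverse at \<open>v\<close>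
  is the form of \<open>G\<close> at \<open>y\<close>. Symmetry is uniqueness of the
  inverse.\<close>

lemma posdef_inv:
  fixes G :: "real ^ 'n::finite ^ 'n"
  assumes G: "\<And>v. v \<noteq> 0 \<Longrightarrow> 0 < v \<bullet> (G *v v)" and sym: "transpose G = G"
  shows "v \<noteq> 0 \<Longrightarrow> 0 < v \<bullet> (matrix_inv G *v v)" "transpose (matrix_inv G) = matrix_inv G"
proof -
  have inv: "G ** matrix_inv G = mat 1"
    using posdef_det_nz[OF G] matrix_inv_right by blast
  have "transpose (matrix_inv G) ** G = mat 1"
    using arg_cong[OF inv, of transpose] by (simp add: matrix_transpose_mul sym transpose_mat)
  then show "transpose (matrix_inv G) = matrix_inv G"
    using inv by (metis matrix_mul_assoc matrix_mul_lid matrix_mul_rid)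
  assume v: "v \<noteq> 0"
  define y where "y = matrix_inv G *v v"
  have Gy: "G *v y = v" unfolding y_def by (simp add: matrix_vector_mul_assoc inv)
  then have "y \<noteq> 0" using v by auto
  from G[OF this] show "0 < v \<bullet> (matrix_inv G *v v)"
    unfolding Gy y_def[symmetric] by (simp add: inner_commute)
qed

text \<open>These are the coefficients under the divergence in the Laplace-Beltrami operator.
  Differentiating them brings the operator into the nondivergence form to which the maximum
  principle applies.\<close>

lemma C1_along_axes_laplace_coefficient:
  fixes X :: "real ^ 'n::finite \<Rightarrow> real ^ 'n ^ 'n"
  assumes S: "open S" and X: "\<And>i j. \<exists>f'. C1_along_axes S (\<lambda>x. X x $ i $ j) f'"
    and pos: "\<And>x v. \<lbrakk>x \<in> S; v \<noteq> 0\<rbrakk> \<Longrightarrow> 0 < v \<bullet> (X x *v v)"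
  shows "\<exists>f'. C1_along_axes S (\<lambda>x. sqrt (det (X x)) * matrix_inv (X x) $ i $ j) f'"
proof -
  have det: "det (X x) > 0" if "x \<in> S" for x using posdef_det_pos pos[OF that] by blast
  obtain d where d: "C1_along_axes S (\<lambda>x. det (X x)) d"
    using C1_along_axes_det[OF X] by blast
  have sq: "C1_along_axes S (\<lambda>x. sqrt (det (X x))) (\<lambda>i x. inverse (sqrt (det (X x))) / 2 * d i x)"
  proof (rule C1_along_axes_compose[OF d])
    show "(sqrt has_real_derivative inverse (sqrt (det (X x))) / 2) (at (det (X x)))" if "x \<in> S" for x
      using DERIV_real_sqrt[OF det[OF that]] by simp
    show "continuous_on ((\<lambda>x. det (X x)) ` S) (\<lambda>y. inverse (sqrt y) / 2)"
      using det by (auto intro!: continuous_intros simp: less_imp_neq[symmetric])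
  qed
  have iv: "C1_along_axes S (\<lambda>x. inverse (det (X x))) (\<lambda>i x. - (inverse (det (X x)) ^ Suc (Suc 0)) * d i x)"
  proof (rule C1_along_axes_compose[OF d])
    show "(inverse has_real_derivative - (inverse (det (X x)) ^ Suc (Suc 0))) (at (det (X x)))" if "x \<in> S" for x
      using DERIV_inverse[of "det (X x)"] det[OF that] by simp
    show "continuous_on ((\<lambda>x. det (X x)) ` S) (\<lambda>y. - (inverse y ^ Suc (Suc 0)))"
      using det by (intro continuous_intros) (auto simp: less_imp_neq[symmetric])
  qed
  have "\<exists>f'. C1_along_axes S (\<lambda>x. (\<chi> k l. if l = i then (axis j 1 :: real ^ 'n) $ k else X x $ k $ l) $ k $ l) f'" for k l
    using X[of k l] C1_along_axes_const[of S "(axis j 1 :: real ^ 'n) $ k"] by (cases "l = i") auto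
  from C1_along_axes_det[OF this] obtain n where
    n: "C1_along_axes S (\<lambda>x. det (\<chi> k l. if l = i then (axis j 1 :: real ^ 'n) $ k else X x $ k $ l)) n"
    by blast
  define P where "P x = sqrt (det (X x)) * (det (\<chi> k l. if l = i then (axis j 1 :: real ^ 'n) $ k else X x $ k $ l) * inverse (det (X x)))" for x
  obtain f' where f': "C1_along_axes S P f'"
    unfolding P_def using C1_along_axes_mult[OF sq C1_along_axes_mult[OF n iv]] by blast
  have "matrix_inv (X x) $ i $ j = det (\<chi> k l. if l = i then (axis j 1 :: real ^ 'n) $ k else X x $ k $ l) * inverse (det (X x))"
    if "x \<in> S" for x
    using matrix_inv_cramer[of "X x" i j] det[OF that] by (simp add: divide_inverse)
  then have "C1_along_axes S (\<lambda>x. sqrt (det (X x)) * matrix_inv (X x) $ i $ j) f'"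
    by (intro C1_along_axes_cong[OF S f']) (simp add: P_def)
  then show ?thesis by blast
qed

lemma posdef_form:
  fixes B :: "real ^ 'n::finite ^ 'n"
  shows "(\<Sum>i\<in>UNIV. \<Sum>j\<in>UNIV. v $ i * (\<rho> * B $ i $ j) * v $ j) = \<rho> * (v \<bullet> (B *v v))"
  by (simp add: inner_vec_def matrix_vector_mult_def sum_distrib_left mult_ac)

section \<open>The leaf topology\<close>

text \<open>A product rather than a ball of the product metric: all its slices are the same ball,
  and its transverse interval may start at 0, so boundary charts need no separate treatment.\<close>

definition half_box :: "'n::finite coords \<Rightarrow> real \<Rightarrow> 'n coords set"
  where "half_box z e = ball (fst z) e \<times> (ball (snd z) e \<inter> {0..})"

lemma half_box_mono: "d \<le> e \<Longrightarrow> half_box z d \<subseteq> half_box z e"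
  by (auto simp: half_box_def)

lemma half_box_subset:
  assumes "openin (top_of_set (UNIV \<times> {0..})) S" "z \<in> S"
  shows "\<exists>e>0. half_box z e \<subseteq> S"
proof -
  obtain T where T: "open T" "S = (UNIV \<times> {0..}) \<inter> T"
    using assms(1) by (auto simp: openin_open)
  then obtain d where d: "d > 0" "ball z d \<subseteq> T"
    using assms(2) by (meson IntD2 open_contains_ball)
  have "half_box z (d/2) \<subseteq> S"
  proof
    fix w assume w: "w \<in> half_box z (d/2)"
    have "dist z w \<le> dist (fst z) (fst w) + dist (snd z) (snd w)"
      unfolding dist_prod_def by (rule sqrt_sum_squares_le_sum) auto
    also have "\<dots> < d"
      using w by (auto simp: half_box_def)
    finally show "w \<in> S"
      using w d T by (auto simp: half_box_def)
  qed
  then show ?thesis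
    using d by (intro exI[of _ "d/2"]) auto
qed

lemma openin_half_box: "openin (top_of_set (UNIV \<times> {0..})) (half_box z e)"
proof -
  have "half_box z e = (UNIV \<times> {0..}) \<inter> (ball (fst z) e \<times> ball (snd z) e)"
    by (auto simp: half_box_def)
  then show ?thesis
    unfolding openin_open by (intro exI[of _ "ball (fst z) e \<times> ball (snd z) e"] conjI open_Times) auto
qed

text \<open>A small plaque through \<open>m\<close>, possibly cut off by the chart domain. It is a
  full disc when a half box of radius \<open>e\<close> fits into the chart image, which later lemmas
  demand wherever connectedness matters.\<close>

definition slice :: "('a, 'n::finite) chart \<Rightarrow> 'a \<Rightarrow> real \<Rightarrow> 'a set"
  where "slice c m e = {x \<in> fst c. snd (snd c x) = snd (snd c m) \<and>
           dist (fst (snd c m)) (fst (snd c x)) < e}"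

lemma foliated_chartD:
  assumes "foliated_chart M c"
  shows "openin (top_of_set M) (fst c)"
    and "openin (top_of_set (UNIV \<times> {0..})) (snd c ` fst c)"
    and "homeomorphism (fst c) (snd c ` fst c) (snd c) (chart_inv c)"
    and "inj_on (snd c) (fst c)"
proof -
  obtain q where q: "homeomorphism (fst c) (snd c ` fst c) (snd c) q"
    and o: "openin (top_of_set M) (fst c)" "openin (top_of_set (UNIV \<times> {0..})) (snd c ` fst c)"
    using assms unfolding foliated_chart_def case_prod_beta by blast
  show "openin (top_of_set M) (fst c)" 
    "openin (top_of_set (UNIV \<times> {0..})) (snd c ` fst c)" using o .
  show inj: "inj_on (snd c) (fst c)"
    by (rule inj_on_inverseI[of _ q]) (rule homeomorphism_apply1[OF q])
  have eq: "q z = chart_inv c z" if z: "z \<in> snd c ` fst c" for z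
  proof -
    obtain x where x: "x \<in> fst c" "z = snd c x" using z by blast
    then show ?thesis
      unfolding chart_inv_def using inv_into_f_f[OF inj x(1)] homeomorphism_apply1[OF q x(1)] by simp
  qed
  show "homeomorphism (fst c) (snd c ` fst c) (snd c) (chart_inv c)"
    by (rule homeomorphism_cong[OF q]) (simp_all add: eq)
qed

text \<open>
  The compatibility condition is the coordinate-free content of the local product form of the
  transition maps; it is inherited by lifts to covering spaces.
\<close>

locale foliation =
  fixes M :: "'a::topological_space set" and A :: "('a, 'n::finite) chart set"
  assumes chart: "c \<in> A \<Longrightarrow> foliated_chart M c"
    and cover: "(\<Union>c\<in>A. fst c) = M"
    and compat: "\<lbrakk>c \<in> A; d \<in> A; m \<in> fst c; m \<in> fst d\<rbrakk> \<Longrightarrow>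
      \<exists>W. openin (top_of_set M) W \<and> m \<in> W \<and> W \<subseteq> fst c \<inter> fst d \<and>
        (\<forall>x\<in>W. \<forall>y\<in>W. snd (snd c x) = snd (snd c y) \<longrightarrow> snd (snd d x) = snd (snd d y))"
begin

abbreviation leaf :: "'a \<Rightarrow> 'a set"
  where "leaf m \<equiv> connected_component_of_set (leaf_topology A) m"

lemma chart_inv_snd: "\<lbrakk>c \<in> A; x \<in> fst c\<rbrakk> \<Longrightarrow> chart_inv c (snd c x) = x"
  by (rule homeomorphism_apply1[OF foliated_chartD(3)[OF chart]])

lemma snd_chart_inv: "\<lbrakk>c \<in> A; z \<in> snd c ` fst c\<rbrakk> \<Longrightarrow> snd c (chart_inv c z) = z"
  by (rule homeomorphism_apply2[OF foliated_chartD(3)[OF chart]])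

lemma chart_inv_in: "\<lbrakk>c \<in> A; z \<in> snd c ` fst c\<rbrakk> \<Longrightarrow> chart_inv c z \<in> fst c"
  using chart_inv_snd[of c] by (elim imageE) simp

lemma fst_chart_subset: "c \<in> A \<Longrightarrow> fst c \<subseteq> M"
  using cover by blast

lemma chart_at: "m \<in> M \<Longrightarrow> \<exists>c\<in>A. m \<in> fst c"
  using cover by blast

lemma snd_snd_nonneg: "\<lbrakk>c \<in> A; m \<in> fst c\<rbrakk> \<Longrightarrow> snd (snd c m) \<ge> 0"
  using subsetD[OF openin_imp_subset[OF foliated_chartD(2)[OF chart, of c]], of "snd c m"]
  by (simp add: mem_Times_iff)

lemma open_chart_image:
  assumes "c \<in> A" "openin (top_of_set M) W"
  shows "openin (top_of_set (UNIV \<times> {0..})) (snd c ` (fst c \<inter> W))"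
proof -
  have "openin (top_of_set (fst c)) (fst c \<inter> W)"
    using assms(2) fst_chart_subset[OF assms(1)] by (auto simp: openin_open)
  then have "openin (top_of_set (snd c ` fst c)) (snd c ` (fst c \<inter> W))"
    using foliated_chartD(3)[OF chart[OF assms(1)]] homeomorphism_imp_open_map by blast
  then show ?thesis
    using foliated_chartD(2)[OF chart[OF assms(1)]] openin_trans by blast
qed

lemma open_chart_inv_image:
  assumes "c \<in> A" "openin (top_of_set (UNIV \<times> {0..})) B" "B \<subseteq> snd c ` fst c"
  shows "openin (top_of_set M) (chart_inv c ` B)"
proof -
  have "openin (top_of_set (snd c ` fst c)) B"
    using openin_subset_trans[OF assms(2,3)]
      openin_imp_subset[OF foliated_chartD(2)[OF chart[OF assms(1)]]] by blast
  moreover have "homeomorphism (snd c ` fst c) (fst c) (chart_inv c) (snd c)"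
    using foliated_chartD(3)[OF chart[OF assms(1)]] by (rule homeomorphism_symD)
  ultimately have "openin (top_of_set (fst c)) (chart_inv c ` B)"
    using homeomorphism_imp_open_map by blast
  then show ?thesis
    using foliated_chartD(1)[OF chart[OF assms(1)]] openin_trans by blast
qed

lemma box_in_open:
  assumes "c \<in> A" "m \<in> fst c" "openin (top_of_set M) W" "m \<in> W"
  shows "\<exists>e>0. half_box (snd c m) e \<subseteq> snd c ` (fst c \<inter> W)"
  using half_box_subset[OF open_chart_image[OF assms(1,3)]] assms by blast

lemma box_in_chart:
  assumes "c \<in> A" "m \<in> fst c"
  shows "\<exists>e>0. half_box (snd c m) e \<subseteq> snd c ` fst c"
  using box_in_open[OF assms foliated_chartD(1)[OF chart[OF assms(1)]] assms(2)] by simp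

section \<open>Slices as a neighbourhood base of the leaf topology\<close>

lemma slice_subset_open:
  assumes "c \<in> A" "m \<in> fst c" "openin (top_of_set M) W" "m \<in> W"
  shows "\<exists>e>0. slice c m e \<subseteq> W"
proof -
  obtain e where e: "e > 0" "half_box (snd c m) e \<subseteq> snd c ` (fst c \<inter> W)"
    using box_in_open[OF assms] by blast
  have "slice c m e \<subseteq> W"
  proof
    fix x assume x: "x \<in> slice c m e"
    then have "snd c x \<in> half_box (snd c m) e"
      using e snd_snd_nonneg[OF assms(1,2)] by (simp add: slice_def half_box_def mem_Times_iff)
    then have "snd c x \<in> snd c ` (fst c \<inter> W)" using e by blast
    then show "x \<in> W"
      using x inj_on_image_mem_iff[OF foliated_chartD(4)[OF chart[OF assms(1)]], of x "fst c \<inter> W"]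
      by (simp add: slice_def)
  qed
  then show ?thesis using e by blast
qed

lemma leaf_open_subbasic:
  assumes "c \<in> A" "open B"
  shows "openin (leaf_topology A) {m \<in> fst c. snd c m \<in> B \<times> {t}}"
  unfolding leaf_topology_def
  by (intro topology_generated_by_Basis CollectI exI[of _ "fst c"] exI[of _ "snd c"] exI[of _ B]
        exI[of _ t] conjI) (simp_all add: assms)

lemma topspace_leaf_topology: "topspace (leaf_topology A) = M"
proof
  have "S \<subseteq> M" if S: "S = {m \<in> U. \<phi> m \<in> B \<times> {t}}" "(U, \<phi>) \<in> A" for S U \<phi> B t
    using fst_chart_subset[OF S(2)] S(1) by auto
  then show "topspace (leaf_topology A) \<subseteq> M"
    unfolding leaf_topology_def topology_generated_by_topspace
    by (intro Union_least) (elim CollectE exE conjE)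
  show "M \<subseteq> topspace (leaf_topology A)"
  proof
    fix m assume "m \<in> M"
    then obtain c where c: "c \<in> A" "m \<in> fst c" using chart_at by blast
    then have "m \<in> {x \<in> fst c. snd c x \<in> UNIV \<times> {snd (snd c m)}}"
      by (simp add: mem_Times_iff)
    then show "m \<in> topspace (leaf_topology A)"
      using openin_subset[OF leaf_open_subbasic[OF c(1) open_UNIV]] by (rule rev_subsetD)
  qed
qed

lemma slice_leaf_open:
  assumes "c \<in> A" shows "openin (leaf_topology A) (slice c m e)"
proof -
  have "slice c m e = {x \<in> fst c. snd c x \<in> ball (fst (snd c m)) e \<times> {snd (snd c m)}}"
    unfolding slice_def by (rule Collect_cong) (simp add: mem_Times_iff conj_commute)
  then show ?thesis using leaf_open_subbasic[OF assms] by simp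
qed

text \<open>Near \<open>m\<close>, equal transverse coordinates in \<open>c\<close> force equal ones
  in \<open>d\<close>, so a small slice of \<open>c\<close> cannot leave the plaque of
  \<open>d\<close>; continuity keeps it over \<open>B\<close>.\<close>

lemma slice_compat:
  assumes c: "c \<in> A" "m \<in> fst c" and d: "d \<in> A" "m \<in> fst d" "snd d m \<in> B \<times> {t}" and B: "open B"
  shows "\<exists>e>0. slice c m e \<subseteq> {x \<in> fst d. snd d x \<in> B \<times> {t}}"
proof -
  obtain W where W: "openin (top_of_set M) W" "m \<in> W" "W \<subseteq> fst c \<inter> fst d"
    and Weq: "\<And>x y. \<lbrakk>x \<in> W; y \<in> W; snd (snd c x) = snd (snd c y)\<rbrakk> \<Longrightarrow> snd (snd d x) = snd (snd d y)"
    using compat[OF c(1) d(1) c(2) d(2)] by blast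
  have cont: "continuous_on (fst d) (\<lambda>x. fst (snd d x))"
    using foliated_chartD(3)[OF chart[OF d(1)]] by (intro continuous_intros) (auto simp: homeomorphism_def)
  have "openin (top_of_set (fst d)) (fst d \<inter> (\<lambda>x. fst (snd d x)) -` B)"
    using cont B continuous_openin_preimage_gen by blast
  then have "openin (top_of_set M) (fst d \<inter> (\<lambda>x. fst (snd d x)) -` B)"
    using foliated_chartD(1)[OF chart[OF d(1)]] openin_trans by blast
  then have "openin (top_of_set M) (W \<inter> (fst d \<inter> (\<lambda>x. fst (snd d x)) -` B))"
    using W by blast
  moreover have "m \<in> W \<inter> (fst d \<inter> (\<lambda>x. fst (snd d x)) -` B)"
    using W d by auto
  ultimately obtain e where e: "e > 0" "slice c m e \<subseteq> W \<inter> (fst d \<inter> (\<lambda>x. fst (snd d x)) -` B)"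
    using slice_subset_open[OF c] by blast
  have "slice c m e \<subseteq> {x \<in> fst d. snd d x \<in> B \<times> {t}}"
  proof
    fix x assume x: "x \<in> slice c m e"
    then have "snd (snd d x) = snd (snd d m)"
      using e W(2) by (intro Weq) (auto simp: slice_def)
    then show "x \<in> {x \<in> fst d. snd d x \<in> B \<times> {t}}"
      using x e d by (auto simp: mem_Times_iff)
  qed
  then show ?thesis using e by blast
qed

text \<open>With \<open>slice_leaf_open\<close> this says that the slices of any single chart at
  \<open>m\<close> form a neighbourhood base, so leaf-openness can be tested in whichever chart is
  at hand. Only subbasic sets require an argument, which is \<open>slice_compat\<close>.\<close>

lemma openin_leaf_topology_slice:
  assumes "openin (leaf_topology A) S" "c \<in> A" "m \<in> S" "m \<in> fst c"
  shows "\<exists>e>0. slice c m e \<subseteq> S"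
proof -
  have "generate_topology_on {{m \<in> U. \<phi> m \<in> B \<times> {t}} |U \<phi> B t. (U, \<phi>) \<in> A \<and> open B} S"
    using assms(1) by (simp add: leaf_topology_def openin_topology_generated_by)
  then show ?thesis using assms(3)
  proof (induction rule: generate_topology_on.induct)
    case (Int a b)
    then obtain e1 e2 where "e1 > 0" "e2 > 0" "slice c m e1 \<subseteq> a" "slice c m e2 \<subseteq> b" by blast
    then have "min e1 e2 > 0" "slice c m (min e1 e2) \<subseteq> a \<inter> b"
      by (auto simp: slice_def)
    then show ?case by blast
  next
    case (UN K)
    then show ?case by blast
  next
    case (Basis s)
    then obtain U \<phi> B t where s: "s = {m \<in> U. \<phi> m \<in> B \<times> {t}}" "(U, \<phi>) \<in> A" "open B" by blast
    then show ?case
      using slice_compat[OF assms(2,4) s(2), of B t] Basis by simp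
  qed simp
qed

lemma openin_leaf_topologyI:
  assumes "S \<subseteq> M" "\<And>m. m \<in> S \<Longrightarrow> \<exists>c\<in>A. m \<in> fst c \<and> (\<exists>e>0. slice c m e \<subseteq> S)"
  shows "openin (leaf_topology A) S"
proof (subst openin_subopen, intro ballI)
  fix m assume "m \<in> S"
  then obtain c e where "c \<in> A" "m \<in> fst c" "e > 0" "slice c m e \<subseteq> S"
    using assms by blast
  moreover from this have "m \<in> slice c m e" by (auto simp: slice_def)
  ultimately show "\<exists>T. openin (leaf_topology A) T \<and> m \<in> T \<and> T \<subseteq> S"
    using slice_leaf_open by blast
qed

lemma open_imp_leaf_open:
  assumes "openin (top_of_set M) W"
  shows "openin (leaf_topology A) W"
proof (rule openin_leaf_topologyI)
  show "W \<subseteq> M" using assms openin_imp_subset by blast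
  show "\<exists>c\<in>A. m \<in> fst c \<and> (\<exists>e>0. slice c m e \<subseteq> W)" if "m \<in> W" for m
    using that chart_at[of m] slice_subset_open[OF _ _ assms] \<open>W \<subseteq> M\<close> by (meson subsetD)
qed

text \<open>Carries connectedness of balls and compactness of closed balls over to plaques in the
  leaf topology.\<close>

lemma chart_inv_leaf_continuous:
  assumes c: "c \<in> A" and K: "K \<times> {t} \<subseteq> snd c ` fst c"
  shows "continuous_map (top_of_set K) (leaf_topology A) (\<lambda>x. chart_inv c (x, t))"
  unfolding continuous_map_def
proof (intro conjI allI impI)
  show "(\<lambda>x. chart_inv c (x, t)) \<in> topspace (top_of_set K) \<rightarrow> topspace (leaf_topology A)"
    using K chart_inv_in[OF c] fst_chart_subset[OF c] unfolding topspace_leaf_topology by fastforce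
next
  fix S assume S: "openin (leaf_topology A) S"
  show "openin (top_of_set K) {x \<in> topspace (top_of_set K). chart_inv c (x, t) \<in> S}"
  proof (subst openin_subopen, intro ballI)
    fix x assume "x \<in> {x \<in> topspace (top_of_set K). chart_inv c (x, t) \<in> S}"
    then have x: "x \<in> K" "chart_inv c (x, t) \<in> S" by auto
    have xc: "chart_inv c (x, t) \<in> fst c" using x K chart_inv_in[OF c] by blast
    obtain e where e: "e > 0" "slice c (chart_inv c (x, t)) e \<subseteq> S"
      using openin_leaf_topology_slice[OF S c x(2) xc] by blast
    have "K \<inter> ball x e \<subseteq> {x \<in> topspace (top_of_set K). chart_inv c (x, t) \<in> S}"
    proof
      fix y assume y: "y \<in> K \<inter> ball x e"
      have "chart_inv c (y, t) \<in> slice c (chart_inv c (x, t)) e"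
      proof -
        have "(x, t) \<in> snd c ` fst c" "(y, t) \<in> snd c ` fst c" using x y K by blast+
        then show ?thesis
          using y by (simp add: slice_def chart_inv_in[OF c] snd_chart_inv[OF c])
      qed
      then show "y \<in> {x \<in> topspace (top_of_set K). chart_inv c (x, t) \<in> S}"
        using y e by auto
    qed
    then show "\<exists>T. openin (top_of_set K) T \<and> x \<in> T \<and> T \<subseteq> {x \<in> topspace (top_of_set K). chart_inv c (x, t) \<in> S}"
      using x e by (intro exI[of _ "K \<inter> ball x e"]) (auto simp: openin_open_Int)
  qed
qed

lemma box_same_leaf:
  assumes c: "c \<in> A" and sub: "half_box z e \<subseteq> snd c ` fst c"
    and xy: "(x, t) \<in> half_box z e" "(y, t) \<in> half_box z e"
  shows "chart_inv c (y, t) \<in> leaf (chart_inv c (x, t))"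
proof -
  have "ball (fst z) e \<times> {t} \<subseteq> snd c ` fst c"
    using sub xy by (auto simp: half_box_def)
  then have "continuous_map (top_of_set (ball (fst z) e)) (leaf_topology A) (\<lambda>x. chart_inv c (x, t))"
    using chart_inv_leaf_continuous[OF c] by blast
  then have "connectedin (leaf_topology A) ((\<lambda>x. chart_inv c (x, t)) ` ball (fst z) e)"
    by (rule connectedin_continuous_map_image) (simp add: connectedin_subtopology)
  then show ?thesis
    using xy unfolding mem_Collect_eq connected_component_of_def half_box_def by blast
qed

lemma leaf_self: "m \<in> M \<Longrightarrow> m \<in> leaf m"
  by (simp add: connected_component_of_refl topspace_leaf_topology)

lemma leaf_subset: "leaf m \<subseteq> M"
  using connected_component_of_subset_topspace topspace_leaf_topology by metis

lemma leaf_eq: "x \<in> leaf m \<Longrightarrow> leaf x = leaf m"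
  by (metis connected_component_of_equiv mem_Collect_eq)

lemma leaves_eq: "leaves A = leaf ` M"
  by (auto simp: leaves_def connected_components_of_def topspace_leaf_topology)

section \<open>Saturated sets\<close>

text \<open>Induction along a leaf: a set with locally constant membership is open and closed in the
  leaf topology, and leaves are connected.\<close>

lemma leaf_invariant:
  assumes loc: "\<And>m. m \<in> M \<Longrightarrow> \<exists>N. openin (leaf_topology A) N \<and> m \<in> N \<and> (\<forall>x\<in>N. x \<in> S \<longleftrightarrow> m \<in> S)"
    and "x \<in> leaf m" "m \<in> S"
  shows "x \<in> S"
proof (rule ccontr)
  assume "x \<notin> S"
  have sub: "N \<subseteq> M" if "openin (leaf_topology A) N" for N
    using openin_subset[OF that] by (simp add: topspace_leaf_topology)
  have 1: "openin (leaf_topology A) (M \<inter> S)"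
  proof (subst openin_subopen, intro ballI)
    fix y assume y: "y \<in> M \<inter> S"
    then obtain N where N: "openin (leaf_topology A) N" "y \<in> N" "\<forall>x\<in>N. x \<in> S \<longleftrightarrow> y \<in> S"
      using loc by blast
    then have "N \<subseteq> M" using sub by blast
    then show "\<exists>T. openin (leaf_topology A) T \<and> y \<in> T \<and> T \<subseteq> M \<inter> S"
      using N y by blast
  qed
  have 2: "openin (leaf_topology A) (M - S)"
  proof (subst openin_subopen, intro ballI)
    fix y assume y: "y \<in> M - S"
    then obtain N where N: "openin (leaf_topology A) N" "y \<in> N" "\<forall>x\<in>N. x \<in> S \<longleftrightarrow> y \<in> S"
      using loc by blast
    then have "N \<subseteq> M" using sub by blast
    then show "\<exists>T. openin (leaf_topology A) T \<and> y \<in> T \<and> T \<subseteq> M - S"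
      using N y by blast
  qed
  have conn: "connectedin (leaf_topology A) (leaf m)"
    by (rule connectedin_connected_component_of)
  have "m \<in> leaf m"
    using assms(2) by (metis connected_component_of_equiv mem_Collect_eq)
  then have "m \<in> M \<inter> S \<inter> leaf m" "x \<in> (M - S) \<inter> leaf m"
    using assms(2,3) \<open>x \<notin> S\<close> leaf_subset[of m] by blast+
  moreover have "leaf m \<subseteq> (M \<inter> S) \<union> (M - S)" using leaf_subset[of m] by blast
  ultimately show False
    using conn 1 2 unfolding connectedin by blast
qed

text \<open>This makes the projection to the leaf space an open map. The interior of the saturation
  contains \<open>V\<close>, and it is a union of leaves because a thin box can be slid along a
  plaque.\<close>

lemma open_saturation:
  assumes V: "openin (top_of_set M) V"
  shows "openin (top_of_set M) (\<Union>m\<in>V. leaf m)"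
proof -
  define S where "S = (\<Union>m\<in>V. leaf m)"
  define I where "I = {x. \<exists>W. openin (top_of_set M) W \<and> x \<in> W \<and> W \<subseteq> S}"
  have VM: "V \<subseteq> M" using V openin_imp_subset by blast
  have VI: "V \<subseteq> I"
    using V leaf_self VM unfolding I_def S_def by blast
  have loc: "\<exists>N. openin (leaf_topology A) N \<and> m \<in> N \<and> (\<forall>x\<in>N. x \<in> I \<longleftrightarrow> m \<in> I)" if m: "m \<in> M" for m
  proof (cases "m \<in> I")
    case True
    then obtain W where "openin (top_of_set M) W" "m \<in> W" "W \<subseteq> S" unfolding I_def by blast
    then show ?thesis using open_imp_leaf_open True unfolding I_def by blast
  next
    case False
    obtain c where c: "c \<in> A" "m \<in> fst c" using m chart_at by blast
    obtain e where e: "e > 0" "half_box (snd c m) e \<subseteq> snd c ` fst c"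
      using box_in_chart[OF c] by blast
    \<comment> \<open>Contrapositive: an interior point \<open>x\<close> on the plaque of
      \<open>m\<close> would make \<open>m\<close> interior as well.\<close>
    have "x \<notin> I" if x: "x \<in> slice c m e" for x
    proof
      assume "x \<in> I"
      then obtain W where W: "openin (top_of_set M) W" "x \<in> W" "W \<subseteq> S" unfolding I_def by blast
      have xc: "x \<in> fst c" using x by (auto simp: slice_def)
      obtain d where d: "d > 0" "half_box (snd c x) d \<subseteq> snd c ` (fst c \<inter> W)"
        using box_in_open[OF c(1) xc W(1,2)] by blast
      \<comment> \<open>The bound \<open>d\<close> keeps the points above \<open>x\<close> at the
        heights of the new box inside \<open>W\<close>; the bound \<open>e\<close> keeps that box
        inside the chart.\<close>
      define k where "k = min d e"
      have k: "k > 0" "k \<le> d" "k \<le> e" using d e by (auto simp: k_def)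
      have "chart_inv c ` half_box (snd c m) k \<subseteq> S"
      proof
        fix y assume "y \<in> chart_inv c ` half_box (snd c m) k"
        then obtain y1 t where y: "y = chart_inv c (y1, t)" "(y1, t) \<in> half_box (snd c m) k"
          by auto
        \<comment> \<open>The point on the plaque of \<open>y\<close> that has the leaf coordinates
          of \<open>x\<close>. It lies in \<open>W\<close>, and the plaque carries membership in
          \<open>S\<close> from it to \<open>y\<close>.\<close>
        define w where "w = chart_inv c (fst (snd c x), t)"
        have sx: "snd (snd c x) = snd (snd c m)" "dist (fst (snd c m)) (fst (snd c x)) < e"
          using x by (auto simp: slice_def)
        have "(fst (snd c x), t) \<in> half_box (snd c x) d"
          using y k sx by (auto simp: half_box_def)
        then have "w \<in> W"
          using d chart_inv_snd[OF c(1)] unfolding w_def by auto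
        then obtain v where v: "v \<in> V" "w \<in> leaf v" using W(3) unfolding S_def by blast
        have "y \<in> leaf w"
          unfolding w_def y(1)
          by (rule box_same_leaf[OF c(1) e(2)])
             (use y k sx half_box_mono[of k e] in \<open>auto simp: half_box_def\<close>)
        then show "y \<in> S" using v leaf_eq unfolding S_def by blast
      qed
      moreover have "openin (top_of_set M) (chart_inv c ` half_box (snd c m) k)"
        by (rule open_chart_inv_image[OF c(1) openin_half_box])
           (use e k half_box_mono in blast)
      moreover have "m \<in> chart_inv c ` half_box (snd c m) k"
      proof -
        have "snd c m \<in> half_box (snd c m) k"
          using k snd_snd_nonneg[OF c] by (auto simp: half_box_def mem_Times_iff)
        then show ?thesis using chart_inv_snd[OF c] by (metis imageI)
      qed
      ultimately have "m \<in> I" unfolding I_def by blast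
      then show False using False by blast
    qed
    moreover have "m \<in> slice c m e" using c e by (auto simp: slice_def)
    ultimately show ?thesis
      using slice_leaf_open[OF c(1)] False by blast
  qed
  have "S \<subseteq> I"
    unfolding S_def using leaf_invariant[OF loc, of _ _ ] VI by blast
  then have "\<forall>x\<in>S. \<exists>W. openin (top_of_set M) W \<and> x \<in> W \<and> W \<subseteq> S" unfolding I_def by blast
  then have "openin (top_of_set M) S" by (subst openin_subopen) blast
  then show ?thesis unfolding S_def .
qed

end

section \<open>Lifting to covering spaces\<close>

lemma foliated_atlas_imp_foliation:
  assumes "foliated_atlas r M A"
  shows "foliation M A"
proof
  show ch: "foliated_chart M c" if "c \<in> A" for c
    using assms that unfolding foliated_atlas_def by blast
  show "(\<Union>c\<in>A. fst c) = M"
    using assms unfolding foliated_atlas_def by blast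
  fix c d m assume cd: "c \<in> A" "d \<in> A" "m \<in> fst c" "m \<in> fst d"
  define \<Omega> where "\<Omega> = snd c ` (fst c \<inter> fst d)"
  have "snd c m \<in> \<Omega>" using cd by (auto simp: \<Omega>_def)
  then obtain N h where N: "openin (top_of_set \<Omega>) N" "snd c m \<in> N"
      "\<And>w. w \<in> N \<Longrightarrow> snd (transition c d w) = h (snd w)"
    using assms cd unfolding foliated_atlas_def Let_def \<Omega>_def by metis
  define W where "W = (fst c \<inter> fst d) \<inter> snd c -` N"
  have hc: "homeomorphism (fst c) (snd c ` fst c) (snd c) (chart_inv c)"
    using foliated_chartD(3)[OF ch[OF cd(1)]] .
  have "openin (top_of_set (fst c \<inter> fst d)) W"
    unfolding W_def
  proof (rule continuous_openin_preimage[OF _ _ N(1)])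
    show "continuous_on (fst c \<inter> fst d) (snd c)"
      using homeomorphism_cont1[OF hc] continuous_on_subset by blast
  qed (auto simp: \<Omega>_def)
  moreover have "openin (top_of_set M) (fst c \<inter> fst d)"
    using foliated_chartD(1)[OF ch[OF cd(1)]] foliated_chartD(1)[OF ch[OF cd(2)]] by blast
  ultimately have "openin (top_of_set M) W"
    using openin_trans by blast
  moreover have eq: "snd (snd d x) = h (snd (snd c x))" if "x \<in> W" for x
    using N(3)[of "snd c x"] that homeomorphism_apply1[OF hc, of x] by (simp add: W_def transition_def)
  have "\<forall>x\<in>W. \<forall>y\<in>W. snd (snd c x) = snd (snd c y) \<longrightarrow> snd (snd d x) = snd (snd d y)"
    by (simp add: eq)
  moreover have "m \<in> W" "W \<subseteq> fst c \<inter> fst d"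
    using N cd unfolding W_def by auto
  ultimately show "\<exists>W. openin (top_of_set M) W \<and> m \<in> W \<and> W \<subseteq> fst c \<inter> fst d \<and>
        (\<forall>x\<in>W. \<forall>y\<in>W. snd (snd c x) = snd (snd c y) \<longrightarrow> snd (snd d x) = snd (snd d y))"
    by blast
qed

lemma covering_space_open_image:
  assumes "covering_space C p S" "openin (top_of_set C) T"
  shows "openin (top_of_set S) (p ` T)"
proof (subst openin_subopen, intro ballI)
  fix y assume "y \<in> p ` T"
  then obtain x where x: "x \<in> T" "y = p x" by blast
  then have "x \<in> C" using assms(2) openin_imp_subset by blast
  then obtain V u q where V: "x \<in> V" "openin (top_of_set C) V" "openin (top_of_set S) u"
      "homeomorphism V u p q"
    using covering_space_local_homeomorphism[OF assms(1)] by metis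
  have "V \<subseteq> C" using V(2) openin_imp_subset by blast
  then have "openin (top_of_set V) (V \<inter> T)"
    using assms(2) by (auto simp: openin_open)
  then have "openin (top_of_set u) (p ` (V \<inter> T))"
    using homeomorphism_imp_open_map[OF V(4)] by blast
  then have "openin (top_of_set S) (p ` (V \<inter> T))"
    using V(3) openin_trans by blast
  then show "\<exists>R. openin (top_of_set S) R \<and> y \<in> R \<and> R \<subseteq> p ` T"
    using x V(1) by (intro exI[of _ "p ` (V \<inter> T)"]) auto
qed

text \<open>Bisection of the parameter interval: lifts over adjacent intervals can be glued, and a
  short piece of the path lies in one evenly covered set, where a local inverse of \<open>p\<close>
  lifts it.\<close>

lemma path_lift_topological:
  fixes p :: "'c::topological_space \<Rightarrow> 'a::topological_space"
  assumes cov: "covering_space C p S" and g: "path g" "path_image g \<subseteq> S"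
    and a: "a \<in> C" "p a = pathstart g"
  obtains h where "path h" "path_image h \<subseteq> C" "pathstart h = a"
    "\<And>t. t \<in> {0..1} \<Longrightarrow> p (h t) = g t"
proof -
  define Lift where "Lift s t \<longleftrightarrow> 0 \<le> s \<and> t \<le> 1 \<longrightarrow> (\<forall>c\<in>C. p c = g s \<longrightarrow>
    (\<exists>h. continuous_on {s..t} h \<and> h ` {s..t} \<subseteq> C \<and> h s = c \<and> (\<forall>x\<in>{s..t}. p (h x) = g x)))" for s t
  have gc: "continuous_on {0..1} g" "g ` {0..1} \<subseteq> S"
    using g by (auto simp: path_def path_image_def)
  have "Lift 0 1"
  proof (rule Bolzano)
    show "(0::real) \<le> 1" by simp
    fix a b c :: real assume ab: "Lift a b" and bc: "Lift b c" and le: "a \<le> b" "b \<le> c"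
    show "Lift a c" unfolding Lift_def
    proof (intro impI ballI)
      fix x assume ac: "0 \<le> a \<and> c \<le> 1" and x: "x \<in> C" "p x = g a"
      have "0 \<le> a \<and> b \<le> 1" using ac le by simp
      then obtain h where h: "continuous_on {a..b} h" "h ` {a..b} \<subseteq> C" "h a = x"
          "\<And>y. y \<in> {a..b} \<Longrightarrow> p (h y) = g y"
        using ab[unfolded Lift_def] x by blast
      have "h b \<in> C" "p (h b) = g b" using h le by auto
      moreover have "0 \<le> b \<and> c \<le> 1" using ac le by simp
      ultimately obtain k where k: "continuous_on {b..c} k" "k ` {b..c} \<subseteq> C" "k b = h b"
          "\<And>y. y \<in> {b..c} \<Longrightarrow> p (k y) = g y"
        using bc[unfolded Lift_def] by blast
      define f where "f y = (if y \<le> b then h y else k y)" for y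
      have eq: "{a..c} = {a..b} \<union> {b..c}" using le by auto
      have "continuous_on {a..c} f"
        unfolding f_def eq
        by (rule continuous_on_cases) (use h k in auto)
      moreover have "f ` {a..c} \<subseteq> C" "\<forall>y\<in>{a..c}. p (f y) = g y" "f a = x"
        using h k le unfolding f_def by (auto simp: image_subset_iff)
      ultimately show "\<exists>h. continuous_on {a..c} h \<and> h ` {a..c} \<subseteq> C \<and> h a = x \<and> (\<forall>x\<in>{a..c}. p (h x) = g x)"
        by blast
    qed
  next
    fix x :: real assume x: "0 \<le> x" "x \<le> 1"
    then have "g x \<in> S" using gc by auto
    then obtain T v where T: "g x \<in> T" "openin (top_of_set S) T" "\<Union>v = C \<inter> p -` T"
      "\<forall>u\<in>v. openin (top_of_set C) u" "\<forall>u\<in>v. \<exists>q. homeomorphism u T p q"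
      using cov unfolding covering_space_def by metis
    have "openin (top_of_set {0..1}) ({0..1} \<inter> g -` T)"
      by (rule continuous_openin_preimage[OF gc(1) _ T(2)]) (use gc in auto)
    then obtain d where d: "d > 0" "\<And>y. \<lbrakk>y \<in> {0..1}; dist y x < d\<rbrakk> \<Longrightarrow> g y \<in> T"
      using x T(1) unfolding openin_euclidean_subtopology_iff by (metis IntD2 IntI atLeastAtMost_iff vimageE vimageI)
    have "Lift a b" if ab: "a \<le> x \<and> x \<le> b \<and> b - a < d" for a b
      unfolding Lift_def
    proof (intro impI ballI)
      fix c assume ab01: "0 \<le> a \<and> b \<le> 1" and c: "c \<in> C" "p c = g a"
      have gT: "g y \<in> T" if "y \<in> {a..b}" for y
        using d(2)[of y] that ab ab01 by (auto simp: dist_real_def)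
      then have "c \<in> C \<inter> p -` T" using c ab by auto
      then obtain u where u: "u \<in> v" "c \<in> u" using T(3) by blast
      then obtain q where q: "homeomorphism u T p q" using T(5) by blast
      have uC: "u \<subseteq> C" using T(3) u by blast
      have "continuous_on {a..b} (q \<circ> g)"
      proof (rule continuous_on_compose)
        show "continuous_on {a..b} g" using gc(1) ab01 continuous_on_subset by fastforce
        show "continuous_on (g ` {a..b}) q"
          using homeomorphism_cont2[OF q] gT continuous_on_subset by blast
      qed
      moreover have "(q \<circ> g) ` {a..b} \<subseteq> C"
        using gT homeomorphism_image2[OF q] uC by auto
      moreover have "(q \<circ> g) a = c"
        using c homeomorphism_apply1[OF q u(2)] by simp
      moreover have "\<forall>y\<in>{a..b}. p ((q \<circ> g) y) = g y"
        using gT homeomorphism_apply2[OF q] by simp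
      ultimately show "\<exists>h. continuous_on {a..b} h \<and> h ` {a..b} \<subseteq> C \<and> h a = c \<and> (\<forall>x\<in>{a..b}. p (h x) = g x)"
        by blast
    qed
    then show "\<exists>d>0. \<forall>a b. a \<le> x \<and> x \<le> b \<and> b - a < d \<longrightarrow> Lift a b"
      using d by blast
  qed
  then obtain h where "continuous_on {0..1} h" "h ` {0..1} \<subseteq> C" "h 0 = a" "\<forall>x\<in>{0..1}. p (h x) = g x"
    using a unfolding Lift_def pathstart_def by auto
  then show ?thesis
    using that unfolding path_def path_image_def pathstart_def by blast
qed

context foliation
begin

lemma slice_subset_leaf:
  assumes c: "c \<in> A" "m \<in> fst c" and e: "half_box (snd c m) e \<subseteq> snd c ` fst c"
  shows "slice c m e \<subseteq> leaf m"
proof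
  fix x assume x: "x \<in> slice c m e"
  then have pos: "e > 0" "x \<in> fst c" unfolding slice_def using zero_le_dist le_less_trans by blast+
  have "(fst (snd c m), snd (snd c m)) \<in> half_box (snd c m) e"
    "(fst (snd c x), snd (snd c m)) \<in> half_box (snd c m) e"
    using x pos snd_snd_nonneg[OF c] by (auto simp: half_box_def slice_def mem_Times_iff)
  from box_same_leaf[OF c(1) e this] show "x \<in> leaf m"
    using x chart_inv_snd[OF c] chart_inv_snd[OF c(1) pos(2)] unfolding slice_def
    by (metis (mono_tags, lifting) mem_Collect_eq prod.collapse)
qed

text \<open>The leaf topology is finer than the subspace topology. In the cover this gives connected
  fibres of the map to the leaf space.\<close>

lemma leaf_connected: "connected (leaf m)"
proof -
  have "continuous_map (leaf_topology A) (top_of_set M) id"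
    unfolding continuous_map_def using open_imp_leaf_open openin_imp_subset
    by (auto simp: topspace_leaf_topology Int_absorb1 Collect_conj_eq)
  then have "connectedin (top_of_set M) (id ` leaf m)"
    using connectedin_continuous_map_image connectedin_connected_component_of by metis
  then show ?thesis by (simp add: connectedin_subtopology)
qed

text \<open>Half boxes are convex. In the cover this upgrades connected open sets to path connected
  ones.\<close>

lemma locally_path_connected_manifold: "locally path_connected M"
proof (rule locally_path_connected_1)
  fix v x assume v: "openin (top_of_set M) v" "x \<in> v"
  then have "x \<in> M" using openin_imp_subset by blast
  then obtain c where c: "c \<in> A" "x \<in> fst c" using chart_at by blast
  obtain e where e: "e > 0" "half_box (snd c x) e \<subseteq> snd c ` (fst c \<inter> v)"
    using box_in_open[OF c v] by blast
  have sub: "half_box (snd c x) e \<subseteq> snd c ` fst c" using e by blast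
  define u where "u = chart_inv c ` half_box (snd c x) e"
  have "convex (half_box (snd c x) e)"
    unfolding half_box_def by (intro convex_Times convex_Int) auto
  then have "path_connected u"
    unfolding u_def
    by (intro path_connected_continuous_image convex_imp_path_connected
        continuous_on_subset[OF homeomorphism_cont2[OF foliated_chartD(3)[OF chart[OF c(1)]]] sub])
  moreover have "openin (top_of_set M) u"
    unfolding u_def by (rule open_chart_inv_image[OF c(1) openin_half_box sub])
  moreover have "snd c x \<in> half_box (snd c x) e"
    using e snd_snd_nonneg[OF c] by (simp add: half_box_def mem_Times_iff)
  then have "x \<in> u"
    unfolding u_def using chart_inv_snd[OF c] by (metis imageI)
  moreover have "u \<subseteq> v"
    unfolding u_def
  proof
    fix y assume "y \<in> chart_inv c ` half_box (snd c x) e"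
    then obtain w where "w \<in> fst c" "w \<in> v" "y = chart_inv c (snd c w)" using e by blast
    then show "y \<in> v" using chart_inv_snd[OF c(1)] by simp
  qed
  ultimately show "\<exists>u. openin (top_of_set M) u \<and> path_connected u \<and> x \<in> u \<and> u \<subseteq> v"
    by blast
qed

end

section \<open>The lifted foliation\<close>

locale covered_foliation = foliation M A
  for M :: "'a::topological_space set" and A :: "('a, 'n::finite) chart set" +
  fixes C :: "'c::topological_space set" and p :: "'c \<Rightarrow> 'a"
  assumes cov: "covering_space C p M"
begin

lemma lifted_chartE:
  assumes "d \<in> lifted_atlas C p A"
  obtains c q where "c \<in> A" "snd d = snd c \<circ> p" "openin (top_of_set C) (fst d)"
    "p ` fst d \<subseteq> fst c" "homeomorphism (fst d) (p ` fst d) p q"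
proof -
  obtain V U \<phi> where d: "d = (V, \<phi> \<circ> p)" "(U, \<phi>) \<in> A" "openin (top_of_set C) V"
     "p ` V \<subseteq> U" "\<exists>q. homeomorphism V (p ` V) p q"
    using assms unfolding lifted_atlas_def mem_Collect_eq by (elim exE conjE) (rule that; (assumption | rule exI))
  from d(5) obtain q where "homeomorphism V (p ` V) p q" ..
  then show ?thesis
    using that[of "(U, \<phi>)" q] d by simp
qed

lemma p_in: "x \<in> C \<Longrightarrow> p x \<in> M"
  using covering_space_imp_surjective[OF cov] by blast

lemma foliation_lifted_atlas: "foliation C (lifted_atlas C p A)"
proof
  fix d assume d: "d \<in> lifted_atlas C p A"
  obtain c q where c: "c \<in> A" "snd d = snd c \<circ> p" "openin (top_of_set C) (fst d)"
    "p ` fst d \<subseteq> fst c" "homeomorphism (fst d) (p ` fst d) p q"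
    using lifted_chartE[OF d] .
  have "openin (top_of_set M) (p ` fst d)"
    using covering_space_open_image[OF cov c(3)] .
  then have "openin (top_of_set (UNIV \<times> {0..})) (snd c ` (fst c \<inter> p ` fst d))"
    by (rule open_chart_image[OF c(1)])
  moreover have eq: "snd c ` (fst c \<inter> p ` fst d) = snd d ` fst d"
    using c(4) unfolding c(2) by (simp add: image_comp Int_absorb1)
  moreover have "homeomorphism (p ` fst d) (snd d ` fst d) (snd c) (chart_inv c)"
    by (rule homeomorphism_of_subsets[OF foliated_chartD(3)[OF chart[OF c(1)]] c(4) subset_refl])
       (simp add: c(2) image_comp)
  from homeomorphism_compose[OF c(5) this]
  have "homeomorphism (fst d) (snd d ` fst d) (snd d) (q \<circ> chart_inv c)" 
    by (simp add: c(2))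
  ultimately show "foliated_chart C d"
    unfolding foliated_chart_def case_prod_beta using c(3) by metis
next
  show "(\<Union>d\<in>lifted_atlas C p A. fst d) = C"
  proof
    show "(\<Union>d\<in>lifted_atlas C p A. fst d) \<subseteq> C"
      using lifted_chartE openin_imp_subset by (metis UN_least)
    show "C \<subseteq> (\<Union>d\<in>lifted_atlas C p A. fst d)"
    proof
      fix x assume x: "x \<in> C"
      obtain T u q where T: "x \<in> T" "openin (top_of_set C) T" "homeomorphism T u p q"
        using covering_space_local_homeomorphism[OF cov x] by metis
      obtain c where c: "c \<in> A" "p x \<in> fst c" using chart_at p_in x by metis
      define V where "V = T \<inter> (C \<inter> p -` fst c)"
      have "openin (top_of_set C) (C \<inter> p -` fst c)"
        by (rule continuous_openin_preimage[OF covering_space_imp_continuous[OF cov] _ foliated_chartD(1)[OF chart[OF c(1)]]])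
           (use p_in in blast)
      then have V: "openin (top_of_set C) V" unfolding V_def using T(2) by blast
      have "homeomorphism V (p ` V) p q"
        by (rule homeomorphism_of_subsets[OF T(3) _ subset_refl refl]) (auto simp: V_def)
      then have "(V, snd c \<circ> p) \<in> lifted_atlas C p A"
        unfolding lifted_atlas_def mem_Collect_eq
        by (intro exI[of _ V] exI[of _ "fst c"] exI[of _ "snd c"] conjI exI[of _ q])
           (simp_all add: c V, auto simp: V_def)
      moreover have "x \<in> V" using x T c by (simp add: V_def)
      ultimately show "x \<in> (\<Union>d\<in>lifted_atlas C p A. fst d)" 
        by (metis UN_I fst_conv)
    qed
  qed
next
  fix d d' m assume d: "d \<in> lifted_atlas C p A" and d': "d' \<in> lifted_atlas C p A"
    and m: "m \<in> fst d" "m \<in> fst d'"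
  obtain c q where c: "c \<in> A" "snd d = snd c \<circ> p" "openin (top_of_set C) (fst d)"
    "p ` fst d \<subseteq> fst c" 
    using lifted_chartE[OF d] .
  obtain c' q' where c': "c' \<in> A" "snd d' = snd c' \<circ> p" "openin (top_of_set C) (fst d')"
    "p ` fst d' \<subseteq> fst c'" 
    using lifted_chartE[OF d'] .
  have pm: "p m \<in> fst c" "p m \<in> fst c'" using c(4) c'(4) m by blast+
  obtain W where W: "openin (top_of_set M) W" "p m \<in> W"
      "\<forall>x\<in>W. \<forall>y\<in>W. snd (snd c x) = snd (snd c y) \<longrightarrow> snd (snd c' x) = snd (snd c' y)"
    using compat[OF c(1) c'(1) pm] by blast
  define W' where "W' = fst d \<inter> fst d' \<inter> (C \<inter> p -` W)"
  have "openin (top_of_set C) (C \<inter> p -` W)"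
    by (rule continuous_openin_preimage[OF covering_space_imp_continuous[OF cov] _ W(1)])
       (use p_in in blast)
  then have "openin (top_of_set C) W'" unfolding W'_def using c(3) c'(3) by blast
  moreover have "m \<in> C" using c(3) m openin_imp_subset by blast
  then have "m \<in> W'" unfolding W'_def using m W by simp
  moreover have "\<forall>x\<in>W'. \<forall>y\<in>W'. snd (snd d x) = snd (snd d y) \<longrightarrow> snd (snd d' x) = snd (snd d' y)"
    unfolding c(2) c'(2) W'_def using W(3) by simp
  ultimately show "\<exists>W. openin (top_of_set C) W \<and> m \<in> W \<and> W \<subseteq> fst d \<inter> fst d' \<and>
        (\<forall>x\<in>W. \<forall>y\<in>W. snd (snd d x) = snd (snd d y) \<longrightarrow> snd (snd d' x) = snd (snd d' y))"
    unfolding W'_def by blast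
qed

sublocale lift: foliation C "lifted_atlas C p A"
  by (rule foliation_lifted_atlas)

text \<open>A lifted chart has the coordinates of a chart below, so plaques go into plaques;
  \<open>leaf_invariant\<close> spreads this along the lifted leaf.\<close>

lemma p_leaf:
  assumes "x \<in> lift.leaf y"
  shows "p x \<in> leaf (p y)"
proof -
  have y: "y \<in> C" using assms by (metis connected_component_of_equiv lift.topspace_leaf_topology mem_Collect_eq)
  have "x \<in> {x \<in> C. p x \<in> leaf (p y)}"
  proof (rule lift.leaf_invariant[OF _ assms])
    fix m assume m: "m \<in> C"
    then obtain d where d: "d \<in> lifted_atlas C p A" "m \<in> fst d" using lift.chart_at by blast
    obtain c q where c: "c \<in> A" "snd d = snd c \<circ> p" "openin (top_of_set C) (fst d)" "p ` fst d \<subseteq> fst c" 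
      using lifted_chartE[OF d(1)] .
    have pm: "p m \<in> fst c" using c(4) d by blast
    obtain e where e: "e > 0" "half_box (snd c (p m)) e \<subseteq> snd c ` fst c"
      using box_in_chart[OF c(1) pm] by blast
    have *: "x \<in> C \<and> leaf (p x) = leaf (p m)" if x: "x \<in> slice d m e" for x
    proof
      show "x \<in> C" using x lift.fst_chart_subset[OF d(1)] unfolding slice_def by blast
      have "p x \<in> slice c (p m) e"
        using x c(2,4) unfolding slice_def by auto
      then show "leaf (p x) = leaf (p m)"
        using slice_subset_leaf[OF c(1) pm e(2)] leaf_eq by blast
    qed
    have "x \<in> {x \<in> C. p x \<in> leaf (p y)} \<longleftrightarrow> m \<in> {x \<in> C. p x \<in> leaf (p y)}" if x: "x \<in> slice d m e" for x
    proof -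
      have "p x \<in> leaf (p x)" "p m \<in> leaf (p m)" using leaf_self p_in *[OF x] m by blast+
      then have "p x \<in> leaf (p y) \<longleftrightarrow> p m \<in> leaf (p y)"
        using *[OF x] leaf_eq by metis
      then show ?thesis using m *[OF x] by simp
    qed
    moreover have "m \<in> slice d m e" using d e by (simp add: slice_def)
    ultimately show "\<exists>N. openin (leaf_topology (lifted_atlas C p A)) N \<and> m \<in> N \<and>
           (\<forall>x\<in>N. x \<in> {x \<in> C. p x \<in> leaf (p y)} \<longleftrightarrow> m \<in> {x \<in> C. p x \<in> leaf (p y)})"
      using lift.slice_leaf_open[OF d(1)] by blast
  next
    show "y \<in> {x \<in> C. p x \<in> leaf (p y)}" using y leaf_self p_in by blast
  qed
  then show ?thesis by simp
qed

text \<open>Gives every point of \<open>M\<close> a leaf-open neighbourhood whose points all have a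
  lift on one common lifted leaf.\<close>

lemma p_lifted_leaf_open: "openin (leaf_topology A) (p ` lift.leaf y)"
proof (rule openin_leaf_topologyI)
  show "p ` lift.leaf y \<subseteq> M" using lift.leaf_subset p_in by blast
  fix m assume "m \<in> p ` lift.leaf y"
  then obtain x where x: "x \<in> lift.leaf y" "m = p x" by blast
  then have "x \<in> C" using lift.leaf_subset by blast
  then obtain d where d: "d \<in> lifted_atlas C p A" "x \<in> fst d" using lift.chart_at by blast
  obtain c q where c: "c \<in> A" "snd d = snd c \<circ> p" "openin (top_of_set C) (fst d)" "p ` fst d \<subseteq> fst c" 
    using lifted_chartE[OF d(1)] .
  have pm: "p x \<in> fst c" using c(4) d by blast
  \<comment> \<open>The box is taken in the image of the lifted chart, which may be smaller than
    that of \<open>c\<close>, so that every point of the slice has a preimage in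
    \<open>fst d\<close>.\<close>
  obtain e where e: "e > 0" "half_box (snd d x) e \<subseteq> snd d ` fst d"
    using lift.box_in_chart[OF d] by blast
  have "slice c m e \<subseteq> p ` lift.leaf y"
  proof
    fix z assume z: "z \<in> slice c m e"
    then have zc: "z \<in> fst c" by (simp add: slice_def)
    have "snd c z \<in> half_box (snd d x) e"
      using z snd_snd_nonneg[OF c(1) zc] e(1) by (simp add: slice_def half_box_def mem_Times_iff c(2) x(2))
    then obtain w where w: "w \<in> fst d" "snd c z = snd c (p w)"
      using e(2) c(2) by auto
    then have zw: "z = p w"
      using inj_onD[OF foliated_chartD(4)[OF chart[OF c(1)]], of z "p w"] zc c(4) by blast
    have "w \<in> slice d x e"
      using z w unfolding slice_def x(2) c(2) by (simp add: zw)
    then have "w \<in> lift.leaf x" using lift.slice_subset_leaf[OF d e(2)] by blast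
    then show "z \<in> p ` lift.leaf y" using lift.leaf_eq[OF x(1)] zw by blast
  qed
  then show "\<exists>c\<in>A. m \<in> fst c \<and> (\<exists>e>0. slice c m e \<subseteq> p ` lift.leaf y)"
    using c(1) pm x(2) e(1) by blast
qed

end

section \<open>\<open>\<real>\<close>-covered foliations\<close>

text \<open>If \<open>h a = h b\<close>, an extreme value over \<open>{a..b}\<close> is attained
  strictly inside, where it would belong to the open image of the interior. \<open>I\<close> may be
  half-open, as it is for boundary charts.\<close>

lemma open_map_interval_imp_inj:
  fixes h :: "real \<Rightarrow> real"
  assumes I: "is_interval I" and cont: "continuous_on I h"
    and op: "\<And>T. openin (top_of_set I) T \<Longrightarrow> open (h ` T)"
  shows "inj_on h I"
proof (rule linorder_inj_onI')
  fix a b assume ab: "a \<in> I" "b \<in> I" "a < b"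
  show "h a \<noteq> h b"
  proof
    assume eq: "h a = h b"
    have sub: "{a..b} \<subseteq> I" using I ab by (meson mem_is_interval_1_I atLeastAtMost_iff subsetI)
    have hc: "continuous_on {a..b} h" using cont sub continuous_on_subset by blast
    obtain s where s: "s \<in> {a..b}" "\<And>x. x \<in> {a..b} \<Longrightarrow> h x \<le> h s"
      using continuous_attains_sup[OF _ _ hc] ab by auto
    obtain t where t: "t \<in> {a..b}" "\<And>x. x \<in> {a..b} \<Longrightarrow> h t \<le> h x"
      using continuous_attains_inf[OF _ _ hc] ab by auto
    have "{a<..<b} = I \<inter> {a<..<b}" using sub by auto
    then have "openin (top_of_set I) {a<..<b}" by (metis openin_open_Int open_greaterThanLessThan)
    then have o: "open (h ` {a<..<b})" by (rule op)
    have no_max: "h s \<notin> h ` {a<..<b}"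
    proof
      assume "h s \<in> h ` {a<..<b}"
      then obtain e where "e > 0" "ball (h s) e \<subseteq> h ` {a<..<b}" using o open_contains_ball by blast
      moreover from this have "h s + e/2 \<in> ball (h s) e" by (simp add: dist_real_def)
      ultimately obtain x where "x \<in> {a<..<b}" "h s + e/2 = h x" by blast
      then show False using s(2)[of x] \<open>e > 0\<close> by simp
    qed
    have no_min: "h t \<notin> h ` {a<..<b}"
    proof
      assume "h t \<in> h ` {a<..<b}"
      then obtain e where "e > 0" "ball (h t) e \<subseteq> h ` {a<..<b}" using o open_contains_ball by blast
      moreover from this have "h t - e/2 \<in> ball (h t) e" by (simp add: dist_real_def)
      ultimately obtain x where "x \<in> {a<..<b}" "h t - e/2 = h x" by blast
      then show False using t(2)[of x] \<open>e > 0\<close> by simp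
    qed
    have "s = a \<or> s = b" "t = a \<or> t = b" using no_max no_min s(1) t(1) by force+
    then have st: "h s = h a" "h t = h a" using eq by auto
    have "(a + b)/2 \<in> {a<..<b}" using ab by simp
    moreover from this have "h ((a+b)/2) = h s" using s(2)[of "(a+b)/2"] t(2)[of "(a+b)/2"] st by simp
    ultimately show False using no_max by (metis imageI)
  qed
qed

text \<open>Segments are unordered, so the partner may lie on either side and reversing the line
  preserves the notion. Only the ends in \<open>X\<close> are collected.\<close>

definition gap_ends :: "real set \<Rightarrow> real set \<Rightarrow> real set"
  where "gap_ends X Y = {a \<in> X. \<exists>b\<in>Y. open_segment a b \<inter> (X \<union> Y) = {}}"

text \<open>Inside one compact segment there is a pair of minimal distance; a point of either set
  strictly between its members would form a closer pair.\<close>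

lemma gap_ends_nonempty:
  assumes cl: "closed X" "closed Y" and ne: "X \<noteq> {}" "Y \<noteq> {}" 
  shows "gap_ends X Y \<noteq> {}"
proof -
  obtain a0 b0 where a0: "a0 \<in> X" "b0 \<in> Y" using ne by blast
  define K where "K = (X \<inter> closed_segment a0 b0) \<times> (Y \<inter> closed_segment a0 b0)"
  have cK: "compact K" unfolding K_def
    by (intro compact_Times closed_Int_compact cl compact_segment)
  have nK: "K \<noteq> {}" using a0 unfolding K_def by auto
  have "continuous_on K (\<lambda>z. \<bar>fst z - snd z\<bar>)" by (intro continuous_intros)
  from continuous_attains_inf[OF cK nK this] obtain z where z: "z \<in> K" "\<And>w. w \<in> K \<Longrightarrow> \<bar>fst z - snd z\<bar> \<le> \<bar>fst w - snd w\<bar>"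
    by blast
  obtain a b where ab: "z = (a, b)" by (cases z)
  have K: "a \<in> X" "b \<in> Y" "a \<in> closed_segment a0 b0" "b \<in> closed_segment a0 b0"
    using z(1) unfolding K_def ab by auto
  have "open_segment a b \<inter> (X \<union> Y) = {}"
  proof (rule ccontr)
    assume "open_segment a b \<inter> (X \<union> Y) \<noteq> {}"
    then obtain c where c: "c \<in> open_segment a b" "c \<in> X \<union> Y" by blast
    have cs: "c \<in> closed_segment a0 b0"
      using c(1) K(3,4) by (meson closed_segment_subset convex_closed_segment segment_open_subset_closed subsetD)
    have lt: "\<bar>c - b\<bar> < \<bar>a - b\<bar>" "\<bar>a - c\<bar> < \<bar>a - b\<bar>"
      using c(1) by (auto simp: open_segment_eq_real_ivl split: if_splits)
    show False
      using c(2)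
    proof
      assume "c \<in> X"
      then have "(c, b) \<in> K" using K cs unfolding K_def by simp
      then show False using z(2)[of "(c, b)"] lt by (simp add: ab)
    next
      assume "c \<in> Y"
      then have "(a, c) \<in> K" using K cs unfolding K_def by simp
      then show False using z(2)[of "(a, c)"] lt by (simp add: ab)
    qed
  qed
  then show ?thesis using K unfolding gap_ends_def by blast
qed

text \<open>A limit point lies in \<open>X\<close>, so some ball about it misses \<open>Y\<close>.
  This ball holds at most two ends: of three, the middle one has its partner outside the ball, and
  the segment to the partner passes over another end, a point of \<open>X\<close>.\<close>

lemma gap_ends_not_islimpt:
  assumes cl: "closed X" "closed Y" and disj: "X \<inter> Y = {}"
  shows "\<not> l islimpt gap_ends X Y"
proof
  assume lim: "l islimpt gap_ends X Y"
  have "gap_ends X Y \<subseteq> X" by (auto simp: gap_ends_def)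
  then have "l \<in> X" using lim cl(1) closed_limpt islimpt_subset by blast
  then have "l \<in> - Y" "open (- Y)" using disj cl by auto
  then obtain e where e: "e > 0" "ball l e \<subseteq> - Y" using open_contains_ball by blast
  have no3: False if xyz: "x < y" "y < z" "{x,y,z} \<subseteq> gap_ends X Y \<inter> ball l e" for x y z
  proof -
    obtain b where b: "b \<in> Y" "open_segment y b \<inter> (X \<union> Y) = {}"
      using xyz unfolding gap_ends_def by blast
    have xz: "x \<in> X" "z \<in> X" using xyz unfolding gap_ends_def by auto
    have "b \<notin> ball l e" using e b by blast
    then have "x \<in> open_segment y b \<or> z \<in> open_segment y b"
      using xyz by (auto simp: open_segment_eq_real_ivl dist_real_def)
    then show False using b xz by blast
  qed
  have "infinite (gap_ends X Y \<inter> ball l e)"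
    using lim e islimpt_eq_infinite_ball by blast
  then obtain B where B: "card B = 3" "B \<subseteq> gap_ends X Y \<inter> ball l e"
    using infinite_arbitrarily_large by metis
  then obtain x y z where xyz: "B = {x, y, z}" "x \<noteq> y" "x \<noteq> z" "y \<noteq> z"
    using card_3_iff[of B] by auto
  consider "x < y \<and> y < z" | "x < z \<and> z < y" | "y < x \<and> x < z" | "y < z \<and> z < x"
    | "z < x \<and> x < y" | "z < y \<and> y < x" using xyz by linarith
  then show False
  proof cases
    case 1 then show False using no3[of x y z] B(2) xyz(1) by blast
  next
    case 2 then show False using no3[of x z y] B(2) xyz(1) by blast
  next
    case 3 then show False using no3[of y x z] B(2) xyz(1) by blast
  next
    case 4 then show False using no3[of y z x] B(2) xyz(1) by blast
  next
    case 5 then show False using no3[of z x y] B(2) xyz(1) by blast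
  next
    case 6 then show False using no3[of z y x] B(2) xyz(1) by blast
  qed
qed

section \<open>The projection of the cover to the leaf space\<close>

text \<open>The quotient topology is replaced by a real-valued map \<open>P\<close> on the cover,
  the projection followed by a homeomorphism with the line.\<close>

locale R_covered_foliation = covered_foliation M A C p
  for M :: "'a::topological_space set" and A :: "('a, 'n::finite) chart set"
    and C :: "'c::topological_space set" and p :: "'c \<Rightarrow> 'a" +
  fixes P :: "'c \<Rightarrow> real"
  assumes P_cont: "continuous_on C P"
    and P_surj: "P ` C = UNIV"
    and P_eq: "\<lbrakk>x \<in> C; y \<in> C\<rbrakk> \<Longrightarrow> P x = P y \<longleftrightarrow> y \<in> lift.leaf x"
    and P_open: "openin (top_of_set C) V \<Longrightarrow> open (P ` V)"

text \<open>Continuity, surjectivity and the description of the fibres are formal. Openness of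
  \<open>P\<close> is \<open>open_saturation\<close> in the cover.\<close>

lemma (in covered_foliation) R_covered_imp:
  assumes "R_covered C p A"
  obtains P where "R_covered_foliation M A C p P"
proof -
  let ?X = "leaf_space C (lifted_atlas C p A)"
  have Un: "\<Union>(leaves (lifted_atlas C p A)) = C"
    unfolding leaves_def by (simp add: Union_connected_components_of lift.topspace_leaf_topology)
  have top: "topspace ?X = leaves (lifted_atlas C p A)"
  proof
    show "topspace ?X \<subseteq> leaves (lifted_atlas C p A)"
      using openin_topspace[of ?X] unfolding openin_leaf_space by blast
    have "openin ?X (leaves (lifted_atlas C p A))"
      unfolding openin_leaf_space Un by simp
    then show "leaves (lifted_atlas C p A) \<subseteq> topspace ?X" by (rule openin_subset)
  qed
  obtain f where f: "homeomorphic_map ?X euclideanreal f"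
    using assms unfolding R_covered_def homeomorphic_space by blast
  define P where "P x = f (lift.leaf x)" for x
  have inL: "lift.leaf x \<in> leaves (lifted_atlas C p A)" if "x \<in> C" for x
    using that lift.leaves_eq by blast
  have "R_covered_foliation M A C p P"
  proof (intro_locales, unfold_locales)
    show "continuous_on C P"
      unfolding continuous_openin_preimage_eq
    proof (intro allI impI)
      fix T :: "real set" assume T: "open T"
      have "openin ?X {L \<in> topspace ?X. f L \<in> T}"
        using homeomorphic_imp_continuous_map[OF f] T openin_continuous_map_preimage by fastforce
      then have o: "openin (top_of_set C) (\<Union>{L \<in> topspace ?X. f L \<in> T})"
        unfolding openin_leaf_space by blast
      have "\<Union>{L \<in> topspace ?X. f L \<in> T} = C \<inter> P -` T"
      proof (intro equalityI subsetI)
        fix x assume "x \<in> \<Union>{L \<in> topspace ?X. f L \<in> T}"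
        then obtain y where y: "y \<in> C" "x \<in> lift.leaf y" "f (lift.leaf y) \<in> T"
          unfolding top lift.leaves_eq by blast
        then show "x \<in> C \<inter> P -` T"
          unfolding P_def using lift.leaf_eq[OF y(2)] lift.leaf_subset by auto
      next
        fix x assume "x \<in> C \<inter> P -` T"
        then show "x \<in> \<Union>{L \<in> topspace ?X. f L \<in> T}"
          unfolding top P_def using lift.leaf_self inL by blast
      qed
      then show "openin (top_of_set C) (C \<inter> P -` T)" using o by simp
    qed
    have "f ` leaves (lifted_atlas C p A) = UNIV"
      using homeomorphic_imp_surjective_map[OF f] unfolding top by simp
    then show "P ` C = UNIV"
      unfolding P_def lift.leaves_eq by (simp add: image_image)
    show "P x = P y \<longleftrightarrow> y \<in> lift.leaf x" if xy: "x \<in> C" "y \<in> C" for x y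
    proof -
      have "P x = P y \<longleftrightarrow> lift.leaf x = lift.leaf y"
        unfolding P_def
        by (rule inj_on_eq_iff[OF homeomorphic_imp_injective_map[OF f]])
           (simp_all add: top inL xy del: mem_Collect_eq)
      moreover have "lift.leaf x = lift.leaf y \<longleftrightarrow> y \<in> lift.leaf x"
        using lift.leaf_eq[of y x] lift.leaf_self[OF xy(2)] by metis
      ultimately show ?thesis by blast
    qed
    show "open (P ` V)" if V: "openin (top_of_set C) V" for V
    proof -
      have "V \<subseteq> C" using V openin_imp_subset by blast
      then have "openin ?X (lift.leaf ` V)"
        unfolding openin_leaf_space using lift.open_saturation[OF V] inL by blast
      then have "openin euclideanreal (f ` (lift.leaf ` V))"
        using homeomorphic_imp_open_map[OF f] unfolding open_map_def by blast
      then show ?thesis unfolding P_def by (simp add: image_image)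
    qed
  qed
  then show ?thesis using that by blast
qed

context R_covered_foliation
begin

context
  fixes d z e
  assumes d: "d \<in> lifted_atlas C p A" and box: "half_box z e \<subseteq> snd d ` fst d"
begin

lemma P_box_slice:
  assumes "w \<in> half_box z e"
  shows "P (chart_inv d w) = P (chart_inv d (fst z, snd w))"
proof -
  have "dist (fst z) (fst w) < e" using assms by (auto simp: half_box_def)
  then have e: "e > 0" using zero_le_dist[of "fst z" "fst w"] by linarith
  have w: "(fst w, snd w) \<in> half_box z e" "(fst z, snd w) \<in> half_box z e"
    using assms e by (auto simp: half_box_def mem_Times_iff)
  have "chart_inv d w \<in> C" "chart_inv d (fst z, snd w) \<in> C"
    using lift.chart_inv_in[OF d] lift.fst_chart_subset[OF d] w(2) assms box by blast+
  then show ?thesis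
    using lift.box_same_leaf[OF d box w] P_eq by simp
qed

text \<open>A set of heights is thickened to an open part of the box, on which \<open>P\<close>
  depends on the height alone.\<close>

lemma P_box_open:
  assumes T: "openin (top_of_set (ball (snd z) e \<inter> {0..})) T" and e: "e > 0"
  shows "open ((\<lambda>t. P (chart_inv d (fst z, t))) ` T)"
proof -
  obtain T' where T': "open T'" "T = (ball (snd z) e \<inter> {0..}) \<inter> T'"
    using T by (auto simp: openin_open)
  have "ball (fst z) e \<times> T = (UNIV \<times> {0..}) \<inter> (ball (fst z) e \<times> (ball (snd z) e \<inter> T'))"
    unfolding T' by auto
  then have o: "openin (top_of_set (UNIV \<times> {0..})) (ball (fst z) e \<times> T)"
    unfolding openin_open
    by (intro exI[of _ "ball (fst z) e \<times> (ball (snd z) e \<inter> T')"] conjI open_Times open_Int T' open_ball)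
  have sub: "ball (fst z) e \<times> T \<subseteq> half_box z e"
    unfolding T' half_box_def by auto
  have "open (P ` chart_inv d ` (ball (fst z) e \<times> T))"
    using P_open lift.open_chart_inv_image[OF d o] sub box by blast
  moreover have "P ` chart_inv d ` (ball (fst z) e \<times> T) = (\<lambda>t. P (chart_inv d (fst z, t))) ` T"
  proof (intro equalityI subsetI)
    fix y assume "y \<in> P ` chart_inv d ` (ball (fst z) e \<times> T)"
    then obtain w where w: "w \<in> ball (fst z) e \<times> T" "y = P (chart_inv d w)" by blast
    then show "y \<in> (\<lambda>t. P (chart_inv d (fst z, t))) ` T"
      using P_box_slice[of w] sub by auto
  next
    fix y assume "y \<in> (\<lambda>t. P (chart_inv d (fst z, t))) ` T"
    then obtain t where "t \<in> T" "y = P (chart_inv d (fst z, t))" by blast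
    moreover have "fst z \<in> ball (fst z) e" using e by simp
    ultimately show "y \<in> P ` chart_inv d ` (ball (fst z) e \<times> T)" by blast
  qed
  ultimately show ?thesis by simp
qed

lemma chart_inv_box_cont:
  assumes e: "e > 0"
  shows "continuous_on (ball (snd z) e \<inter> {0..}) (\<lambda>t. chart_inv d (fst z, t))"
proof -
  have im: "(\<lambda>t. (fst z, t)) ` (ball (snd z) e \<inter> {0..}) \<subseteq> snd d ` fst d"
    using box e by (auto simp: half_box_def)
  have "continuous_on ((\<lambda>t. (fst z, t)) ` (ball (snd z) e \<inter> {0..})) (chart_inv d)"
    by (rule continuous_on_subset[OF homeomorphism_cont2[OF foliated_chartD(3)[OF lift.chart[OF d]]] im])
  then show ?thesis
    using continuous_on_compose[of "ball (snd z) e \<inter> {0..}" "\<lambda>t. (fst z, t)" "chart_inv d"]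
    by (simp add: o_def continuous_on_Pair continuous_on_const)
qed

lemma P_box_cont:
  assumes e: "e > 0"
  shows "continuous_on (ball (snd z) e \<inter> {0..}) (\<lambda>t. P (chart_inv d (fst z, t)))"
proof -
  have "(\<lambda>t. chart_inv d (fst z, t)) ` (ball (snd z) e \<inter> {0..}) \<subseteq> C"
  proof (rule image_subsetI)
    fix t assume "t \<in> ball (snd z) e \<inter> {0..}"
    then have "(fst z, t) \<in> snd d ` fst d"
      using e by (intro subsetD[OF box]) (simp add: half_box_def)
    then show "chart_inv d (fst z, t) \<in> C"
      using lift.chart_inv_in[OF d] lift.fst_chart_subset[OF d] by blast
  qed
  then have "continuous_on ((\<lambda>t. chart_inv d (fst z, t)) ` (ball (snd z) e \<inter> {0..})) P"
    using P_cont continuous_on_subset by blast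
  from continuous_on_compose[OF chart_inv_box_cont[OF e] this] show ?thesis
    by (simp add: o_def)
qed

text \<open>A lifted leaf therefore crosses a box in at most one plaque.\<close>

lemma P_box_inj:
  assumes e: "e > 0"
  shows "inj_on (\<lambda>t. P (chart_inv d (fst z, t))) (ball (snd z) e \<inter> {0..})"
proof (rule open_map_interval_imp_inj[OF _ P_box_cont[OF e] P_box_open[OF _ e]])
  show "is_interval (ball (snd z) e \<inter> {0..})"
    by (intro is_interval_Int is_interval_ball_real) auto
qed

end

text \<open>Along the transverse axis of a chart \<open>P\<close> is injective with open image, so
  it moves from \<open>P x\<close> towards either side, and in particular towards \<open>b\<close>,
  without coming back.\<close>

lemma local_transversal:
  assumes x: "x \<in> C" and b: "b \<noteq> P x"
  obtains \<gamma> where "path \<gamma>" "path_image \<gamma> \<subseteq> C" "pathstart \<gamma> = x"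
    "\<And>s. s \<in> {0<..1} \<Longrightarrow> P (\<gamma> s) \<in> open_segment (P x) b"
proof -
  obtain d where d: "d \<in> lifted_atlas C p A" "x \<in> fst d" using lift.chart_at x by blast
  define z where "z = snd d x"
  obtain e where e: "e > 0" "half_box z e \<subseteq> snd d ` fst d"
    using lift.box_in_chart[OF d] unfolding z_def by blast
  define I where "I = ball (snd z) e \<inter> {0..}"
  define h where "h t = P (chart_inv d (fst z, t))" for t
  have zI: "snd z \<in> I" unfolding I_def z_def using e lift.snd_snd_nonneg[OF d] by simp
  have x_eq: "chart_inv d (fst z, snd z) = x" unfolding z_def using lift.chart_inv_snd[OF d] by simp
  then have hz: "h (snd z) = P x" unfolding h_def by simp
  have "open (h ` I)"
    unfolding h_def I_def by (rule P_box_open[OF d(1) e(2) _ e(1)]) simp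
  moreover have "P x \<in> h ` I" using zI hz by (metis imageI)
  ultimately obtain k where k: "k > 0" "ball (P x) k \<subseteq> h ` I" using open_contains_ball by blast
  \<comment> \<open>Halving yields a value strictly between \<open>P x\<close> and \<open>b\<close>
    and strictly inside the ball of attained values.\<close>
  define u where "u = min (k/2) (\<bar>b - P x\<bar>/2)"
  define b' where "b' = (if b > P x then P x + u else P x - u)"
  have u: "u > 0" "u < k" "u < \<bar>b - P x\<bar>" proof -
    have "\<bar>b - P x\<bar> > 0" using b by simp
    then show "u > 0" "u < k" "u < \<bar>b - P x\<bar>" using k(1) unfolding u_def by (simp_all add: min_less_iff_disj)
  qed
  have b': "b' \<in> open_segment (P x) b" "b' \<in> ball (P x) k" "b' \<noteq> P x"
    using u b unfolding b'_def by (auto simp: open_segment_eq_real_ivl dist_real_def)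
  then obtain t where t: "t \<in> I" "h t = b'" using k by blast
  have conv: "convex I" unfolding I_def by (intro convex_Int) auto
  have seg: "closed_segment (snd z) t \<subseteq> I"
    using closed_segment_subset[OF zI t(1) conv] .
  have im: "h ` open_segment (snd z) t = open_segment (P x) b'"
  proof -
    have "h ` open_segment (snd z) t = open_segment (h (snd z)) (h t)"
    proof (rule continuous_injective_image_open_segment_1)
      show "continuous_on (closed_segment (snd z) t) h"
        using P_box_cont[OF d(1) e(2,1)] seg continuous_on_subset unfolding I_def h_def by blast
      show "inj_on h (closed_segment (snd z) t)"
        using P_box_inj[OF d(1) e(2,1)] seg inj_on_subset unfolding I_def h_def by blast
    qed
    then show ?thesis using hz t by simp
  qed
  have tz: "t \<noteq> snd z" using t(2) hz b'(3) by auto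
  define \<gamma> where "\<gamma> = (\<lambda>s. chart_inv d (fst z, s)) \<circ> linepath (snd z) t"
  have cI: "continuous_on I (\<lambda>s. chart_inv d (fst z, s))"
    unfolding I_def by (rule chart_inv_box_cont[OF d(1) e(2,1)])
  have "path \<gamma>"
    unfolding \<gamma>_def by (rule path_continuous_image) (use cI seg continuous_on_subset in auto)
  moreover have "path_image \<gamma> \<subseteq> C"
    unfolding \<gamma>_def path_image_compose path_image_linepath
  proof (rule image_subsetI)
    fix s assume "s \<in> closed_segment (snd z) t"
    then have "(fst z, s) \<in> half_box z e"
      using seg e(1) unfolding half_box_def I_def by auto
    then show "chart_inv d (fst z, s) \<in> C"
      using e(2) lift.chart_inv_in[OF d(1)] lift.fst_chart_subset[OF d(1)] by blast
  qed
  moreover have "pathstart \<gamma> = x"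
    using x_eq unfolding \<gamma>_def pathstart_compose by simp
  moreover have "P (\<gamma> s) \<in> open_segment (P x) b" if s: "s \<in> {0<..1}" for s
  proof -
    have P: "P (\<gamma> s) = h (linepath (snd z) t s)" unfolding \<gamma>_def h_def by simp
    show ?thesis
    proof (cases "s = 1")
      case True
      then show ?thesis using P t(2) b' by (simp add: linepath_1')
    next
      case False
      then have "linepath (snd z) t s \<in> open_segment (snd z) t"
        using s tz unfolding in_segment linepath_def by (intro conjI exI[of _ s]) auto
      then have "P (\<gamma> s) \<in> open_segment (P x) b'" using im P by blast
      then show ?thesis using b'(1)
        by (auto simp: open_segment_eq_real_ivl split: if_splits)
    qed
  qed
  ultimately show ?thesis using that by blast
qed

text \<open>\<open>P\<close> is open and its fibres, the lifted leaves, are connected, so preimages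
  of connected sets are connected. This one is also open in a locally path connected space.\<close>

lemma gap_path_connected: "path_connected (C \<inter> P -` open_segment a b)"
proof -
  let ?G = "C \<inter> P -` open_segment a b"
  have o: "openin (top_of_set C) ?G"
    by (rule continuous_openin_preimage_gen[OF P_cont]) (simp add: open_segment_eq_real_ivl)
  have "connected ?G"
  proof (rule connected_open_monotone_preimage[OF P_cont P_surj])
    show "openin (top_of_set UNIV) (P ` V)" if "openin (top_of_set C) V" for V
      using P_open[OF that] by simp
    show "connected (C \<inter> P -` {y})" for y
    proof -
      obtain x where x: "x \<in> C" "P x = y" using P_surj by (metis UNIV_I imageE)
      have "C \<inter> P -` {y} = lift.leaf x"
      proof (intro equalityI subsetI)
        fix u assume "u \<in> C \<inter> P -` {y}"
        then have u: "u \<in> C" "P x = P u" using x(2) by simp_all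
        show "u \<in> lift.leaf x" by (rule iffD1[OF P_eq[OF x(1) u(1)] u(2)])
      next
        fix u assume u: "u \<in> lift.leaf x"
        have uC: "u \<in> C" by (rule subsetD[OF lift.leaf_subset u])
        then show "u \<in> C \<inter> P -` {y}" using iffD2[OF P_eq[OF x(1) uC] u] x(2) by simp
      qed
      then show ?thesis using lift.leaf_connected by simp
    qed
    show "connected (open_segment a b)" by (intro convex_connected convex_open_segment)
  qed auto
  then show ?thesis
    unfolding path_connected_component connected_iff_connected_component
      path_component_eq_connected_component[OF locally_open_subset[OF lift.locally_path_connected_manifold o]] .
qed

text \<open>The path must leave the level \<open>P x\<close> at once and reach the level
  \<open>b\<close> only at the end. Local transversals provide these two stretches, and
  \<open>gap_path_connected\<close> joins them over the open segment.\<close>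

lemma transversal_path:
  assumes x: "x \<in> C" and b: "b \<noteq> P x"
  obtains \<gamma> where "path \<gamma>" "path_image \<gamma> \<subseteq> C" "pathstart \<gamma> = x" "P (pathfinish \<gamma>) = b"
    "\<And>s. s \<in> {0<..<1} \<Longrightarrow> P (\<gamma> s) \<in> open_segment (P x) b"
proof -
  obtain y where y: "y \<in> C" "P y = b" using P_surj by (metis UNIV_I imageE)
  obtain \<alpha> where \<alpha>: "path \<alpha>" "path_image \<alpha> \<subseteq> C" "pathstart \<alpha> = x"
    "\<And>s. s \<in> {0<..1} \<Longrightarrow> P (\<alpha> s) \<in> open_segment (P x) b"
    using local_transversal[OF x b] by metis
  have "P x \<noteq> P y" using b y by simp
  then obtain \<beta> where \<beta>: "path \<beta>" "path_image \<beta> \<subseteq> C" "pathstart \<beta> = y"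
    "\<And>s. s \<in> {0<..1} \<Longrightarrow> P (\<beta> s) \<in> open_segment (P x) b"
    using local_transversal[OF y(1), of "P x"] y(2) by (metis open_segment_commute)
  have "pathfinish \<alpha> \<in> C \<inter> P -` open_segment (P x) b" "pathfinish \<beta> \<in> C \<inter> P -` open_segment (P x) b"
    using \<alpha>(2) \<alpha>(4)[of 1] \<beta>(2) \<beta>(4)[of 1] unfolding pathfinish_def path_image_def by auto
  then obtain \<delta> where \<delta>: "path \<delta>" "path_image \<delta> \<subseteq> C \<inter> P -` open_segment (P x) b"
    "pathstart \<delta> = pathfinish \<alpha>" "pathfinish \<delta> = pathfinish \<beta>"
    using gap_path_connected unfolding path_connected_def by metis
  define \<gamma> where "\<gamma> = \<alpha> +++ (\<delta> +++ reversepath \<beta>)"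
  have "path \<gamma>" unfolding \<gamma>_def using \<alpha>(1) \<beta>(1) \<delta> by simp
  moreover have "path_image \<gamma> \<subseteq> C"
    unfolding \<gamma>_def using \<alpha>(2) \<beta>(2) \<delta> by (simp add: path_image_join)
  moreover have "pathstart \<gamma> = x" "P (pathfinish \<gamma>) = b"
    unfolding \<gamma>_def using \<alpha>(3) \<beta>(3) y by simp_all
  moreover have "P (\<gamma> s) \<in> open_segment (P x) b" if s: "s \<in> {0<..<1}" for s
  proof -
    have D: "P (\<delta> u) \<in> open_segment (P x) b" if "u \<in> {0..1}" for u
      using \<delta>(2) that unfolding path_image_def by blast
    consider "s \<le> 1/2" | "s > 1/2" "2 * s - 1 \<le> 1/2" | "2 * s - 1 > 1/2" by linarith
    then show ?thesis
    proof cases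
      case 1
      then show ?thesis using s \<alpha>(4)[of "2 * s"] by (simp add: \<gamma>_def joinpaths_def)
    next
      case 2
      then show ?thesis using s D[of "2 * (2 * s - 1)"] by (simp add: \<gamma>_def joinpaths_def)
    next
      case 3
      then show ?thesis using s \<beta>(4)[of "1 - (2 * (2 * s - 1) - 1)"]
        by (simp add: \<gamma>_def joinpaths_def reversepath_def)
    qed
  qed
  ultimately show ?thesis using that by blast
qed

section \<open>Ends of gaps and their invariance\<close>

context
  fixes K1 K2
  assumes closed: "closedin (top_of_set M) K1" "closedin (top_of_set M) K2"
    and sat: "\<And>m. m \<in> K1 \<Longrightarrow> leaf m \<subseteq> K1" "\<And>m. m \<in> K2 \<Longrightarrow> leaf m \<subseteq> K2"
    and disj: "K1 \<inter> K2 = {}"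
begin

abbreviation (input) "shadow K \<equiv> P ` (C \<inter> p -` K)"

text \<open>Points of one fibre of \<open>P\<close> project into one leaf, and a saturated set
  contains all of that leaf or nothing of it.\<close>

lemma P_in_shadow:
  assumes K: "\<And>m. m \<in> K \<Longrightarrow> leaf m \<subseteq> K" and x: "x \<in> C"
  shows "P x \<in> shadow K \<longleftrightarrow> p x \<in> K"
proof
  assume "P x \<in> shadow K"
  then obtain y where y: "y \<in> C" "p y \<in> K" "P y = P x" by auto
  then have "p x \<in> leaf (p y)" using P_eq x p_leaf by blast
  then show "p x \<in> K" using K y by blast
qed (use x in auto)

text \<open>By saturation the complement of the shadow is the image under the open map
  \<open>P\<close> of the part of the cover over \<open>M - K\<close>.\<close>

lemma closed_shadow:
  assumes cl: "closedin (top_of_set M) K" and K: "\<And>m. m \<in> K \<Longrightarrow> leaf m \<subseteq> K"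
  shows "closed (shadow K)"
proof -
  have "openin (top_of_set M) (M - K)" using cl by (simp add: closedin_def)
  then have "openin (top_of_set C) (C \<inter> p -` (M - K))"
    by (rule continuous_openin_preimage[OF covering_space_imp_continuous[OF cov], rotated])
       (use p_in in blast)
  then have "open (P ` (C \<inter> p -` (M - K)))" by (rule P_open)
  moreover have "P ` (C \<inter> p -` (M - K)) = - shadow K"
  proof (intro equalityI subsetI)
    fix y assume "y \<in> P ` (C \<inter> p -` (M - K))"
    then show "y \<in> - shadow K" using P_in_shadow[OF K] by auto
  next
    fix y assume y: "y \<in> - shadow K"
    obtain x where x: "x \<in> C" "P x = y" using P_surj by (metis UNIV_I imageE)
    then have "p x \<notin> K" using P_in_shadow[OF K x(1)] y by simp
    then show "y \<in> P ` (C \<inter> p -` (M - K))" using x p_in by blast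
  qed
  ultimately show ?thesis by (simp add: closed_def)
qed

lemma disjoint_shadows: "shadow K1 \<inter> shadow K2 = {}"
  using P_in_shadow[OF sat(1)] P_in_shadow[OF sat(2)] disj by blast

text \<open>
  Whether a lift of \<open>m\<close> lies on an end of a gap can be read off from paths in \<open>M\<close>, so it does not
  depend on the lift.
\<close>

lemma gap_ends_lift:
  assumes x: "x \<in> C" "P x \<in> gap_ends (shadow K1) (shadow K2)" and y: "y \<in> C" "p y = p x"
  shows "P y \<in> gap_ends (shadow K1) (shadow K2)"
proof -
  define S1 S2 where "S1 = shadow K1" and "S2 = shadow K2"
  have S: "S1 \<inter> S2 = {}" unfolding S1_def S2_def by (rule disjoint_shadows)
  have S_iff: "P w \<in> S1 \<longleftrightarrow> p w \<in> K1" "P w \<in> S2 \<longleftrightarrow> p w \<in> K2" if "w \<in> C" for w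
    unfolding S1_def S2_def by (rule P_in_shadow[OF sat(1) that], assumption) (rule P_in_shadow[OF sat(2) that])
  have x2: "P x \<in> gap_ends S1 S2" using x(2) unfolding S1_def S2_def .
  obtain b where b: "P x \<in> S1" "b \<in> S2"
    "open_segment (P x) b \<inter> (S1 \<union> S2) = {}"
    using x2 unfolding gap_ends_def by blast
  have "b \<noteq> P x" using b S by blast
  then obtain \<gamma> where \<gamma>: "path \<gamma>" "path_image \<gamma> \<subseteq> C" "pathstart \<gamma> = x" "P (pathfinish \<gamma>) = b"
    "\<And>s. s \<in> {0<..<1} \<Longrightarrow> P (\<gamma> s) \<in> open_segment (P x) b"
    using transversal_path[OF x(1)] by metis
  have \<gamma>C: "\<gamma> s \<in> C" if "s \<in> {0..1}" for s using \<gamma>(2) that unfolding path_image_def by blast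
  have "path (p \<circ> \<gamma>)"
    by (rule path_continuous_image[OF \<gamma>(1) continuous_on_subset[OF covering_space_imp_continuous[OF cov] \<gamma>(2)]])
  moreover have "path_image (p \<circ> \<gamma>) \<subseteq> M"
    using \<gamma>(2) p_in unfolding path_image_compose by blast
  moreover have "p y = pathstart (p \<circ> \<gamma>)" by (simp add: pathstart_compose \<gamma>(3) y(2))
  ultimately obtain h where h: "path h" "path_image h \<subseteq> C" "pathstart h = y"
    "\<And>s. s \<in> {0..1} \<Longrightarrow> p (h s) = (p \<circ> \<gamma>) s"
    by (rule path_lift_topological[OF cov _ _ y(1)]) blast
  have hC: "h s \<in> C" if "s \<in> {0..1}" for s using h(2) that unfolding path_image_def by blast
  \<comment> \<open>\<open>h\<close> and \<open>\<gamma>\<close> have the same projection, and this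
    projection decides membership in the shadows.\<close>
  have same: "P (h s) \<in> S1 \<longleftrightarrow> P (\<gamma> s) \<in> S1" "P (h s) \<in> S2 \<longleftrightarrow> P (\<gamma> s) \<in> S2"
    if "s \<in> {0..1}" for s
    using S_iff[OF hC[OF that]] S_iff[OF \<gamma>C[OF that]] h(4)[OF that] by simp_all
  have y0: "h 0 = y" "\<gamma> 0 = x" "P (\<gamma> 1) = b" using h(3) \<gamma>(3,4) by (simp_all add: pathstart_def pathfinish_def)
  have "P y \<in> S1" using same(1)[of 0] b y0 by simp
  moreover have "P (h 1) \<in> S2" using same(2)[of 1] b y0 by simp
  \<comment> \<open>\<open>P \<circ> h\<close> need not be monotone, but it takes every value
    between its end values. A shadow point strictly between them would be taken at an interior time,
    when \<open>\<gamma>\<close> is over the gap.\<close>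
  moreover have "open_segment (P y) (P (h 1)) \<inter> (S1 \<union> S2) = {}"
  proof (rule ccontr)
    assume "open_segment (P y) (P (h 1)) \<inter> (S1 \<union> S2) \<noteq> {}"
    then obtain v where v: "v \<in> open_segment (P y) (P (h 1))" "v \<in> S1 \<union> S2" by blast
    have "continuous_on {0..1} (P \<circ> h)"
      by (rule continuous_on_compose[OF h(1)[unfolded path_def]
            continuous_on_subset[OF P_cont h(2)[unfolded path_image_def]]])
    then have "convex ((P \<circ> h) ` {0..1})"
      using connected_continuous_image connected_convex_1 connected_Icc by blast
    moreover have "(P \<circ> h) 0 \<in> (P \<circ> h) ` {0..1}" "(P \<circ> h) 1 \<in> (P \<circ> h) ` {0..1}" by (rule imageI, simp)+
    ultimately have "closed_segment ((P \<circ> h) 0) ((P \<circ> h) 1) \<subseteq> (P \<circ> h) ` {0..1}"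
      by (intro closed_segment_subset)
    moreover have "v \<in> closed_segment ((P \<circ> h) 0) ((P \<circ> h) 1)"
      using v(1) y0(1) segment_open_subset_closed by (metis comp_apply subsetD)
    ultimately obtain s where s: "s \<in> {0..1}" "v = P (h s)"
      by (metis comp_apply imageE subsetD)
    have "s \<noteq> 0" "s \<noteq> 1" using v(1) s(2) y0 by (auto simp: open_segment_def)
    then have "P (\<gamma> s) \<in> open_segment (P x) b" using s(1) \<gamma>(5)[of s] by simp
    moreover have "P (\<gamma> s) \<in> S1 \<union> S2"
      using v(2) same[OF s(1)] unfolding s(2) by blast
    ultimately show False using b(3) by blast
  qed
  ultimately show ?thesis unfolding gap_ends_def S1_def[symmetric] S2_def[symmetric] by blast
qed

text \<open>By \<open>gap_ends_lift\<close>, lying below an end is a property of points of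
  \<open>M\<close>. It is locally constant along leaves, since nearby points of a leaf have lifts on
  one lifted leaf, where \<open>P\<close> is constant.\<close>

lemma gap_end_leaf:
  assumes x: "x \<in> C" "P x \<in> gap_ends (shadow K1) (shadow K2)"
    and y: "y \<in> C" "p y \<in> leaf (p x)"
  shows "P y \<in> gap_ends (shadow K1) (shadow K2)"
proof -
  let ?E = "gap_ends (shadow K1) (shadow K2)"
  have iff: "p w \<in> {m. \<exists>c\<in>C. p c = m \<and> P c \<in> ?E} \<longleftrightarrow> P w \<in> ?E" if w: "w \<in> C" for w
  proof
    assume "p w \<in> {m. \<exists>c\<in>C. p c = m \<and> P c \<in> ?E}"
    then obtain c where c: "c \<in> C" "p c = p w" "P c \<in> ?E" by blast
    show "P w \<in> ?E" by (rule gap_ends_lift[OF c(1,3) w c(2)[symmetric]])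
  qed (use w in blast)
  have "p y \<in> {m. \<exists>c\<in>C. p c = m \<and> P c \<in> ?E}"
  proof (rule leaf_invariant[OF _ y(2)])
    fix m assume "m \<in> M"
    then obtain c where c: "c \<in> C" "p c = m"
      using covering_space_imp_surjective[OF cov] by blast
    have "(u \<in> {m. \<exists>c\<in>C. p c = m \<and> P c \<in> ?E}) = (m \<in> {m. \<exists>c\<in>C. p c = m \<and> P c \<in> ?E})"
      if u: "u \<in> p ` lift.leaf c" for u
    proof -
      obtain w where w: "w \<in> lift.leaf c" "u = p w" using u by blast
      then have "w \<in> C" using lift.leaf_subset by blast
      then have "P w = P c" using iffD2[OF P_eq[OF c(1) \<open>w \<in> C\<close>] w(1)] by simp
      then show ?thesis using iff[OF \<open>w \<in> C\<close>] iff[OF c(1)] c w by simp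
    qed
    moreover have "m \<in> p ` lift.leaf c" using c lift.leaf_self by blast
    ultimately show "\<exists>N. openin (leaf_topology A) N \<and> m \<in> N \<and>
      (\<forall>x\<in>N. (x \<in> {m. \<exists>c\<in>C. p c = m \<and> P c \<in> ?E}) = (m \<in> {m. \<exists>c\<in>C. p c = m \<and> P c \<in> ?E}))"
      using p_lifted_leaf_open[of c] by blast
  qed (use x in blast)
  then show ?thesis unfolding iff[OF y(1)] .
qed

end

section \<open>Compactness of a leaf below a discrete set\<close>

text \<open>Every point of \<open>M\<close> has a neighbourhood that meets the leaf inside finitely
  many closed plaques. Finitely many such neighbourhoods cover \<open>M\<close>, so the leaf lies in
  a compact set of the leaf topology.\<close>

lemma compact_leafI:
  assumes M: "compact M" "m0 \<in> M"
    and fin: "\<And>u v. finite ({u..v} \<inter> E)"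
    and E: "\<And>y. \<lbrakk>y \<in> C; p y \<in> leaf m0\<rbrakk> \<Longrightarrow> P y \<in> E"
  shows "compact_leaf A (leaf m0)"
proof -
  define \<O> where "\<O> = {Q. openin (top_of_set M) Q \<and> (\<exists>T. compactin (leaf_topology A) T \<and> leaf m0 \<inter> Q \<subseteq> T)}"
  have "\<exists>Q\<in>\<O>. m \<in> Q" if m: "m \<in> M" for m
  proof -
    obtain x where x: "x \<in> C" "p x = m" using m covering_space_imp_surjective[OF cov] by blast
    obtain d where d: "d \<in> lifted_atlas C p A" "x \<in> fst d" using lift.chart_at x by blast
    obtain c q where c: "c \<in> A" "snd d = snd c \<circ> p" "p ` fst d \<subseteq> fst c"
      using lifted_chartE[OF d(1)] by metis
    define z where "z = snd d x"
    obtain e where e: "e > 0" "half_box z e \<subseteq> snd d ` fst d"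
      using lift.box_in_chart[OF d] unfolding z_def by blast
    \<comment> \<open>Closed balls of radius \<open>r\<close> still fit into the box of radius
      \<open>e\<close>; they make the plaques and the interval of heights compact.\<close>
    define r where "r = e/2"
    have r: "0 < r" "r < e" using e by (auto simp: r_def)
    have z0: "snd z \<ge> 0" unfolding z_def using lift.snd_snd_nonneg[OF d] .
    have sub: "half_box z r \<subseteq> snd d ` fst d"
      using half_box_mono[of r e z] r e(2) by (meson less_imp_le order_trans)
    define Q where "Q = p ` chart_inv d ` half_box z r"
    have "openin (top_of_set M) Q"
      unfolding Q_def
      by (intro covering_space_open_image[OF cov] lift.open_chart_inv_image[OF d(1) openin_half_box sub])
    moreover have "m \<in> Q"
    proof -
      have "z \<in> half_box z r" using r z0 by (simp add: half_box_def mem_Times_iff)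
      moreover have "p (chart_inv d z) = m" unfolding z_def using lift.chart_inv_snd[OF d] x by simp
      ultimately show ?thesis unfolding Q_def by blast
    qed
    moreover have "\<exists>T. compactin (leaf_topology A) T \<and> leaf m0 \<inter> Q \<subseteq> T"
    proof -
      define h where "h t = P (chart_inv d (fst z, t))" for t
      define J where "J = cball (snd z) r \<inter> {0..}"
      have JI: "J \<subseteq> ball (snd z) e \<inter> {0..}" using r by (auto simp: J_def)
      have "compact (h ` J)"
      proof (rule compact_continuous_image)
        show "continuous_on J h"
          using continuous_on_subset[OF P_box_cont[OF d(1) e(2,1)] JI] unfolding h_def .
        show "compact J" unfolding J_def by (intro compact_Int_closed) auto
      qed
      then have "bounded (h ` J)" by (rule compact_imp_bounded)
      then obtain v where v: "\<And>t. t \<in> J \<Longrightarrow> \<bar>h t\<bar> \<le> v"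
        unfolding bounded_real by blast
      \<comment> \<open>Heights at which the leaf can cross the box. There are finitely many:
        \<open>h\<close> is injective on \<open>J\<close> and its bounded image meets
        \<open>E\<close> in a finite set.\<close>
      define F where "F = {t \<in> J. h t \<in> E}"
      have "finite F"
      proof (rule finite_imageD)
        have "h t \<in> {-v..v} \<inter> E" if "t \<in> F" for t
          using v[of t] that unfolding F_def by (simp add: abs_le_iff)
        then have "h ` F \<subseteq> {-v..v} \<inter> E" by blast
        then show "finite (h ` F)" using fin finite_subset by blast
        show "inj_on h F"
          unfolding h_def by (rule inj_on_subset[OF P_box_inj[OF d(1) e(2,1)]]) (use JI in \<open>auto simp: F_def\<close>)
      qed
      define T where "T = (\<Union>t\<in>F. (\<lambda>x. chart_inv c (x, t)) ` cball (fst z) r)"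
      have dc: "snd d ` fst d \<subseteq> snd c ` fst c"
        using c(3) unfolding c(2) image_comp[symmetric] by (rule image_mono)
      have "compactin (leaf_topology A) ((\<lambda>x. chart_inv c (x, t)) ` cball (fst z) r)" if t: "t \<in> F" for t
      proof -
        have "cball (fst z) r \<times> {t} \<subseteq> half_box z e"
          using r t JI by (auto simp: F_def half_box_def)
        then have "cball (fst z) r \<times> {t} \<subseteq> snd c ` fst c" using e dc by blast
        from chart_inv_leaf_continuous[OF c(1) this] show ?thesis
          by (intro image_compactin[where X = "top_of_set (cball (fst z) r)"])
            (auto simp: compactin_subtopology)
      qed
      then have "compactin (leaf_topology A) T"
        unfolding T_def using \<open>finite F\<close> by (intro compactin_Union) auto
      moreover have "leaf m0 \<inter> Q \<subseteq> T"
      proof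
        fix y assume y: "y \<in> leaf m0 \<inter> Q"
        then obtain w where w: "w \<in> half_box z r" "y = p (chart_inv d w)" unfolding Q_def by blast
        have wd: "w \<in> snd d ` fst d" using sub w by blast
        have wC: "chart_inv d w \<in> fst d" using lift.chart_inv_in[OF d(1) wd] .
        have yc: "y = chart_inv c w"
        proof -
          have "p (chart_inv d w) \<in> fst c" using wC c by blast
          moreover have "snd c (p (chart_inv d w)) = w"
            using lift.snd_chart_inv[OF d(1) wd] by (simp add: c(2))
          ultimately show ?thesis using chart_inv_snd[OF c(1)] w(2) by metis
        qed
        have "P (chart_inv d w) \<in> E"
          using E[of "chart_inv d w"] wC lift.fst_chart_subset[OF d(1)] y w(2) by blast
        moreover have "P (chart_inv d w) = h (snd w)"
          unfolding h_def
          by (rule P_box_slice[OF d(1) e(2) subsetD[OF half_box_mono[OF less_imp_le[OF r(2)]] w(1)]])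
        ultimately have "snd w \<in> F"
          using w(1) unfolding F_def J_def half_box_def by auto
        moreover have "fst w \<in> cball (fst z) r" using w(1) unfolding half_box_def by auto
        moreover have "y = chart_inv c (fst w, snd w)" using yc by simp
        ultimately show "y \<in> T" unfolding T_def by blast
      qed
      ultimately show ?thesis by blast
    qed
    ultimately show ?thesis unfolding \<O>_def by blast
  qed
  then have "M \<subseteq> \<Union>\<O>" by blast
  moreover have "\<forall>Q\<in>\<O>. openin (top_of_set M) Q" unfolding \<O>_def by blast
  ultimately obtain D where D: "D \<subseteq> \<O>" "finite D" "M \<subseteq> \<Union>D"
    using M(1)[unfolded compact_eq_openin_cover, rule_format, of \<O>] by blast
  have "\<forall>Q\<in>D. \<exists>T. compactin (leaf_topology A) T \<and> leaf m0 \<inter> Q \<subseteq> T"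
    using D(1) unfolding \<O>_def by blast
  then obtain T where T: "\<And>Q. Q \<in> D \<Longrightarrow> compactin (leaf_topology A) (T Q)" "\<And>Q. Q \<in> D \<Longrightarrow> leaf m0 \<inter> Q \<subseteq> T Q"
    by metis
  have "compactin (leaf_topology A) (\<Union>(T ` D))"
    using D(2) T(1) by (intro compactin_Union) auto
  moreover have "leaf m0 \<subseteq> \<Union>(T ` D)"
  proof
    fix y assume y: "y \<in> leaf m0"
    then have "y \<in> \<Union>D" using D(3) leaf_subset[of m0] by blast
    then obtain Q where "Q \<in> D" "y \<in> Q" by blast
    then show "y \<in> \<Union>(T ` D)" using T(2)[of Q] y by blast
  qed
  \<comment> \<open>The leaf is closed in the leaf topology, being a connected component.\<close>
  ultimately have "compactin (leaf_topology A) (leaf m0)"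
    by (rule closed_compactin[OF _ _ closedin_connected_component_of])
  then show ?thesis
    unfolding compact_leaf_def using leaves_eq M(2) by blast
qed

lemma closed_saturated_meet:
  assumes M: "compact M" and no_compact: "\<not> (\<exists>L. compact_leaf A L)"
    and K: "closedin (top_of_set M) K1" "closedin (top_of_set M) K2" "K1 \<noteq> {}" "K2 \<noteq> {}"
    and sat: "\<And>m. m \<in> K1 \<Longrightarrow> leaf m \<subseteq> K1" "\<And>m. m \<in> K2 \<Longrightarrow> leaf m \<subseteq> K2"
  shows "K1 \<inter> K2 \<noteq> {}"
proof
  assume disj: "K1 \<inter> K2 = {}"
  let ?S1 = "P ` (C \<inter> p -` K1)" and ?S2 = "P ` (C \<inter> p -` K2)"
  have cl: "closed ?S1" "closed ?S2"
    using closed_shadow[OF K(1,2) sat disj] K sat by blast+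
  have "?S1 \<noteq> {}" "?S2 \<noteq> {}"
    using K covering_space_imp_surjective[OF cov] closedin_imp_subset by blast+
  then obtain a where a: "a \<in> gap_ends ?S1 ?S2"
    using gap_ends_nonempty[OF cl] by blast
  obtain x where x: "x \<in> C" "P x = a" using P_surj by (metis UNIV_I imageE)
  have "finite ({u..v} \<inter> gap_ends ?S1 ?S2)" for u v
    using gap_ends_not_islimpt[OF cl disjoint_shadows[OF K(1,2) sat disj]]
    by (intro finite_not_islimpt_in_compact) auto
  moreover have "P y \<in> gap_ends ?S1 ?S2" if "y \<in> C" "p y \<in> leaf (p x)" for y
    using gap_end_leaf[OF K(1,2) sat disj] x a that by blast
  ultimately have "compact_leaf A (leaf (p x))"
    using compact_leafI[OF M p_in[OF x(1)]] by blast
  then show False using no_compact by blast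
qed

end

section \<open>The Liouville property\<close>

text \<open>In a chart the equation is brought into nondivergence form, to which
  \<open>strong_maximum_principle\<close> applies. The factor \<sigma> treats maxima
  (\<open>\<sigma> = 1\<close>) and minima (\<open>\<sigma> = -1\<close>) at once.\<close>

lemma harmonic_locally_constant_at_extremum:
  fixes M :: "'m::t2_space set" and A :: "('m, 'n::finite) chart set"
  assumes r: "r \<ge> 1" and at: "foliated_atlas r M A" and met: "leafwise_metric r A g"
    and harm: "leafwise_harmonic M A g f"
    and c: "c \<in> A" and m: "m \<in> fst c"
    and \<sigma>: "\<sigma> \<noteq> 0" and max: "\<And>x. x \<in> M \<Longrightarrow> \<sigma> * f x \<le> \<sigma> * f m"
  shows "\<exists>e>0. \<forall>x\<in>slice c m e. f x = f m"
proof -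
  interpret foliation M A using foliated_atlas_imp_foliation[OF at] .
  define \<Omega> where "\<Omega> = snd c ` fst c"
  define x0 t where "x0 = fst (snd c m)" and "t = snd (snd c m)"
  define S where "S = {x. (x, t) \<in> \<Omega>}"
  define U where "U = f \<circ> chart_inv c"
  define G where "G = g c"
  have St: "S \<times> {t} \<subseteq> \<Omega>" "S \<times> {t} \<subseteq> {z \<in> \<Omega>. snd z = t}" unfolding S_def by auto
  have t0: "t \<ge> 0" unfolding t_def using snd_snd_nonneg[OF c m] .
  have x0: "x0 \<in> S" unfolding S_def x0_def t_def \<Omega>_def using m by simp
  have oS: "open S"
  proof (subst open_contains_ball, intro ballI)
    fix x assume "x \<in> S"
    then have "(x, t) \<in> \<Omega>" unfolding S_def by simp
    then obtain e where e: "e > 0" "half_box (x, t) e \<subseteq> \<Omega>"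
      using half_box_subset[OF foliated_chartD(2)[OF chart[OF c]]] unfolding \<Omega>_def by blast
    have "ball x e \<subseteq> S"
    proof
      fix y assume "y \<in> ball x e"
      then have "(y, t) \<in> half_box (x, t) e" using t0 e(1) by (simp add: half_box_def)
      then show "y \<in> S" using e(2) unfolding S_def by blast
    qed
    then show "\<exists>e>0. ball x e \<subseteq> S" using e(1) by blast
  qed
  obtain k where k: "r = Suc k" using r by (cases r) auto
  have GC: "leafwise_C (Suc k) \<Omega> G"
    and Gsym: "\<And>z. z \<in> \<Omega> \<Longrightarrow> transpose (G z) = G z"
    and Gpos: "\<And>z v. \<lbrakk>z \<in> \<Omega>; v \<noteq> 0\<rbrakk> \<Longrightarrow> 0 < v \<bullet> (G z *v v)"
    using met c unfolding leafwise_metric_def k \<Omega>_def G_def by blast+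
  have hc: "\<forall>t. leafwise_C 2 {z \<in> \<Omega>. snd z = t} U" "\<forall>z\<in>\<Omega>. laplace_beltrami G U z = 0"
    using harm c unfolding leafwise_harmonic_def Let_def U_def G_def \<Omega>_def by blast+
  have UC: "leafwise_C (Suc (Suc 0)) {z \<in> \<Omega>. snd z = t} U"
    using hc(1) by (simp only: numeral_2_eq_2)
  define u1 where "u1 j x = leaf_partial j U (x, t)" for j x
  define u2 where "u2 i j x = leaf_partial i (leaf_partial j U) (x, t)" for i j x
  have u: "C1_along_axes S (\<lambda>x. U (x, t)) u1"
    unfolding u1_def by (rule leafwise_C_imp_C1_along_axes[OF UC St(2) bounded_linear_ident])
  have u': "C1_along_axes S (u1 j) (\<lambda>i. u2 i j)" for j
  proof -
    have "leafwise_C (Suc 0) {z \<in> \<Omega>. snd z = t} (leaf_partial j U)" 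
      using UC unfolding leafwise_C.simps(2)[of "Suc 0"] by blast
    from leafwise_C_imp_C1_along_axes[OF this St(2) bounded_linear_ident]
    show ?thesis unfolding u1_def u2_def .
  qed
  have X: "\<exists>f'. C1_along_axes S (\<lambda>x. G (x, t) $ i $ j) f'" for i j
    using leafwise_C_imp_C1_along_axes[OF GC St(1)
        bounded_linear_compose[OF bounded_linear_vec_nth bounded_linear_vec_nth]] by blast
  have pos: "0 < v \<bullet> (G (x, t) *v v)" if "x \<in> S" "v \<noteq> 0" for x v
    using Gpos that unfolding S_def by blast
  define \<rho> where "\<rho> x = sqrt (det (G (x, t)))" for x
  have \<rho>: "\<rho> x > 0" if "x \<in> S" for x
    unfolding \<rho>_def using posdef_det_pos[OF pos[OF that]] by simp
  define B where "B x = matrix_inv (G (x, t))" for x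
  \<comment> \<open>Multiplying the equation by the positive density \<open>\<rho>\<close> clears
    the denominator of \<open>laplace_beltrami\<close>.\<close>
  define a where "a i j x = \<rho> x * B x $ i $ j" for i j x
  have "\<exists>f'. C1_along_axes S (a i j) f'" for i j
    unfolding a_def \<rho>_def B_def by (rule C1_along_axes_laplace_coefficient[OF oS X pos])
  then have "\<forall>i. \<forall>j. \<exists>f'. C1_along_axes S (a i j) f'" by blast
  then obtain a' where a': "\<And>i j. C1_along_axes S (a i j) (a' i j)" by metis
  \<comment> \<open>The divergence of the coefficient matrix: the product rule leaves it as the
    first-order coefficient when the divergence form is expanded.\<close>
  define b where "b j x = (\<Sum>i\<in>UNIV. a' i j i x)" for j x
  have eq: "(\<Sum>i\<in>UNIV. \<Sum>j\<in>UNIV. a i j x * u2 i j x) + (\<Sum>j\<in>UNIV. b j x * u1 j x) = 0"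
    if x: "x \<in> S" for x
  proof -
    have flux: "leaf_partial i (\<lambda>w. sqrt (det (G w)) * (\<Sum>j\<in>UNIV. matrix_inv (G w) $ i $ j * leaf_partial j U w)) (x, t)
      = (\<Sum>j\<in>UNIV. a' i j i x * u1 j x + u2 i j x * a i j x)" for i
    proof -
      define H where "H w = sqrt (det (G w)) * (\<Sum>j\<in>UNIV. matrix_inv (G w) $ i $ j * leaf_partial j U w)" for w
      have "H (y, t) = (\<Sum>j\<in>UNIV. a i j y * u1 j y)" for y
        unfolding H_def a_def \<rho>_def B_def u1_def by (simp add: sum_distrib_left mult.assoc)
      then have "C1_along_axes S (\<lambda>y. H (y, t))
          (\<lambda>l y. \<Sum>j\<in>UNIV. a' i j l y * u1 j y + u2 l j y * a i j y)"
        using C1_along_axes_sum[OF finite C1_along_axes_mult[OF a' u']] by simp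
      from C1_along_axes_imp_leaf_partial[OF this x, of i]
      show ?thesis unfolding H_def .
    qed
    have "laplace_beltrami G U (x, t) = 0" using hc(2) x unfolding S_def by blast
    then have "(\<Sum>i\<in>UNIV. \<Sum>j\<in>UNIV. a' i j i x * u1 j x + u2 i j x * a i j x) = 0"
      unfolding laplace_beltrami_def flux using \<rho>[OF x] unfolding \<rho>_def by simp
    moreover have "(\<Sum>i\<in>UNIV. \<Sum>j\<in>UNIV. a' i j i x * u1 j x) = (\<Sum>j\<in>UNIV. b j x * u1 j x)"
      unfolding b_def sum_distrib_right by (rule sum.swap)
    ultimately show ?thesis by (simp add: sum.distrib mult.commute)
  qed
  have apos: "0 < (\<Sum>i\<in>UNIV. \<Sum>j\<in>UNIV. v $ i * a i j x * v $ j)" if "x \<in> S" "v \<noteq> 0" for x v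
  proof -
    have "0 < v \<bullet> (B x *v v)"
      unfolding B_def using posdef_inv(1)[OF pos[OF that(1)] Gsym that(2)] that(1) unfolding S_def by simp
    then show ?thesis
      unfolding a_def posdef_form using \<rho>[OF that(1)] by simp
  qed
  have asym: "a i j x = a j i x" if "x \<in> S" for i j x
  proof -
    have "transpose (B x) = B x"
      unfolding B_def using posdef_inv(2)[OF pos[OF that] Gsym] that unfolding S_def by simp
    then have "transpose (B x) $ i $ j = B x $ i $ j" by simp
    then show ?thesis unfolding a_def by (simp add: transpose_def)
  qed
  have v: "C1_along_axes S (\<lambda>x. \<sigma> * U (x, t)) (\<lambda>i x. \<sigma> * u1 i x)"
    "\<And>j. C1_along_axes S (\<lambda>x. \<sigma> * u1 j x) (\<lambda>i x. \<sigma> * u2 i j x)"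
    using C1_along_axes_cmult u u' by blast+
  have bcont: "continuous_on S (b j)" for j
    unfolding b_def by (intro continuous_intros C1_along_axesD(2)[OF a'])
  have veq: "(\<Sum>i\<in>UNIV. \<Sum>j\<in>UNIV. a i j x * (\<sigma> * u2 i j x)) + (\<Sum>j\<in>UNIV. b j x * (\<sigma> * u1 j x)) = 0"
    if "x \<in> S" for x
  proof -
    have "(\<Sum>i\<in>UNIV. \<Sum>j\<in>UNIV. a i j x * (\<sigma> * u2 i j x)) + (\<Sum>j\<in>UNIV. b j x * (\<sigma> * u1 j x))
      = \<sigma> * ((\<Sum>i\<in>UNIV. \<Sum>j\<in>UNIV. a i j x * u2 i j x) + (\<Sum>j\<in>UNIV. b j x * u1 j x))"
      by (simp add: distrib_left sum_distrib_left mult_ac)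
    then show ?thesis using eq[OF that] by simp
  qed
  have Um: "U (x0, t) = f m" unfolding U_def x0_def t_def using chart_inv_snd[OF c m] by simp
  have vmax: "\<sigma> * U (x, t) \<le> \<sigma> * U (x0, t)" if "x \<in> S" for x
  proof -
    have "chart_inv c (x, t) \<in> M"
      using that chart_inv_in[OF c] fst_chart_subset[OF c] unfolding S_def \<Omega>_def by blast
    from max[OF this] show ?thesis unfolding Um by (simp add: U_def)
  qed
  obtain e where e: "e > 0" "\<And>y. y \<in> ball x0 e \<Longrightarrow> \<sigma> * U (y, t) = \<sigma> * U (x0, t)"
    using strong_maximum_principle[OF oS v C1_along_axesD(1)[OF a'] asym apos bcont veq x0 vmax] by blast
  have "f x = f m" if x: "x \<in> slice c m e" for x
  proof -
    have xc: "x \<in> fst c" "snd (snd c x) = t" "fst (snd c x) \<in> ball x0 e"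
      using x unfolding slice_def t_def x0_def by auto
    have "(fst (snd c x), t) = snd c x" using xc(2) by (simp add: prod_eq_iff)
    then have "U (fst (snd c x), t) = f x" unfolding U_def using chart_inv_snd[OF c xc(1)] by simp
    then show ?thesis using e(2)[OF xc(3)] \<sigma> Um by simp
  qed
  then show ?thesis using e(1) by blast
qed

text \<open>Membership in the level set is locally constant on leaves: at its points by the maximum
  principle, elsewhere by continuity of \<open>f\<close>.\<close>

lemma harmonic_extremum_saturated:
  fixes M :: "'m::t2_space set" and A :: "('m, 'n::finite) chart set"
  assumes r: "r \<ge> 1" and at: "foliated_atlas r M A" and met: "leafwise_metric r A g"
    and harm: "leafwise_harmonic M A g f"
    and \<sigma>: "\<sigma> \<noteq> 0" and max: "\<And>x. x \<in> M \<Longrightarrow> \<sigma> * f x \<le> \<sigma> * K"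
    and m: "m \<in> {x \<in> M. f x = K}"
  shows "connected_component_of_set (leaf_topology A) m \<subseteq> {x \<in> M. f x = K}"
proof
  interpret foliation M A using foliated_atlas_imp_foliation[OF at] .
  fix x assume x: "x \<in> leaf m"
  show "x \<in> {x \<in> M. f x = K}"
  proof (rule leaf_invariant[OF _ x m])
    fix y assume y: "y \<in> M"
    show "\<exists>N. openin (leaf_topology A) N \<and> y \<in> N \<and> (\<forall>x\<in>N. x \<in> {x \<in> M. f x = K} \<longleftrightarrow> y \<in> {x \<in> M. f x = K})"
    proof (cases "f y = K")
      case True
      obtain c where c: "c \<in> A" "y \<in> fst c" using chart_at y by blast
      have "\<exists>e>0. \<forall>x\<in>slice c y e. f x = f y"
        by (rule harmonic_locally_constant_at_extremum[OF r at met harm c \<sigma>]) (use max True in simp)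
      then obtain e where e: "e > 0" "\<And>x. x \<in> slice c y e \<Longrightarrow> f x = f y" by blast
      have "slice c y e \<subseteq> M" using fst_chart_subset[OF c(1)] unfolding slice_def by blast
      moreover have "y \<in> slice c y e" using c e by (simp add: slice_def)
      ultimately show ?thesis using slice_leaf_open[OF c(1), of y e] e(2) True y
        by (intro exI[of _ "slice c y e"]) auto
    next
      case False
      have "continuous_on M f" using harm unfolding leafwise_harmonic_def by blast
      then have "openin (top_of_set M) (M \<inter> f -` (- {K}))"
        by (rule continuous_openin_preimage_gen) auto
      from open_imp_leaf_open[OF this] show ?thesis
        using False y by (intro exI[of _ "M \<inter> f -` (- {K})"]) auto
    qed
  qed
qed

theorem proposition1p1:
  fixes M :: "'m::t2_space set"
    and A :: "('m, 'n::finite) chart set"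
    and g :: "('m, 'n) chart \<Rightarrow> 'n coords \<Rightarrow> real ^ 'n ^ 'n"
    and C :: "'c::topological_space set"
    and p :: "'c \<Rightarrow> 'm"
    and r :: nat
  assumes "r \<ge> 2"
    and "compact M" and "connected M"
    and "foliated_atlas r M A"
    and "leafwise_metric r A g"
    and "universal_cover C p M"
    and "R_covered C p A"
    and "\<not> (\<exists>L. compact_leaf A L)"
  shows "liouville_property M A g"
  unfolding liouville_property_def
proof (intro allI impI ballI)
  fix f L assume harm: "leafwise_harmonic M A g f" and L: "L \<in> leaves A"
  have fol: "foliation M A" using foliated_atlas_imp_foliation[OF assms(4)] .
  interpret covered_foliation M A C p
    using fol assms(6) unfolding universal_cover_def
    by (auto simp: covered_foliation_def covered_foliation_axioms_def)
  obtain P where "R_covered_foliation M A C p P" using R_covered_imp[OF assms(7)] .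
  then interpret R_covered_foliation M A C p P .
  have f: "continuous_on M f" using harm unfolding leafwise_harmonic_def by blast
  obtain m0 where m0: "m0 \<in> M" "L = leaf m0" using L leaves_eq by auto
  obtain s where s: "s \<in> M" "\<And>x. x \<in> M \<Longrightarrow> f x \<le> f s"
    using continuous_attains_sup[OF assms(2) _ f] m0 by blast
  obtain i where i: "i \<in> M" "\<And>x. x \<in> M \<Longrightarrow> f i \<le> f x"
    using continuous_attains_inf[OF assms(2) _ f] m0 by blast
  have r: "1 \<le> r" using assms(1) by simp
  have closed: "closedin (top_of_set M) {x \<in> M. f x = K}" for K
    by (rule continuous_closedin_preimage_constant[OF f])
  have "{x \<in> M. f x = f s} \<inter> {x \<in> M. f x = f i} \<noteq> {}"
  proof (rule closed_saturated_meet[OF assms(2,8) closed closed])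
    show "leaf m \<subseteq> {x \<in> M. f x = f s}" if "m \<in> {x \<in> M. f x = f s}" for m
      by (rule harmonic_extremum_saturated[OF r assms(4,5) harm, of 1]) (use s that in auto)
    show "leaf m \<subseteq> {x \<in> M. f x = f i}" if "m \<in> {x \<in> M. f x = f i}" for m
      by (rule harmonic_extremum_saturated[OF r assms(4,5) harm, of "-1"]) (use i that in auto)
  qed (use s i in auto)
  \<comment> \<open>At a common point the maximum and the minimum agree, so \<open>f\<close> is
    constant on all of \<open>M\<close>.\<close>
  then have "f s = f i" by auto
  then have "f x = f s" if "x \<in> M" for x using s(2)[OF that] i(2)[OF that] by simp
  then show "f constant_on L"
    unfolding constant_on_def m0(2) using leaf_subset by blast
qed

end
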